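(* Let $M=\mathbb{C}^{5|6}$ with even coordinates $x,u,u_x,u_{xx},z$ and odd coordinates $\nu,\tau,u_\nu,u_\tau,u_{x\nu},u_{x\tau}$, and let $\mathcal D$ be the rank $(2|4)$ superdistribution (the Cartan distribution of the super Hilbert--Cartan (SHC) equation $z_x=\tfrac12u_{xx}^2+u_{x\nu}u_{x\tau}$, $z_\nu=u_{xx}u_{x\nu}$, $z_\tau=u_{xx}u_{x\tau}$, $u_{\nu\tau}=-u_{xx}$) spanned by $D_x=\partial_x+u_x\partial_u+u_{xx}\partial_{u_x}+(\tfrac12u_{xx}^2+u_{x\nu}u_{x\tau})\partial_z+u_{x\tau}\partial_{u_\tau}+u_{x\nu}\partial_{u_\nu}$, $\ \partial_{u_{xx}}$ (even), and $D_\tau=\partial_\tau+u_\tau\partial_u+u_{x\tau}\partial_{u_x}+u_{xx}u_{x\tau}\partial_z+u_{xx}\partial_{u_\nu}$, $\ \partial_{u_{x\tau}}$, $\ D_\nu=\partial_\nu+u_\nu\partial_u+u_{x\nu}\partial_{u_x}+u_{xx}u_{x\nu}\partial_z-u_{xx}\partial_{u_\tau}$, $\ \partial_{u_{x\nu}}$ (odd). Then the internal symmetry superalgebra $\{\mathbf X:\mathcal L_{\mathbf X}\mathcal D\subset\mathcal D\}$ of $\mathcal D$ is isomorphic to $G(3)$; in particular it has dimension $(17|14)$.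
   Context: $G(3)$ denotes the complex exceptional simple Lie superalgebra of dimension $(17|14)$ with even part $G(2)\oplus\mathfrak{sl}(2)$ and odd part $\mathbb{C}^7\boxtimes\mathbb{C}^2$. *)

theory Defs
  imports "HOL-Analysis.Analysis" "HOL-Complex_Analysis.Complex_Analysis" "HOL-Library.Numeral_Type"
begin

text \<open>Even coordinates (indices of type 5): 0 = x, 1 = u, 2 = u_x, 3 = u_xx, 4 = z.
  Odd coordinates (indices of type 6): 0 = nu, 1 = tau, 2 = u_nu, 3 = u_tau, 4 = u_xnu, 5 = u_xtau.
  A superfunction is f = sum_S f_S(x) theta_S, theta_S the product of the odd coordinates
  in S in increasing order; it is represented by S \<mapsto> f_S.\<close>

type_synonym sfun = "6 set \<Rightarrow> complex^5 \<Rightarrow> complex"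

definition cupd :: "complex^5 \<Rightarrow> 5 \<Rightarrow> complex \<Rightarrow> complex^5" where
  "cupd p i z = (\<chi> j. if j = i then z else p $ j)"

definition hol5 :: "(complex^5 \<Rightarrow> complex) \<Rightarrow> bool" where
  "hol5 g \<longleftrightarrow> continuous_on UNIV g \<and> (\<forall>p i. (\<lambda>z. g (cupd p i z)) holomorphic_on UNIV)"

definition sfun_ok :: "sfun \<Rightarrow> bool" where
  "sfun_ok f \<longleftrightarrow> (\<forall>S. hol5 (f S))"

definition szero :: sfun where "szero = (\<lambda>S p. 0)"
definition sconst :: "complex \<Rightarrow> sfun" where "sconst c = (\<lambda>S p. if S = {} then c else 0)"
definition evc :: "5 \<Rightarrow> sfun" where "evc i = (\<lambda>S p. if S = {} then p $ i else 0)"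
definition odc :: "6 \<Rightarrow> sfun" where "odc k = (\<lambda>S p. if S = {k} then 1 else 0)"
definition sadd :: "sfun \<Rightarrow> sfun \<Rightarrow> sfun" where "sadd f g = (\<lambda>S p. f S p + g S p)"
definition sscale :: "complex \<Rightarrow> sfun \<Rightarrow> sfun" where "sscale c f = (\<lambda>S p. c * f S p)"

text \<open>theta_S theta_T = inv_sign S T theta_(S \<union> T) for disjoint S, T.\<close>
definition inv_sign :: "6 set \<Rightarrow> 6 set \<Rightarrow> complex" where
  "inv_sign S T = (-1) ^ card {(a, b). a \<in> S \<and> b \<in> T \<and> b < a}"

definition smult :: "sfun \<Rightarrow> sfun \<Rightarrow> sfun" where
  "smult f g = (\<lambda>U p. \<Sum>S\<in>Pow U. inv_sign S (U - S) * f S p * g (U - S) p)"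

definition pdx :: "5 \<Rightarrow> sfun \<Rightarrow> sfun" where
  "pdx i f = (\<lambda>S p. deriv (\<lambda>z. f S (cupd p i z)) (p $ i))"

definition pdth :: "6 \<Rightarrow> sfun \<Rightarrow> sfun" where
  "pdth k f = (\<lambda>T p. if k \<in> T then 0 else (-1) ^ card {j\<in>T. j < k} * f (insert k T) p)"

definition sf_part :: "bool \<Rightarrow> sfun \<Rightarrow> sfun" where
  "sf_part b f = (\<lambda>S. if odd (card S) = b then f S else (\<lambda>p. 0))"

text \<open>X = sum_i (fst X i) d/dx_i + sum_k (snd X k) d/dtheta_k.\<close>
type_synonym vf = "(5 \<Rightarrow> sfun) \<times> (6 \<Rightarrow> sfun)"

definition vf_ok :: "vf \<Rightarrow> bool" where
  "vf_ok X \<longleftrightarrow> (\<forall>i. sfun_ok (fst X i)) \<and> (\<forall>k. sfun_ok (snd X k))"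

definition vapp :: "vf \<Rightarrow> sfun \<Rightarrow> sfun" where
  "vapp X f = (\<lambda>S p. (\<Sum>i\<in>UNIV. smult (fst X i) (pdx i f) S p)
                    + (\<Sum>k\<in>UNIV. smult (snd X k) (pdth k f) S p))"

definition vf_zero :: vf where "vf_zero = (\<lambda>i. szero, \<lambda>k. szero)"
definition vf_add :: "vf \<Rightarrow> vf \<Rightarrow> vf" where
  "vf_add X Y = (\<lambda>i. sadd (fst X i) (fst Y i), \<lambda>k. sadd (snd X k) (snd Y k))"
definition vf_scale :: "complex \<Rightarrow> vf \<Rightarrow> vf" where
  "vf_scale c X = (\<lambda>i. sscale c (fst X i), \<lambda>k. sscale c (snd X k))"
definition vf_cmul :: "sfun \<Rightarrow> vf \<Rightarrow> vf" where
  "vf_cmul f X = (\<lambda>i. smult f (fst X i), \<lambda>k. smult f (snd X k))"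

text \<open>Parity components of a vector field (True = odd); d/dtheta_k is odd.\<close>
definition vf_part :: "bool \<Rightarrow> vf \<Rightarrow> vf" where
  "vf_part b X = (\<lambda>i. sf_part b (fst X i), \<lambda>k. sf_part (\<not> b) (snd X k))"

definition vf_hom :: "bool \<Rightarrow> vf \<Rightarrow> bool" where
  "vf_hom b X \<longleftrightarrow> vf_part b X = X"

definition hbr :: "bool \<Rightarrow> bool \<Rightarrow> vf \<Rightarrow> vf \<Rightarrow> vf" where
  "hbr a b X Y = (let s = (if a \<and> b then 1 else -1) in
     (\<lambda>i. sadd (vapp X (fst Y i)) (sscale s (vapp Y (fst X i))),
      \<lambda>k. sadd (vapp X (snd Y k)) (sscale s (vapp Y (snd X k)))))"

definition brk :: "vf \<Rightarrow> vf \<Rightarrow> vf" where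
  "brk X Y = vf_add (vf_add (hbr False False (vf_part False X) (vf_part False Y))
                            (hbr False True (vf_part False X) (vf_part True Y)))
                    (vf_add (hbr True False (vf_part True X) (vf_part False Y))
                            (hbr True True (vf_part True X) (vf_part True Y)))"

definition Dx :: vf where
  "Dx = ((\<lambda>i. if i = 0 then sconst 1 else if i = 1 then evc 2 else if i = 2 then evc 3
            else if i = 4 then sadd (sscale (1/2) (smult (evc 3) (evc 3))) (smult (odc 4) (odc 5))
            else szero),
         (\<lambda>k. if k = 3 then odc 5 else if k = 2 then odc 4 else szero))"

definition Duxx :: vf where
  "Duxx = ((\<lambda>i. if i = 3 then sconst 1 else szero), (\<lambda>k. szero))"

definition Dtau :: vf where
  "Dtau = ((\<lambda>i. if i = 1 then odc 3 else if i = 2 then odc 5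
             else if i = 4 then smult (evc 3) (odc 5) else szero),
           (\<lambda>k. if k = 1 then sconst 1 else if k = 2 then evc 3 else szero))"

definition Duxtau :: vf where
  "Duxtau = ((\<lambda>i. szero), (\<lambda>k. if k = 5 then sconst 1 else szero))"

definition Dnu :: vf where
  "Dnu = ((\<lambda>i. if i = 1 then odc 2 else if i = 2 then odc 4
            else if i = 4 then smult (evc 3) (odc 4) else szero),
          (\<lambda>k. if k = 0 then sconst 1 else if k = 3 then sscale (-1) (evc 3) else szero))"

definition Duxnu :: vf where
  "Duxnu = ((\<lambda>i. szero), (\<lambda>k. if k = 4 then sconst 1 else szero))"

definition shc_gen :: "nat \<Rightarrow> vf" where
  "shc_gen j = [Dx, Duxx, Dtau, Duxtau, Dnu, Duxnu] ! j"

primrec vf_comb :: "(nat \<Rightarrow> sfun) \<Rightarrow> (nat \<Rightarrow> vf) \<Rightarrow> nat \<Rightarrow> vf" where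
  "vf_comb c e 0 = vf_zero"
| "vf_comb c e (Suc n) = vf_add (vf_comb c e n) (vf_cmul (c n) (e n))"

definition inD :: "vf \<Rightarrow> bool" where
  "inD Y \<longleftrightarrow> (\<exists>c. (\<forall>j<6. sfun_ok (c j)) \<and> Y = vf_comb c shc_gen 6)"

definition shc_sym :: "vf set" where
  "shc_sym = {X. vf_ok X \<and> (\<forall>Y. inD Y \<longrightarrow> inD (brk X Y))}"

primrec vf_lincomb :: "(nat \<Rightarrow> complex) \<Rightarrow> (nat \<Rightarrow> vf) \<Rightarrow> nat \<Rightarrow> vf" where
  "vf_lincomb c e 0 = vf_zero"
| "vf_lincomb c e (Suc n) = vf_add (vf_lincomb c e n) (vf_scale (c n) (e n))"

definition vf_cdim :: "vf set \<Rightarrow> nat \<Rightarrow> bool" where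
  "vf_cdim V n \<longleftrightarrow> (\<exists>e. (\<forall>i<n. e i \<in> V)
      \<and> (\<forall>c. vf_lincomb c e n = vf_zero \<longrightarrow> (\<forall>i<n. c i = 0))
      \<and> (\<forall>X\<in>V. \<exists>c. X = vf_lincomb c e n))"

text \<open>g_0 = g2 + sl2 with g2 the stabiliser in gl(7,C) of the generic 3-form phi
  (octonionic), g_1 = C^7 \<otimes> C^2 realised as 7x2 matrices.\<close>

definition phi_triples :: "(7 \<times> 7 \<times> 7 \<times> complex) list" where
  "phi_triples = [(0,1,2,1), (0,3,4,1), (0,5,6,1), (1,3,5,1), (1,4,6,-1), (2,3,6,-1), (2,4,5,-1)]"

definition phi :: "7 \<Rightarrow> 7 \<Rightarrow> 7 \<Rightarrow> complex" where
  "phi i j k = (\<Sum>(a,b,c,s)\<leftarrow>phi_triples.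
      s * ((if (i,j,k) = (a,b,c) \<or> (i,j,k) = (b,c,a) \<or> (i,j,k) = (c,a,b) then 1 else 0)
         - (if (i,j,k) = (b,a,c) \<or> (i,j,k) = (a,c,b) \<or> (i,j,k) = (c,b,a) then 1 else 0)))"

definition phiF :: "complex^7 \<Rightarrow> complex^7 \<Rightarrow> complex^7 \<Rightarrow> complex" where
  "phiF u v w = (\<Sum>i\<in>UNIV. \<Sum>j\<in>UNIV. \<Sum>k\<in>UNIV. phi i j k * u$i * v$j * w$k)"

definition g2set :: "(complex^7^7) set" where
  "g2set = {A. \<forall>u v w. phiF (A *v u) v w + phiF u (A *v v) w + phiF u v (A *v w) = 0}"

definition cross_mat :: "complex^7 \<Rightarrow> complex^7^7" where
  "cross_mat u = (\<chi> k j. \<Sum>i\<in>UNIV. phi i j k * u$i)"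

definition cvec :: "complex^7^7 \<Rightarrow> complex^7" where
  "cvec X = (\<chi> k. \<Sum>i\<in>UNIV. \<Sum>j\<in>UNIV. phi i j k * X$i$j)"

text \<open>Projection so(7) \<rightarrow> g2.\<close>
definition g2proj :: "complex^7^7 \<Rightarrow> complex^7^7" where
  "g2proj X = X + (\<chi> i j. (1/6) * (cross_mat (cvec X))$i$j)"

definition J2 :: "complex^2^2" where
  "J2 = (\<chi> i j. if i = 0 \<and> j = 1 then 1 else if i = 1 \<and> j = 0 then -1 else 0)"

definition msc :: "complex \<Rightarrow> complex^'n^'m \<Rightarrow> complex^'n^'m" where
  "msc c A = (\<chi> i j. c * A$i$j)"

type_synonym g3 = "(complex^7^7) \<times> (complex^2^2) \<times> (complex^2^7)"

definition g3_carrier :: "g3 set" where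
  "g3_carrier = {(A, B, M). A \<in> g2set \<and> trace B = 0}"

definition g3_even :: "g3 \<Rightarrow> bool" where "g3_even x \<longleftrightarrow> snd (snd x) = 0"
definition g3_odd :: "g3 \<Rightarrow> bool" where "g3_odd x \<longleftrightarrow> fst x = 0 \<and> fst (snd x) = 0"

definition g3_add :: "g3 \<Rightarrow> g3 \<Rightarrow> g3" where
  "g3_add x y = (fst x + fst y, fst (snd x) + fst (snd y), snd (snd x) + snd (snd y))"
definition g3_scale :: "complex \<Rightarrow> g3 \<Rightarrow> g3" where
  "g3_scale c x = (msc c (fst x), msc c (fst (snd x)), msc c (snd (snd x)))"

definition g3_act :: "complex^7^7 \<Rightarrow> complex^2^2 \<Rightarrow> complex^2^7 \<Rightarrow> complex^2^7" where
  "g3_act A B M = A ** M + M ** transpose B"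

definition g3_bracket :: "g3 \<Rightarrow> g3 \<Rightarrow> g3" where
  "g3_bracket x y = (case x of (A, B, M) \<Rightarrow> case y of (A', B', M') \<Rightarrow>
     (A ** A' - A' ** A + msc 3 (g2proj (M ** J2 ** transpose M' + M' ** J2 ** transpose M)),
      B ** B' - B' ** B + msc 2 ((transpose M' ** M + transpose M ** M') ** J2),
      g3_act A B M' - g3_act A' B' M))"

end

theory Submission
  imports Defs "HOL-Library.Function_Algebras"
begin

text \<open>The distribution is left-invariant for a nilpotent supergroup. Completing the six generators to a frame
  adapted to the derived flag, a symmetry is encoded by its coefficients in this frame; those transverse to the
  distribution satisfy linear equations under the frame derivations. Applying the commutation relations of these
  derivations repeatedly closes the system up: every frame derivative of 31 suitable functions is again a linear
  combination of them, so a symmetry is determined by the values of these functions at the origin. Conversely 31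
  explicit polynomial symmetries realise all values. Their structure constants coincide with those of a basis of
  the matrix model of G(3). The polynomial and matrix identities involved are decided by sparse normal forms whose
  correctness is proved once.\<close>

text \<open>\<open>shc_sym\<close> contains every holomorphic symmetry, not only polynomial or
  homogeneous ones. Hence the calculus of entire functions of five variables has to be settled
  first, and Koszul signs of functions without parity are carried by the automorphism
  \<open>alpha\<close> instead of by case distinctions. That the system closes at 31 reflects the
  grading of depth three on G(3) attached to the distribution: the unknowns have weights -3, ..., 3
  with dimensions (2|0), (1|2), (2|4), (7|2), (2|4), (1|2), (2|0). Beyond the last weight the
  relations force all derivatives to vanish, so the top unknowns are constant, and vanishing at the
  origin descends through the levels. On both sides of the isomorphism the basis consists of three
  commuting elements that act diagonally and of simultaneous eigenvectors of them, scaled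
  compatibly; this keeps the bracket table short and lets one table be verified in both algebras.
  All numerical data are integers or Gaussian integers, so that rewriting can decide the
  identities.\<close>

section \<open>Entire functions of five variables and their partial derivatives\<close>

definition pdf :: "5 \<Rightarrow> (complex^5 \<Rightarrow> complex) \<Rightarrow> complex^5 \<Rightarrow> complex" where
  "pdf i g p = deriv (\<lambda>z. g (cupd p i z)) (p $ i)"

lemma cupd_nth: "cupd p i z $ j = (if j = i then z else p $ j)"
  by (simp add: cupd_def)

lemma cupd_self [simp]: "cupd p i (p $ i) = p"
  by (simp add: vec_eq_iff cupd_nth)

lemma cupd_cupd [simp]: "cupd (cupd p i z) i w = cupd p i w"
  by (simp add: vec_eq_iff cupd_nth)

lemma cupd_commute: "i \<noteq> j \<Longrightarrow> cupd (cupd p i z) j w = cupd (cupd p j w) i z"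
  by (simp add: vec_eq_iff cupd_nth)

lemma continuous_on_cupd [continuous_intros]:
  assumes "continuous_on A f" "continuous_on A g"
  shows "continuous_on A (\<lambda>x. cupd (f x) i (g x))"
  unfolding cupd_def
proof (rule continuous_on_vec_lambda)
  fix j show "continuous_on A (\<lambda>x. if j = i then g x else f x $ j)"
    using assms by (cases "j = i") (auto intro: continuous_intros)
qed

lemma hol5_cont: "hol5 g \<Longrightarrow> continuous_on UNIV g"
  and hol5_hol: "hol5 g \<Longrightarrow> (\<lambda>z. g (cupd p i z)) holomorphic_on UNIV"
  by (auto simp: hol5_def)

lemma hol5_continuous_on_compose:
  assumes "hol5 g" "continuous_on A f"
  shows "continuous_on A (\<lambda>x. g (f x))"
  using continuous_on_compose2[OF hol5_cont[OF assms(1)] assms(2)] by auto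

lemma hol5_has_pdf:
  assumes "hol5 g"
  shows "((\<lambda>z. g (cupd p i z)) has_field_derivative pdf i g (cupd p i w)) (at w)"
  using holomorphic_derivI[OF hol5_hol[OF assms] open_UNIV UNIV_I]
  by (simp add: pdf_def cupd_nth)

lemma hol5_const [intro, simp]: "hol5 (\<lambda>p. c)"
  by (simp add: hol5_def)

lemma hol5_coord [intro, simp]: "hol5 (\<lambda>p. p $ i)"
proof -
  have "(\<lambda>z. if i = j then z else p $ i) holomorphic_on UNIV" for p j
    by (cases "i = j") auto
  then show ?thesis by (auto simp: hol5_def cupd_nth intro!: continuous_intros)
qed

lemma hol5_add [intro, simp]: "hol5 f \<Longrightarrow> hol5 g \<Longrightarrow> hol5 (\<lambda>p. f p + g p)"
  by (auto simp: hol5_def intro!: continuous_intros holomorphic_intros)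

lemma hol5_mult [intro, simp]: "hol5 f \<Longrightarrow> hol5 g \<Longrightarrow> hol5 (\<lambda>p. f p * g p)"
  by (auto simp: hol5_def intro!: continuous_intros holomorphic_intros)

lemma hol5_sum [intro, simp]: "(\<And>a. a \<in> A \<Longrightarrow> hol5 (f a)) \<Longrightarrow> hol5 (\<lambda>p. \<Sum>a\<in>A. f a p)"
  by (auto simp: hol5_def intro!: continuous_intros holomorphic_intros)

lemma pdf_const [simp]: "pdf i (\<lambda>p. c) = (\<lambda>p. 0)"
  by (simp add: pdf_def fun_eq_iff)

lemma pdf_eqI:
  assumes "((\<lambda>z. g (cupd p i z)) has_field_derivative d) (at (p $ i))"
  shows "pdf i g p = d"
  using DERIV_imp_deriv[OF assms] by (simp add: pdf_def)

lemma pdf_add: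
  assumes "hol5 f" "hol5 g"
  shows "pdf i (\<lambda>p. f p + g p) = (\<lambda>p. pdf i f p + pdf i g p)"
proof
  fix p show "pdf i (\<lambda>p. f p + g p) p = pdf i f p + pdf i g p"
    by (rule pdf_eqI, rule derivative_eq_intros,
        (rule hol5_has_pdf[OF assms(1)] hol5_has_pdf[OF assms(2)])+) simp
qed

lemma pdf_mult:
  assumes "hol5 f" "hol5 g"
  shows "pdf i (\<lambda>p. f p * g p) = (\<lambda>p. pdf i f p * g p + f p * pdf i g p)"
proof
  fix p show "pdf i (\<lambda>p. f p * g p) p = pdf i f p * g p + f p * pdf i g p"
    by (rule pdf_eqI, rule derivative_eq_intros,
        (rule hol5_has_pdf[OF assms(1)] hol5_has_pdf[OF assms(2)])+) (simp add: algebra_simps)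
qed

lemma pdf_cmult:
  assumes "hol5 f"
  shows "pdf i (\<lambda>p. c * f p) = (\<lambda>p. c * pdf i f p)"
  using pdf_mult[OF hol5_const[of c] assms] by simp

lemma pdf_sum:
  assumes "finite A" "\<And>a. a \<in> A \<Longrightarrow> hol5 (f a)"
  shows "pdf i (\<lambda>p. \<Sum>a\<in>A. f a p) = (\<lambda>p. \<Sum>a\<in>A. pdf i (f a) p)"
  using assms by (induction rule: finite_induct) (simp_all add: pdf_add)

text \<open>Cauchy's formula for the derivative on the unit circle; as an integral over translates of g it can be
  differentiated in the other variables, which gives both holomorphy of the partial derivatives and their symmetry.\<close>

lemma pdf_integral:
  assumes "continuous_on UNIV g" "(\<lambda>z. g (cupd p i z)) holomorphic_on UNIV"
  shows "pdf i g p = integral (cbox 0 1)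
    (\<lambda>t. g (cupd p i (p $ i + exp (2 * of_real pi * \<i> * of_real t))) / exp (2 * of_real pi * \<i> * of_real t))"
proof -
  let ?f = "\<lambda>z. g (cupd p i z)" and ?e = "\<lambda>t::real. exp (2 * of_real pi * \<i> * of_real t)"
  have "((\<lambda>u. ?f u / (u - p $ i) ^ Suc 1) has_contour_integral
          (2 * pi * \<i>) / fact 1 * (deriv ^^ 1) ?f (p $ i)) (circlepath (p $ i) 1)"
    by (rule Cauchy_has_contour_integral_higher_derivative_circlepath)
       (auto intro!: holomorphic_on_imp_continuous_on holomorphic_on_subset[OF assms(2)])
  then have "((\<lambda>t. ?f (p $ i + ?e t) / ?e t ^ 2 * (2 * pi * \<i> * ?e t)) has_integral
          2 * pi * \<i> * pdf i g p) (cbox 0 1)"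
    unfolding has_contour_integral vector_derivative_circlepath unfolding circlepath
    by (simp add: pdf_def mult_ac power2_eq_square)
  from has_integral_mult_right[OF this, of "1 / (2 * pi * \<i>)"]
  have "((\<lambda>t. ?f (p $ i + ?e t) / ?e t) has_integral pdf i g p) (cbox 0 1)"
    by (simp add: power2_eq_square)
  then show ?thesis by (simp add: integral_unique)
qed

text \<open>The second claim does double duty: it yields holomorphy of \<open>pdf i g\<close> in the
  j-th variable, and by naming the derivative with the opposite order of differentiation it also
  yields the symmetry of second derivatives. For distinct i and j both come from differentiating the
  Cauchy integral in the i-th variable under the integral sign.\<close>

lemma hol5_pdf_aux:
  assumes g: "hol5 g"
  shows "continuous_on UNIV (pdf i g)"
    and "((\<lambda>z. pdf i g (cupd p j z)) has_field_derivative pdf i (pdf j g) (cupd p j w)) (at w)"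
proof -
  let ?e = "\<lambda>t::real. exp (2 * of_real pi * \<i> * of_real t) :: complex"
  have cont: "continuous_on UNIV (pdf i g)" for i
  proof -
    have "continuous_on UNIV (\<lambda>p. integral (cbox 0 1) (\<lambda>t. g (cupd p i (p $ i + ?e t)) / ?e t))"
      by (rule integral_continuous_on_param)
         (auto simp: split_beta intro!: continuous_intros hol5_continuous_on_compose[OF g])
    then show ?thesis
      by (subst pdf_integral[OF hol5_cont[OF g] hol5_hol[OF g], abs_def]) auto
  qed
  show "continuous_on UNIV (pdf i g)" by (rule cont)
  have own: "(\<lambda>z. pdf i g (cupd p i z)) holomorphic_on UNIV" for p i
    using holomorphic_deriv[OF hol5_hol[OF g, of p i]] by (simp add: pdf_def cupd_nth)
  show "((\<lambda>z. pdf i g (cupd p j z)) has_field_derivative pdf i (pdf j g) (cupd p j w)) (at w)"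
  proof (cases "i = j")
    case True
    show ?thesis using holomorphic_derivI[OF own[of i p] open_UNIV UNIV_I, of w] True
      by (simp add: pdf_def cupd_nth)
  next
    case False
    have nz: "?e t \<noteq> 0" for t by simp
    have cj: "continuous_on A (\<lambda>x. pdf j g (f x))" if "continuous_on A f" for A and f :: "'b::t2_space \<Rightarrow> _"
      using continuous_on_compose2[OF cont that] by auto
    \<comment> \<open>Holomorphy of \<open>pdf j g\<close> in the i-th variable is the hypothesis
      under which the Cauchy integral can be applied to \<open>pdf j g\<close> itself, at the end of
      this case.\<close>
    have hj: "(\<lambda>z. pdf j g (cupd q i z)) holomorphic_on UNIV" for q
    proof -
      have *: "pdf j g (cupd q i z) = integral (cbox 0 1) (\<lambda>t. g (cupd (cupd q i z) j (q $ j + ?e t)) / ?e t)" for z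
        using False by (subst pdf_integral[OF hol5_cont[OF g] hol5_hol[OF g]]) (simp add: cupd_nth)
      have "((\<lambda>z. integral (cbox 0 1) (\<lambda>t. g (cupd (cupd q i z) j (q $ j + ?e t)) / ?e t))
        has_field_derivative integral (cbox 0 1) (\<lambda>t. pdf i g (cupd (cupd q i z) j (q $ j + ?e t)) / ?e t)) (at z within UNIV)" for z
      proof (rule leibniz_rule_field_derivative)
        fix x t assume "t \<in> cbox (0::real) 1"
        show "((\<lambda>x. g (cupd (cupd q i x) j (q $ j + ?e t)) / ?e t) has_field_derivative
              pdf i g (cupd (cupd q i x) j (q $ j + ?e t)) / ?e t) (at x within UNIV)"
          using DERIV_cdivide[OF hol5_has_pdf[OF g, of "cupd q j (q $ j + ?e t)" i x], of "?e t"] False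
          by (simp add: cupd_commute)
      qed (auto simp: split_beta intro!: integrable_continuous_interval continuous_intros hol5_continuous_on_compose[OF g]
             continuous_on_compose2[OF cont])
      then show ?thesis unfolding * by (auto simp: holomorphic_on_open)
    qed
    have *: "pdf i g (cupd p j z) = integral (cbox 0 1) (\<lambda>t. g (cupd (cupd p j z) i (p $ i + ?e t)) / ?e t)" for z
      using False by (subst pdf_integral[OF hol5_cont[OF g] hol5_hol[OF g]]) (simp add: cupd_nth)
    have "((\<lambda>z. integral (cbox 0 1) (\<lambda>t. g (cupd (cupd p j z) i (p $ i + ?e t)) / ?e t))
        has_field_derivative integral (cbox 0 1) (\<lambda>t. pdf j g (cupd (cupd p j w) i (p $ i + ?e t)) / ?e t)) (at w within UNIV)"
    proof (rule leibniz_rule_field_derivative)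
      fix x t assume "t \<in> cbox (0::real) 1"
      show "((\<lambda>x. g (cupd (cupd p j x) i (p $ i + ?e t)) / ?e t) has_field_derivative
              pdf j g (cupd (cupd p j x) i (p $ i + ?e t)) / ?e t) (at x within UNIV)"
        using DERIV_cdivide[OF hol5_has_pdf[OF g, of "cupd p i (p $ i + ?e t)" j x], of "?e t"] False
        by (simp add: cupd_commute)
    qed (auto simp: split_beta intro!: integrable_continuous_interval continuous_intros hol5_continuous_on_compose[OF g]
             continuous_on_compose2[OF cont])
    moreover have "pdf i (pdf j g) (cupd p j w) =
        integral (cbox 0 1) (\<lambda>t. pdf j g (cupd (cupd p j w) i (p $ i + ?e t)) / ?e t)"
      using False by (subst pdf_integral[OF cont hj]) (simp add: cupd_nth)
    ultimately show ?thesis unfolding * by simp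
  qed
qed

lemma hol5_pdf [intro, simp]: "hol5 g \<Longrightarrow> hol5 (pdf i g)"
  unfolding hol5_def[of "pdf i g"]
  by (auto intro: hol5_pdf_aux simp: holomorphic_on_open)

lemma pdf_commute: "hol5 g \<Longrightarrow> pdf i (pdf j g) = pdf j (pdf i g)"
  by (rule ext, rule sym, rule pdf_eqI) (use hol5_pdf_aux(2)[of g i _ j] in \<open>metis cupd_self\<close>)

section \<open>The vector space of superfunctions\<close>

lemma sadd_eq [simp]: "sadd f g = f + g"
  by (simp add: sadd_def fun_eq_iff)

lemma szero_eq [simp]: "szero = 0"
  by (simp add: szero_def fun_eq_iff)

lemma sscale_simps [simp]: "sscale 1 f = f" "sscale 0 f = 0" "sscale c 0 = 0" "sscale c (sscale d f) = sscale (c * d) f"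
  by (simp_all add: sscale_def fun_eq_iff)

lemma sscale_minus1 [simp]: "sscale (- 1) f = - f"
  by (simp add: sscale_def fun_eq_iff)

lemma sscale_add: "sscale c (f + g) = sscale c f + sscale c g"
  by (simp add: sscale_def fun_eq_iff algebra_simps)

lemma sscale_minus: "sscale c (- f) = - sscale c f"
  by (simp add: sscale_def fun_eq_iff)

lemma sum_fun_apply2: "(\<Sum>a\<in>A. f a) S p = (\<Sum>a\<in>A. f a S p)" for f :: "'a \<Rightarrow> sfun"
  by (induction A rule: infinite_finite_induct) auto

lemma sscale_sum: "sscale c (\<Sum>a\<in>A. f a) = (\<Sum>a\<in>A. sscale c (f a))"
  by (simp add: fun_eq_iff sscale_def sum_fun_apply2 sum_distrib_left)

subsection \<open>Signs\<close>

lemma inv_sign_prod: "inv_sign S T = (\<Prod>a\<in>S. (-1) ^ card {b\<in>T. b < a})"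
proof -
  have "{(a, b). a \<in> S \<and> b \<in> T \<and> b < a} = (SIGMA a:S. {b\<in>T. b < a})" by auto
  then show ?thesis by (simp add: inv_sign_def power_sum)
qed

lemma card_split: "S \<subseteq> U \<Longrightarrow> card U = card S + card (U - S)" for U :: "6 set"
  using card_mono[of U S] by (simp add: card_Diff_subset)

lemma inv_sign_empty [simp]: "inv_sign {} T = 1" "inv_sign S {} = 1"
  by (simp_all add: inv_sign_prod)

lemma inv_sign_Un_left: "S \<inter> T = {} \<Longrightarrow> inv_sign (S \<union> T) R = inv_sign S R * inv_sign T R"
  by (simp add: inv_sign_prod prod.union_disjoint)

lemma inv_sign_Un_right:
  assumes "S \<inter> T = {}"
  shows "inv_sign R (S \<union> T) = inv_sign R S * inv_sign R T"
proof -
  have "card {b \<in> S \<union> T. b < a} = card {b\<in>S. b < a} + card {b\<in>T. b < a}" for a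
    using assms by (subst card_Un_disjoint[symmetric]) (auto intro: arg_cong[where f = card])
  then show ?thesis by (simp add: inv_sign_prod power_add prod.distrib)
qed

lemma inv_sign_singleton: "inv_sign {k} R = (-1) ^ card {j\<in>R. j < k}"
  "inv_sign R {k} = (-1) ^ card {j\<in>R. k < j}"
proof -
  show "inv_sign {k} R = (-1) ^ card {j\<in>R. j < k}" by (simp add: inv_sign_prod)
  have "{(a, b). a \<in> R \<and> b \<in> {k} \<and> b < a} = (\<lambda>a. (a, k)) ` {j\<in>R. k < j}" by auto
  then show "inv_sign R {k} = (-1) ^ card {j\<in>R. k < j}"
    by (simp add: inv_sign_def card_image inj_on_def)
qed

lemma inv_sign_sq: "inv_sign S T * inv_sign S T = 1"
  by (simp add: inv_sign_def flip: power_mult_distrib)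

lemma inv_sign_insert_left: "k \<notin> S \<Longrightarrow> inv_sign (insert k S) R = inv_sign {k} R * inv_sign S R"
  using inv_sign_Un_left[of "{k}" S R] by simp

lemma inv_sign_insert_right: "k \<notin> R \<Longrightarrow> inv_sign S (insert k R) = inv_sign S {k} * inv_sign S R"
  using inv_sign_Un_right[of "{k}" R S] by simp

text \<open>A pair from S and T is an inversion in exactly one of the two orders, so the two
  inversion counts add up to the number of all pairs.\<close>

lemma inv_sign_swap:
  assumes "S \<inter> T = {}"
  shows "inv_sign S T * inv_sign T S = (-1) ^ (card S * card T)"
proof -
  let ?A = "{(a, b). a \<in> S \<and> b \<in> T \<and> b < a}" and ?B = "{(a, b). a \<in> S \<and> b \<in> T \<and> a < b}"
  have "{(a, b). a \<in> T \<and> b \<in> S \<and> b < a} = prod.swap ` ?B" by force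
  then have "card {(a, b). a \<in> T \<and> b \<in> S \<and> b < a} = card ?B" by (simp add: card_image)
  moreover have "card ?A + card ?B = card (S \<times> T)"
  proof (subst card_Un_disjoint[symmetric])
    have "a < b \<or> b < a" if "a \<in> S" "b \<in> T" for a b
      using assms that by (metis disjoint_iff neqE)
    then show "card (?A \<union> ?B) = card (S \<times> T)" by (intro arg_cong[where f = card]) auto
  qed auto
  ultimately show ?thesis by (simp add: inv_sign_def card_cartesian_product flip: power_add)
qed

lemma inv_sign_swap': "S \<inter> T = {} \<Longrightarrow> inv_sign T S = (-1) ^ (card S * card T) * inv_sign S T"
  using inv_sign_swap[of S T] inv_sign_sq[of S T] by (metis mult.assoc mult.commute mult.right_neutral)

lemma inv_sign_single_swap: "k \<notin> S \<Longrightarrow> inv_sign S {k} = (-1) ^ card S * inv_sign {k} S"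
  using inv_sign_swap'[of "{k}" S] by simp

text \<open>The sign of an odd derivative is that of moving the coordinate to the front. Written
  with \<open>inv_sign\<close>, all sign computations for derivatives reduce to its multiplicativity
  in each argument.\<close>

lemma pdth_sign: "pdth k f = (\<lambda>T p. if k \<in> T then 0 else inv_sign {k} T * f (insert k T) p)"
  by (intro ext) (simp add: pdth_def inv_sign_singleton)

subsection \<open>The superalgebra\<close>

lemma smult_add: "smult (f + g) h = smult f h + smult g h" "smult f (g + h) = smult f g + smult f h"
  by (simp_all add: smult_def fun_eq_iff algebra_simps sum.distrib)

lemma smult_minus: "smult (- f) h = - smult f h" "smult f (- h) = - smult f h"
  by (simp_all add: smult_def fun_eq_iff sum_negf)

lemma smult_diff: "smult (f - g) h = smult f h - smult g h" "smult f (g - h) = smult f g - smult f h"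
  by (simp_all only: diff_conv_add_uminus smult_add smult_minus)

lemma smult_zero [simp]: "smult 0 h = 0" "smult f 0 = 0"
  by (simp_all add: smult_def fun_eq_iff)

lemma smult_scale: "smult (sscale c f) h = sscale c (smult f h)" "smult f (sscale c h) = sscale c (smult f h)"
  by (simp_all add: smult_def sscale_def fun_eq_iff algebra_simps sum_distrib_left)

lemma smult_sum: "smult (\<Sum>a\<in>A. f a) h = (\<Sum>a\<in>A. smult (f a) h)" "smult h (\<Sum>a\<in>A. f a) = (\<Sum>a\<in>A. smult h (f a))"
  by (induction A rule: infinite_finite_induct) (auto simp: smult_add)

lemma smult_const: "smult (sconst c) f = sscale c f" "smult f (sconst c) = sscale c f"
proof -
  have "smult (sconst c) f U p = sscale c f U p" for U p
  proof -
    have "smult (sconst c) f U p = (\<Sum>S\<in>{{}}. inv_sign S (U - S) * sconst c S p * f (U - S) p)"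
      unfolding smult_def by (rule sum.mono_neutral_right) (auto simp: sconst_def)
    then show ?thesis by (simp add: sconst_def sscale_def)
  qed
  then show "smult (sconst c) f = sscale c f" by (simp add: fun_eq_iff)
  have "smult f (sconst c) U p = sscale c f U p" for U p
  proof -
    have "smult f (sconst c) U p = (\<Sum>S\<in>{U}. inv_sign S (U - S) * f S p * sconst c (U - S) p)"
      unfolding smult_def by (rule sum.mono_neutral_right) (auto simp: sconst_def)
    then show ?thesis by (simp add: sconst_def sscale_def)
  qed
  then show "smult f (sconst c) = sscale c f" by (simp add: fun_eq_iff)
qed

text \<open>Both sides run over the ordered partitions of U into three blocks, once as a chain S, W,
  U and once as S and a subset of U - S. In either case the sign is the product over the three pairs
  of blocks.\<close>

lemma smult_assoc: "smult (smult f g) h = smult f (smult g h)"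
proof (intro ext)
  fix U p
  have key: "inv_sign S (U - S) * f S p * (inv_sign (W - S) (U - S - (W - S)) * g (W - S) p * h (U - S - (W - S)) p) =
       inv_sign W (U - W) * (inv_sign S (W - S) * f S p * g (W - S) p) * h (U - W) p"
    if "W \<subseteq> U" "S \<subseteq> W" for W S
  proof -
    have *: "S \<union> (W - S) = W" "(W - S) \<union> (U - W) = U - S" "U - S - (W - S) = U - W"
      using that by auto
    have "inv_sign S (U - S) = inv_sign S (W - S) * inv_sign S (U - W)"
      using that by (subst *(2)[symmetric], intro inv_sign_Un_right) auto
    moreover have "inv_sign W (U - W) = inv_sign S (U - W) * inv_sign (W - S) (U - W)"
      by (subst *(1)[symmetric], intro inv_sign_Un_left) auto
    ultimately show ?thesis unfolding *(3) by (simp add: mult_ac)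
  qed
  have "smult (smult f g) h U p =
     (\<Sum>(W, S)\<in>Sigma (Pow U) Pow. inv_sign W (U - W) * (inv_sign S (W - S) * f S p * g (W - S) p) * h (U - W) p)"
    by (simp add: smult_def sum_distrib_left sum_distrib_right sum.Sigma)
  also have "\<dots> = (\<Sum>(S, T)\<in>(SIGMA S:Pow U. Pow (U - S)).
      inv_sign S (U - S) * f S p * (inv_sign T (U - S - T) * g T p * h (U - S - T) p))"
    by (rule sum.reindex_bij_witness[where j = "\<lambda>(W, S). (S, W - S)" and i = "\<lambda>(S, T). (S \<union> T, S)"])
       (auto simp: key)
  also have "\<dots> = smult f (smult g h) U p"
    by (simp add: smult_def sum_distrib_left sum_distrib_right sum.Sigma)
  finally show "smult (smult f g) h U p = smult f (smult g h) U p" .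
qed

text \<open>The parity automorphism. With it the Leibniz and commutation rules become equations for
  arbitrary superfunctions, without a split into homogeneous parts.\<close>

definition alpha :: "sfun \<Rightarrow> sfun" where
  "alpha f = (\<lambda>S p. (-1) ^ card S * f S p)"

text \<open>The effect on an arbitrary function of being passed by an object of parity b.\<close>

definition tw :: "bool \<Rightarrow> sfun \<Rightarrow> sfun" where
  "tw b f = (if b then alpha f else f)"

definition sg :: "bool \<Rightarrow> complex" where "sg b = (if b then -1 else 1)"

definition shom :: "bool \<Rightarrow> sfun \<Rightarrow> bool" where
  "shom b f \<longleftrightarrow> (\<forall>S p. odd (card S) \<noteq> b \<longrightarrow> f S p = 0)"

lemma shom_iff: "shom b f \<longleftrightarrow> sf_part b f = f"
  by (auto simp: shom_def sf_part_def fun_eq_iff)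

lemma alpha_alpha [simp]: "alpha (alpha f) = f"
  by (simp add: alpha_def fun_eq_iff flip: mult.assoc power_add mult_2)

lemma tw_simps [simp]: "tw True f = alpha f" "tw False f = f" "tw b (tw b f) = f"
  by (simp_all add: tw_def)

lemma sg_simps [simp]: "sg True = -1" "sg False = 1" "sg b * sg b = 1"
  by (simp_all add: sg_def)

lemma alpha_add: "alpha (f + g) = alpha f + alpha g"
  and alpha_scale: "alpha (sscale c f) = sscale c (alpha f)"
  and alpha_zero [simp]: "alpha 0 = 0"
  by (simp_all add: alpha_def sscale_def fun_eq_iff algebra_simps)

lemma alpha_shom: "shom b f \<Longrightarrow> alpha f = sscale (sg b) f"
  by (auto simp: alpha_def sscale_def fun_eq_iff shom_def sg_def) (metis minus_one_power_iff mult_minus1 mult_1 mult_zero_right)+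

lemma alpha_smult: "alpha (smult f g) = smult (alpha f) (alpha g)"
proof (intro ext)
  fix U :: "6 set" and p
  have "card U = card S + card (U - S)" if "S \<subseteq> U" for S
    using card_split[OF that] .
  then show "alpha (smult f g) U p = smult (alpha f) (alpha g) U p"
    by (auto simp: alpha_def smult_def sum_distrib_left power_add intro!: sum.cong)
qed

lemma shom_smult:
  assumes "shom a f" "shom b g"
  shows "shom (a \<noteq> b) (smult f g)"
  unfolding shom_def smult_def
proof (intro allI impI sum.neutral ballI)
  fix U S :: "6 set" and p assume *: "odd (card U) \<noteq> (a \<noteq> b)" "S \<in> Pow U"
  have "card U = card S + card (U - S)"
    using * card_split by auto
  then have "odd (card S) \<noteq> a \<or> odd (card (U - S)) \<noteq> b" using * by auto
  then show "inv_sign S (U - S) * f S p * g (U - S) p = 0"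
    using assms by (auto simp: shom_def)
qed

lemma shom_add: "shom a f \<Longrightarrow> shom a g \<Longrightarrow> shom a (f + g)"
  and shom_zero [simp]: "shom a 0"
  by (auto simp: shom_def sscale_def)

text \<open>One homogeneous factor suffices, because the Koszul sign then depends on the degree in
  the other factor only through its parity, which is what \<open>tw\<close> records. The sums are
  matched by complementation in U.\<close>

lemma smult_commute:
  assumes "shom a f"
  shows "smult f g = smult (tw a g) f"
proof (intro ext)
  fix U p
  have "smult f g U p = (\<Sum>S\<in>Pow U. inv_sign (U - S) S * f (U - S) p * g S p)"
    unfolding smult_def
    by (rule sum.reindex_bij_witness[where i = "\<lambda>S. U - S" and j = "\<lambda>S. U - S"]) (auto simp: double_diff)
  also have "\<dots> = smult (tw a g) f U p"
    unfolding smult_def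
  proof (rule sum.cong[OF refl])
    fix S assume "S \<in> Pow U"
    have "inv_sign (U - S) S = (-1) ^ (card S * card (U - S)) * inv_sign S (U - S)"
      by (rule inv_sign_swap') auto
    then show "inv_sign (U - S) S * f (U - S) p * g S p = inv_sign S (U - S) * tw a g S p * f (U - S) p"
      using assms by (cases "odd (card (U - S)) = a")
        (auto simp: shom_def tw_def alpha_def minus_one_power_iff)
  qed
  finally show "smult f g U p = smult (tw a g) f U p" .
qed

text \<open>If k is not in T, the subsets of \<open>insert k T\<close> divide into those containing
  k, where the derivative hits f, and the others, where it hits g after crossing f; the crossing
  produces \<open>alpha\<close>.\<close>

lemma pdth_smult: "pdth k (smult f g) = smult (pdth k f) g + smult (alpha f) (pdth k g)"
proof (intro ext)
  fix T p
  show "pdth k (smult f g) T p = (smult (pdth k f) g + smult (alpha f) (pdth k g)) T p"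
  proof (cases "k \<in> T")
    case False
    have P: "Pow (insert k T) = insert k ` Pow T \<union> Pow T" by (auto simp: Pow_insert)
    have "(\<Sum>S\<in>Pow (insert k T). inv_sign S (insert k T - S) * f S p * g (insert k T - S) p) =
      (\<Sum>S\<in>insert k ` Pow T. inv_sign S (insert k T - S) * f S p * g (insert k T - S) p) +
      (\<Sum>S\<in>Pow T. inv_sign S (insert k T - S) * f S p * g (insert k T - S) p)"
      unfolding P using False by (subst sum.union_disjoint) auto
    moreover have "(\<Sum>S\<in>insert k ` Pow T. inv_sign S (insert k T - S) * f S p * g (insert k T - S) p)
      = (\<Sum>S\<in>Pow T. inv_sign (insert k S) (T - S) * f (insert k S) p * g (T - S) p)"
      using False by (subst sum.reindex) (auto simp: inj_on_def intro!: sum.cong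
        arg_cong2[where f = "(*)"] arg_cong[where f = "\<lambda>R. inv_sign _ R"] arg_cong[where f = "\<lambda>R. g R p"])
    ultimately have "pdth k (smult f g) T p = inv_sign {k} T *
        ((\<Sum>S\<in>Pow T. inv_sign (insert k S) (T - S) * f (insert k S) p * g (T - S) p) +
         (\<Sum>S\<in>Pow T. inv_sign S (insert k T - S) * f S p * g (insert k T - S) p))"
      using False by (simp add: pdth_sign smult_def)
    also have "\<dots> = (\<Sum>S\<in>Pow T. inv_sign S (T - S) * pdth k f S p * g (T - S) p) +
        (\<Sum>S\<in>Pow T. inv_sign S (T - S) * alpha f S p * pdth k g (T - S) p)"
    unfolding distrib_left sum_distrib_left
    proof (rule arg_cong2[where f = "(+)"]; rule sum.cong[OF refl])
      fix S assume "S \<in> Pow T"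
      then have k: "k \<notin> S" "k \<notin> T - S" and T: "T = S \<union> (T - S)" using False by auto
      have s: "inv_sign {k} T = inv_sign {k} S * inv_sign {k} (T - S)"
        by (subst T, rule inv_sign_Un_right) auto
      show "inv_sign {k} T * (inv_sign (insert k S) (T - S) * f (insert k S) p * g (T - S) p) =
          inv_sign S (T - S) * pdth k f S p * g (T - S) p"
        using k(1) inv_sign_sq[of "{k}" "T - S"]
        by (simp add: pdth_sign s inv_sign_insert_left[OF k(1)] mult_ac)
      have "insert k T - S = insert k (T - S)" using k by auto
      then show "inv_sign {k} T * (inv_sign S (insert k T - S) * f S p * g (insert k T - S) p) =
          inv_sign S (T - S) * alpha f S p * pdth k g (T - S) p"
        using k inv_sign_sq[of "{k}" S]
        by (simp add: pdth_sign s inv_sign_insert_right[OF k(2)] inv_sign_single_swap[OF k(1)] alpha_def mult_ac)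
    qed
    finally show ?thesis by (simp add: smult_def)
  next
    \<comment> \<open>Here the left side is zero. On the right the surviving terms are products of
      coefficients of f and g whose index sets both contain k; each product occurs once in either
      sum, with opposite signs.\<close>
    case True
    define R where "R = T - {k}"
    have R: "T = insert k R" "k \<notin> R" using True by (auto simp: R_def)
    have P: "Pow T = insert k ` Pow R \<union> Pow R" by (auto simp: Pow_insert R)
    have "(\<Sum>S\<in>Pow T. inv_sign S (T - S) * pdth k f S p * g (T - S) p) =
       (\<Sum>S\<in>Pow R. inv_sign S (T - S) * pdth k f S p * g (T - S) p)"
      unfolding P by (rule sum.mono_neutral_right) (auto simp: pdth_sign)
    moreover have "(\<Sum>S\<in>Pow T. inv_sign S (T - S) * alpha f S p * pdth k g (T - S) p) =
       (\<Sum>S\<in>insert k ` Pow R. inv_sign S (T - S) * alpha f S p * pdth k g (T - S) p)"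
      unfolding P by (rule sum.mono_neutral_right) (use R in \<open>auto simp: pdth_sign\<close>)
    moreover have "\<dots> = (\<Sum>S\<in>Pow R. inv_sign (insert k S) (R - S) * alpha f (insert k S) p * pdth k g (R - S) p)"
      using R(2) by (subst sum.reindex) (auto simp: inj_on_def R(1) intro!: sum.cong
         arg_cong2[where f = "(*)"] arg_cong[where f = "\<lambda>R. inv_sign _ R"] arg_cong[where f = "\<lambda>R. pdth k g R p"])
    moreover have "inv_sign S (T - S) * pdth k f S p * g (T - S) p +
         inv_sign (insert k S) (R - S) * alpha f (insert k S) p * pdth k g (R - S) p = 0" if "S \<in> Pow R" for S
    proof -
      have k: "k \<notin> S" "k \<notin> R - S" "T - S = insert k (R - S)" using that R by auto
      have "(- 1) ^ card S * (- 1) ^ card S = (1::complex)" by (simp flip: power_mult_distrib)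
      then show ?thesis
        using k by (simp add: pdth_sign inv_sign_insert_left[OF k(1)] inv_sign_insert_right[OF k(2)]
          inv_sign_single_swap[OF k(1)] alpha_def mult_ac inv_sign_sq)
    qed
    ultimately show ?thesis
      using True by (simp add: smult_def pdth_sign flip: sum.distrib)
  qed
qed

lemma pdth_alpha: "pdth k (alpha f) = - alpha (pdth k f)"
  by (auto simp: pdth_sign alpha_def fun_eq_iff)

lemma pdth_add: "pdth k (f + g) = pdth k f + pdth k g"
  and pdth_scale: "pdth k (sscale c f) = sscale c (pdth k f)"
  by (auto simp: pdth_sign sscale_def fun_eq_iff algebra_simps)

lemma pdth_anticommute: "pdth k (pdth l f) = - pdth l (pdth k f)"
proof (cases "k = l")
  case True then show ?thesis by (auto simp: pdth_sign fun_eq_iff)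
next
  case False
  have "inv_sign {k} T * inv_sign {l} (insert k T) = - (inv_sign {l} T * inv_sign {k} (insert l T))"
    if "k \<notin> T" "l \<notin> T" for T
    using False that inv_sign_swap'[of "{k}" "{l}"]
    by (simp add: inv_sign_insert_right[OF that(1)] inv_sign_insert_right[OF that(2)] mult_ac)
  then show ?thesis using False
    by (auto simp: pdth_sign fun_eq_iff insert_commute simp flip: mult.assoc)
qed

section \<open>Holomorphic superfunctions and the even derivatives\<close>

lemma pdx_pdf: "pdx i f = (\<lambda>S. pdf i (f S))"
  by (simp add: pdx_def pdf_def fun_eq_iff)

lemma sfun_okD: "sfun_ok f \<Longrightarrow> hol5 (f S)"
  by (simp add: sfun_ok_def)

lemma sfun_ok_add [intro, simp]: "sfun_ok f \<Longrightarrow> sfun_ok g \<Longrightarrow> sfun_ok (f + g)"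
  by (simp add: sfun_ok_def plus_fun_def)

lemma sfun_ok_zero [intro, simp]: "sfun_ok 0"
  by (simp add: sfun_ok_def zero_fun_def)

lemma sfun_ok_scale [intro, simp]: "sfun_ok f \<Longrightarrow> sfun_ok (sscale c f)"
  by (simp add: sfun_ok_def sscale_def)

lemma sfun_ok_minus [intro, simp]: "sfun_ok f \<Longrightarrow> sfun_ok (- f)"
  using sfun_ok_scale[of f "-1"] by simp

lemma sfun_ok_diff [intro, simp]: "sfun_ok f \<Longrightarrow> sfun_ok g \<Longrightarrow> sfun_ok (f - g)"
  by (simp only: diff_conv_add_uminus sfun_ok_add sfun_ok_minus)

lemma sfun_ok_smult [intro, simp]: "sfun_ok f \<Longrightarrow> sfun_ok g \<Longrightarrow> sfun_ok (smult f g)"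
  by (simp add: sfun_ok_def smult_def)

lemma sfun_ok_alpha [intro, simp]: "sfun_ok f \<Longrightarrow> sfun_ok (alpha f)"
  by (simp add: sfun_ok_def alpha_def)

lemma sfun_ok_sum [intro, simp]: "(\<And>a. a \<in> A \<Longrightarrow> sfun_ok (f a)) \<Longrightarrow> sfun_ok (\<Sum>a\<in>A. f a)"
  by (induction A rule: infinite_finite_induct) auto

lemma sfun_ok_pdx [intro, simp]: "sfun_ok f \<Longrightarrow> sfun_ok (pdx i f)"
  by (simp add: sfun_ok_def pdx_pdf)

lemma sfun_ok_pdth [intro, simp]: "sfun_ok f \<Longrightarrow> sfun_ok (pdth k f)"
proof -
  assume "sfun_ok f"
  then have "hol5 (pdth k f T)" for T
    by (cases "k \<in> T") (auto simp: pdth_def sfun_ok_def)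
  then show ?thesis by (simp add: sfun_ok_def)
qed

lemma sfun_ok_sf_part [intro, simp]: "sfun_ok f \<Longrightarrow> sfun_ok (sf_part b f)"
  by (simp add: sfun_ok_def sf_part_def)

lemma sfun_ok_basic [intro, simp]: "sfun_ok (sconst c)" "sfun_ok (evc i)" "sfun_ok (odc k)"
proof -
  have "hol5 (\<lambda>p. if b then c else 0)" "hol5 (\<lambda>p. if b then p $ i else 0)" for b :: bool and c i
    by (cases b; simp)+
  then show "sfun_ok (sconst c)" "sfun_ok (evc i)" "sfun_ok (odc k)"
    by (simp_all add: sfun_ok_def sconst_def evc_def odc_def)
qed

lemma pdx_add: "sfun_ok f \<Longrightarrow> sfun_ok g \<Longrightarrow> pdx i (f + g) = pdx i f + pdx i g"
  by (simp add: pdx_pdf fun_eq_iff plus_fun_def pdf_add sfun_okD)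

lemma pdx_scale: "sfun_ok f \<Longrightarrow> pdx i (sscale c f) = sscale c (pdx i f)"
  by (simp add: pdx_pdf fun_eq_iff sscale_def pdf_cmult sfun_okD)

lemma pdx_alpha: "sfun_ok f \<Longrightarrow> pdx i (alpha f) = alpha (pdx i f)"
  by (simp add: pdx_pdf fun_eq_iff alpha_def pdf_cmult sfun_okD)

lemma pdx_commute: "sfun_ok f \<Longrightarrow> pdx i (pdx j f) = pdx j (pdx i f)"
  by (simp add: pdx_pdf fun_eq_iff pdf_commute sfun_okD)

lemma pdx_pdth: "sfun_ok f \<Longrightarrow> pdx i (pdth k f) = pdth k (pdx i f)"
  by (auto simp: pdx_pdf pdth_def fun_eq_iff pdf_cmult sfun_okD)

lemma pdx_smult:
  assumes "sfun_ok f" "sfun_ok g"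
  shows "pdx i (smult f g) = smult (pdx i f) g + smult f (pdx i g)"
  by (simp add: pdx_pdf fun_eq_iff smult_def pdf_sum pdf_cmult pdf_mult assms sfun_okD mult.assoc
        algebra_simps sum.distrib)

subsection \<open>Vector fields\<close>

lemma sscale_diff: "sscale c (f - g) = sscale c f - sscale c g"
  by (simp add: sscale_def fun_eq_iff algebra_simps)

lemma vf_add_eq [simp]: "vf_add X Y = X + Y"
  by (simp add: vf_add_def prod_eq_iff fun_eq_iff)

lemma vf_zero_eq [simp]: "vf_zero = 0"
  by (simp add: vf_zero_def prod_eq_iff fun_eq_iff)

text \<open>The sum type merges even and odd coordinates, so that a field has one family of
  components and identities for fields need no separate treatment of the two kinds of
  coordinates.\<close>

definition cmp :: "vf \<Rightarrow> 5 + 6 \<Rightarrow> sfun" where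
  "cmp X A = (case A of Inl i \<Rightarrow> fst X i | Inr k \<Rightarrow> snd X k)"

definition der :: "5 + 6 \<Rightarrow> sfun \<Rightarrow> sfun" where
  "der A = (case A of Inl i \<Rightarrow> pdx i | Inr k \<Rightarrow> pdth k)"

definition podd :: "5 + 6 \<Rightarrow> bool" where
  "podd A = (case A of Inl i \<Rightarrow> False | Inr k \<Rightarrow> True)"

lemma cmp_simps [simp]: "cmp X (Inl i) = fst X i" "cmp X (Inr k) = snd X k"
  "der (Inl i) = pdx i" "der (Inr k) = pdth k" "\<not> podd (Inl i)" "podd (Inr k)"
  by (simp_all add: cmp_def der_def podd_def)

lemma vf_eqI: "(\<And>A. cmp X A = cmp Y A) \<Longrightarrow> X = Y"
  by (metis cmp_simps(1,2) ext prod_eqI)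

lemma cmp_ring [simp]: "cmp (X + Y) A = cmp X A + cmp Y A" "cmp 0 A = 0" "cmp (- X) A = - cmp X A"
  "cmp (X - Y) A = cmp X A - cmp Y A"
  "cmp (vf_scale c X) A = sscale c (cmp X A)" "cmp (vf_cmul f X) A = smult f (cmp X A)"
  by (cases A; simp add: vf_scale_def vf_cmul_def)+

lemma cmp_sum: "cmp (\<Sum>a\<in>B. X a) A = (\<Sum>a\<in>B. cmp (X a) A)"
  by (induction B rule: infinite_finite_induct) simp_all

lemma vapp_sum_der: "vapp X f = (\<Sum>A\<in>UNIV. smult (cmp X A) (der A f))"
  unfolding UNIV_Plus_UNIV[symmetric]
  by (subst sum.Plus) (auto simp: vapp_def fun_eq_iff sum_fun_apply2)

lemma vf_ok_iff: "vf_ok X \<longleftrightarrow> (\<forall>A. sfun_ok (cmp X A))"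
  by (auto simp: vf_ok_def cmp_def split: sum.splits)

lemma vf_hom_iff: "vf_hom b X \<longleftrightarrow> (\<forall>A. shom (b \<noteq> podd A) (cmp X A))"
proof -
  have "vf_hom b X \<longleftrightarrow> (\<forall>A. cmp (vf_part b X) A = cmp X A)"
    unfolding vf_hom_def using vf_eqI by metis
  also have "\<dots> \<longleftrightarrow> (\<forall>A. shom (b \<noteq> podd A) (cmp X A))"
    unfolding shom_iff by (intro all_cong1) (auto simp: vf_part_def podd_def cmp_def split: sum.splits)
  finally show ?thesis .
qed

lemma cmp_vf_part: "cmp (vf_part b X) A = sf_part (b \<noteq> podd A) (cmp X A)"
  by (cases A) (auto simp: vf_part_def)

lemma sfun_ok_der [intro, simp]: "sfun_ok f \<Longrightarrow> sfun_ok (der A f)"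
  by (cases A) auto

lemma vf_okD [simp]: "vf_ok X \<Longrightarrow> sfun_ok (cmp X A)"
  by (simp add: vf_ok_iff)

lemma sfun_ok_vapp [intro, simp]: "vf_ok X \<Longrightarrow> sfun_ok f \<Longrightarrow> sfun_ok (vapp X f)"
  by (simp add: vapp_sum_der)

lemma der_add: "sfun_ok f \<Longrightarrow> sfun_ok g \<Longrightarrow> der A (f + g) = der A f + der A g"
  by (cases A) (auto simp: pdx_add pdth_add)

lemma der_scale: "sfun_ok f \<Longrightarrow> der A (sscale c f) = sscale c (der A f)"
  by (cases A) (auto simp: pdx_scale pdth_scale)

lemma der_zero [simp]: "der A 0 = 0"
  using der_scale[of 0 A 0] by simp

lemma der_sum: "finite B \<Longrightarrow> (\<And>a. a \<in> B \<Longrightarrow> sfun_ok (f a)) \<Longrightarrow> der A (\<Sum>a\<in>B. f a) = (\<Sum>a\<in>B. der A (f a))"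
  by (induction B rule: finite_induct) (simp_all add: der_add)

lemma der_smult: "sfun_ok f \<Longrightarrow> sfun_ok g \<Longrightarrow>
    der A (smult f g) = smult (der A f) g + smult (tw (podd A) f) (der A g)"
  by (cases A) (auto simp: pdx_smult pdth_smult)

lemma der_commute: "sfun_ok f \<Longrightarrow> der A (der B f) = sscale (sg (podd A \<and> podd B)) (der B (der A f))"
  by (cases A; cases B) (simp_all add: pdx_commute pdx_pdth, rule pdth_anticommute)

lemma der_alpha: "sfun_ok f \<Longrightarrow> der A (alpha f) = sscale (sg (podd A)) (alpha (der A f))"
  by (cases A) (auto simp: pdx_alpha pdth_alpha)

lemma vapp_add_left: "vapp (X + Y) f = vapp X f + vapp Y f"
  by (simp add: vapp_sum_der smult_add sum.distrib)

lemma vapp_scale_left: "vapp (vf_scale c X) f = sscale c (vapp X f)"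
  by (simp add: vapp_sum_der smult_scale sscale_sum)

lemma vapp_cmul_left: "vapp (vf_cmul g X) f = smult g (vapp X f)"
  by (simp add: vapp_sum_der smult_assoc smult_sum)

lemma vapp_zero_left [simp]: "vapp 0 f = 0"
  by (simp add: vapp_sum_der)

lemma vapp_zero_right [simp]: "vapp X 0 = 0"
  by (simp add: vapp_sum_der)

lemma vapp_add: "sfun_ok f \<Longrightarrow> sfun_ok g \<Longrightarrow> vapp X (f + g) = vapp X f + vapp X g"
  by (simp add: vapp_sum_der der_add smult_add sum.distrib)

lemma vapp_scale: "sfun_ok f \<Longrightarrow> vapp X (sscale c f) = sscale c (vapp X f)"
  by (simp add: vapp_sum_der der_scale smult_scale sscale_sum)

lemma tw_tw: "tw a (tw b f) = tw (a \<noteq> b) f"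
  by (simp add: tw_def)

lemma tw_shom: "shom a f \<Longrightarrow> tw b f = sscale (sg (a \<and> b)) f"
  by (simp add: tw_def alpha_shom sg_def)

lemma sfun_ok_tw [intro, simp]: "sfun_ok f \<Longrightarrow> sfun_ok (tw b f)"
  by (simp add: tw_def)

lemma vf_homD: "vf_hom b X \<Longrightarrow> shom (b \<noteq> podd A) (cmp X A)"
  by (simp add: vf_hom_iff)

text \<open>The coefficient of \<open>der A\<close> in X has parity b xor \<open>podd A\<close>.
  Moving it past the twist by \<open>podd A\<close> in the Leibniz rule of \<open>der A\<close>
  leaves a twist by b alone, the same for all A.\<close>

lemma vapp_smult:
  assumes "vf_hom b X" "sfun_ok f" "sfun_ok g"
  shows "vapp X (smult f g) = smult (vapp X f) g + smult (tw b f) (vapp X g)"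
proof -
  have "smult (cmp X A) (der A (smult f g)) =
     smult (smult (cmp X A) (der A f)) g + smult (tw b f) (smult (cmp X A) (der A g))" for A
  proof -
    have "tw (b \<noteq> podd A) (tw (podd A) f) = tw b f" by (cases b; cases "podd A") simp_all
    then show ?thesis
      using smult_commute[OF vf_homD[OF assms(1), of A], of "tw (podd A) f"] assms
      by (simp add: der_smult smult_add flip: smult_assoc)
  qed
  then show ?thesis by (simp add: vapp_sum_der smult_sum sum.distrib)
qed

lemma vapp_alpha:
  assumes "vf_hom b X" "sfun_ok f"
  shows "vapp X (alpha f) = sscale (sg b) (alpha (vapp X f))"
proof -
  have "alpha (\<Sum>A\<in>UNIV. smult (cmp X A) (der A f)) = (\<Sum>A\<in>UNIV. alpha (smult (cmp X A) (der A f)))"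
    by (simp add: alpha_def fun_eq_iff sum_fun_apply2 sum_distrib_left)
  moreover have "smult (cmp X A) (der A (alpha f)) = sscale (sg b) (alpha (smult (cmp X A) (der A f)))" for A
    using assms(2) alpha_shom[OF vf_homD[OF assms(1), of A]]
    by (simp add: alpha_smult der_alpha smult_scale sg_def)
  ultimately show ?thesis by (simp add: vapp_sum_der sscale_sum)
qed

subsection \<open>Brackets\<close>

lemma cmp_hbr: "cmp (hbr a b X Y) A = vapp X (cmp Y A) - sscale (sg (a \<and> b)) (vapp Y (cmp X A))"
  by (cases A) (auto simp: hbr_def Let_def sg_def)

text \<open>Separates the part of first order in f, where X differentiates the coefficients of Y,
  from the part of second order. There \<open>der A\<close> has crossed a coefficient of parity b
  xor \<open>podd B\<close>, which accounts for the sign.\<close>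

lemma vapp_vapp:
  assumes "vf_ok X" "vf_ok Y" "vf_hom b Y" "sfun_ok f"
  shows "vapp X (vapp Y f) = (\<Sum>B\<in>UNIV. smult (vapp X (cmp Y B)) (der B f)) +
    (\<Sum>A\<in>UNIV. \<Sum>B\<in>UNIV. sscale (sg (podd A \<and> (b \<noteq> podd B))) (smult (smult (cmp X A) (cmp Y B)) (der A (der B f))))"
proof -
  have "smult (cmp X A) (der A (vapp Y f)) = (\<Sum>B\<in>UNIV. smult (smult (cmp X A) (der A (cmp Y B))) (der B f))
     + (\<Sum>B\<in>UNIV. sscale (sg (podd A \<and> (b \<noteq> podd B))) (smult (smult (cmp X A) (cmp Y B)) (der A (der B f))))" for A
    using assms tw_shom[OF vf_homD[OF assms(3)]]
    by (simp add: vapp_sum_der der_sum der_smult smult_sum smult_add smult_scale smult_assoc sum.distrib conj_commute)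
  then have "vapp X (vapp Y f) = (\<Sum>A\<in>UNIV. \<Sum>B\<in>UNIV. smult (smult (cmp X A) (der A (cmp Y B))) (der B f))
     + (\<Sum>A\<in>UNIV. \<Sum>B\<in>UNIV. sscale (sg (podd A \<and> (b \<noteq> podd B))) (smult (smult (cmp X A) (cmp Y B)) (der A (der B f))))"
    by (subst vapp_sum_der) (simp add: sum.distrib)
  also have "(\<Sum>A\<in>UNIV. \<Sum>B\<in>UNIV. smult (smult (cmp X A) (der A (cmp Y B))) (der B f)) =
     (\<Sum>B\<in>UNIV. smult (vapp X (cmp Y B)) (der B f))"
    by (subst sum.swap) (simp add: vapp_sum_der smult_sum)
  finally show ?thesis .
qed

text \<open>The second-order parts of XY and YX agree up to the Koszul sign of the two fields, so
  they cancel in the graded commutator. The remaining first-order part is the componentwise formula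
  that defines \<open>hbr\<close>.\<close>

lemma vapp_hbr:
  assumes "vf_ok X" "vf_ok Y" "vf_hom a X" "vf_hom b Y" "sfun_ok f"
  shows "vapp (hbr a b X Y) f = vapp X (vapp Y f) - sscale (sg (a \<and> b)) (vapp Y (vapp X f))"
proof -
  let ?t = "\<lambda>b X Y A B. sscale (sg (podd A \<and> (b \<noteq> podd B))) (smult (smult (cmp X A) (cmp Y B)) (der A (der B f)))"
  have "?t b X Y A B = sscale (sg (a \<and> b)) (?t a Y X B A)" for A B
  proof -
    have "smult (cmp X A) (cmp Y B) = sscale (sg ((a \<noteq> podd A) \<and> (b \<noteq> podd B))) (smult (cmp Y B) (cmp X A))"
      using smult_commute[OF vf_homD[OF assms(3)]] tw_shom[OF vf_homD[OF assms(4)]]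
      by (simp add: smult_scale conj_commute)
    then show ?thesis
      by (simp add: der_commute[OF assms(5), of A B] smult_scale sg_def)
  qed
  then have "(\<Sum>A\<in>UNIV. \<Sum>B\<in>UNIV. ?t b X Y A B) = sscale (sg (a \<and> b)) (\<Sum>A\<in>UNIV. \<Sum>B\<in>UNIV. ?t a Y X A B)"
    by (subst (2) sum.swap) (simp add: sscale_sum)
  then have "vapp X (vapp Y f) - sscale (sg (a \<and> b)) (vapp Y (vapp X f)) =
     (\<Sum>B\<in>UNIV. smult (vapp X (cmp Y B)) (der B f)) - sscale (sg (a \<and> b)) (\<Sum>B\<in>UNIV. smult (vapp Y (cmp X B)) (der B f))"
    by (simp add: vapp_vapp[OF assms(1,2,4,5)] vapp_vapp[OF assms(2,1,3,5)] sscale_add)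
  also have "\<dots> = vapp (hbr a b X Y) f"
    by (simp add: vapp_sum_der[of "hbr a b X Y"] cmp_hbr smult_diff sum_subtractf sscale_sum smult_scale)
  finally show ?thesis by simp
qed

lemma hbr_zero [simp]: "hbr a b X 0 = 0" "hbr a b 0 Y = 0"
  by (rule vf_eqI, simp add: cmp_hbr)+

lemma hbr_add_left: "vf_ok X \<Longrightarrow> vf_ok X' \<Longrightarrow> hbr a b (X + X') Y = hbr a b X Y + hbr a b X' Y"
  by (rule vf_eqI) (simp add: cmp_hbr vapp_add_left vapp_add sscale_add)

lemma hbr_add_right: "vf_ok Y \<Longrightarrow> vf_ok Y' \<Longrightarrow> hbr a b X (Y + Y') = hbr a b X Y + hbr a b X Y'"
  by (rule vf_eqI) (simp add: cmp_hbr vapp_add_left vapp_add sscale_add)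

lemma hbr_scale_left: "vf_ok X \<Longrightarrow> hbr a b (vf_scale c X) Y = vf_scale c (hbr a b X Y)"
  by (rule vf_eqI) (simp add: cmp_hbr vapp_scale_left vapp_scale sscale_diff mult.commute)

lemma hbr_scale_right: "vf_ok Y \<Longrightarrow> hbr a b X (vf_scale c Y) = vf_scale c (hbr a b X Y)"
  by (rule vf_eqI) (simp add: cmp_hbr vapp_scale_left vapp_scale sscale_diff mult.commute)

lemma vf_part_add: "vf_part b (X + Y) = vf_part b X + vf_part b Y"
  by (rule vf_eqI) (auto simp: cmp_vf_part sf_part_def fun_eq_iff)

lemma vf_part_scale: "vf_part b (vf_scale c X) = vf_scale c (vf_part b X)"
  by (rule vf_eqI) (auto simp: cmp_vf_part sf_part_def sscale_def fun_eq_iff)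

lemma vf_ok_closed [intro, simp]:
  "vf_ok 0" "vf_ok X \<Longrightarrow> vf_ok Y \<Longrightarrow> vf_ok (X + Y)" "vf_ok X \<Longrightarrow> vf_ok Y \<Longrightarrow> vf_ok (X - Y)"
  "vf_ok X \<Longrightarrow> vf_ok (vf_scale c X)" "vf_ok X \<Longrightarrow> vf_ok (vf_part b X)"
  "sfun_ok f \<Longrightarrow> vf_ok X \<Longrightarrow> vf_ok (vf_cmul f X)"
  by (simp_all add: vf_ok_iff cmp_vf_part)

lemma vf_ok_hbr [intro, simp]: "vf_ok X \<Longrightarrow> vf_ok Y \<Longrightarrow> vf_ok (hbr a b X Y)"
  by (simp add: vf_ok_iff[of "hbr a b X Y"] cmp_hbr)

lemma vf_ok_brk [intro, simp]: "vf_ok X \<Longrightarrow> vf_ok Y \<Longrightarrow> vf_ok (brk X Y)"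
  by (simp add: brk_def)

lemma brk_add_left: "vf_ok X \<Longrightarrow> vf_ok X' \<Longrightarrow> brk (X + X') Y = brk X Y + brk X' Y"
  by (simp add: brk_def vf_part_add hbr_add_left)

lemma brk_add_right: "vf_ok Y \<Longrightarrow> vf_ok Y' \<Longrightarrow> brk X (Y + Y') = brk X Y + brk X Y'"
  by (simp add: brk_def vf_part_add hbr_add_right)

lemma vf_scale_add: "vf_scale c (X + Y) = vf_scale c X + vf_scale c Y"
  by (rule vf_eqI) (simp add: sscale_add)

lemma brk_scale_left: "vf_ok X \<Longrightarrow> brk (vf_scale c X) Y = vf_scale c (brk X Y)"
  by (simp add: brk_def vf_part_scale hbr_scale_left vf_scale_add)

lemma brk_scale_right: "vf_ok Y \<Longrightarrow> brk X (vf_scale c Y) = vf_scale c (brk X Y)"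
  by (simp add: brk_def vf_part_scale hbr_scale_right vf_scale_add)

lemma sf_part_hom: "shom a f \<Longrightarrow> sf_part b f = (if a = b then f else 0)"
  by (auto simp: shom_def sf_part_def fun_eq_iff)

lemma vf_part_hom: "vf_hom a X \<Longrightarrow> vf_part b X = (if a = b then X else 0)"
  by (rule vf_eqI) (use sf_part_hom[OF vf_homD] in \<open>auto simp: cmp_vf_part\<close>)

lemma brk_hom:
  assumes "vf_hom a X" "vf_hom b Y"
  shows "brk X Y = hbr a b X Y"
  by (cases a; cases b) (simp_all add: brk_def vf_part_hom[OF assms(1)] vf_part_hom[OF assms(2)])

text \<open>The Koszul sign of an arbitrary field X against an odd field is absorbed in the grading automorphism.\<close>

definition tv :: "bool \<Rightarrow> 5 + 6 \<Rightarrow> sfun \<Rightarrow> sfun" where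
  "tv b A f = (if b then sscale (sg (podd A)) (alpha f) else f)"

text \<open>X may be inhomogeneous. For odd Y the even and odd parts of X enter with opposite signs;
  on the A-th component this is \<open>alpha\<close> corrected by the parity of the coordinate
  A.\<close>

lemma cmp_brk_hom:
  assumes "vf_hom b Y" "vf_ok X"
  shows "cmp (brk X Y) A = vapp X (cmp Y A) - vapp Y (tv b A (cmp X A))"
proof -
  have p: "sf_part True f + sf_part False f = f" "sf_part False f + sf_part True f = f"
    "sf_part False f - sf_part True f = alpha f" "sf_part True f - sf_part False f = - alpha f" for f
    by (auto simp: sf_part_def alpha_def fun_eq_iff)
  have X: "vf_part False X + vf_part True X = X"
  proof (rule vf_eqI)
    fix A show "cmp (vf_part False X + vf_part True X) A = cmp X A"
      by (cases "podd A") (simp_all add: cmp_vf_part p)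
  qed
  have "brk X Y = hbr False b (vf_part False X) Y + hbr True b (vf_part True X) Y"
    by (cases b) (simp_all add: brk_def vf_part_hom[OF assms(1)])
  then have "cmp (brk X Y) A = vapp (vf_part False X + vf_part True X) (cmp Y A)
      - vapp Y (cmp (vf_part False X) A + sscale (sg b) (cmp (vf_part True X) A))"
    using assms(2) by (simp add: cmp_hbr vapp_add_left vapp_add vapp_scale vf_ok_iff[of "vf_part _ X"] cmp_vf_part)
  moreover have "cmp (vf_part False X) A + sscale (sg b) (cmp (vf_part True X) A) = tv b A (cmp X A)"
    by (cases b; cases "podd A") (simp_all add: cmp_vf_part tv_def p)
  ultimately show ?thesis using X by simp
qed

lemma vf_hom_cmul: "shom a f \<Longrightarrow> vf_hom b X \<Longrightarrow> vf_hom (a \<noteq> b) (vf_cmul f X)"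
  unfolding vf_hom_iff
proof
  fix A assume "shom a f" and "\<forall>A. shom (b \<noteq> podd A) (cmp X A)"
  then have "shom a f" "shom (b \<noteq> podd A) (cmp X A)" by auto
  then show "shom ((a \<noteq> b) \<noteq> podd A) (cmp (vf_cmul f X) A)"
    using shom_smult[of a f "b \<noteq> podd A" "cmp X A"] by (cases a; cases b; cases "podd A") simp_all
qed

lemma brk_cmul_hom:
  assumes "vf_hom a X" "vf_hom b Y" "shom c f" "vf_ok X" "vf_ok Y" "sfun_ok f"
  shows "brk X (vf_cmul f Y) = vf_cmul (vapp X f) Y + vf_cmul (tw a f) (brk X Y)"
proof (rule vf_eqI)
  fix A
  have "tw a f = sscale (sg (c \<and> a)) f" by (rule tw_shom[OF assms(3)])
  then show "cmp (brk X (vf_cmul f Y)) A = cmp (vf_cmul (vapp X f) Y + vf_cmul (tw a f) (brk X Y)) A"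
    using assms
    by (simp add: brk_hom[OF assms(1,2)] brk_hom[OF assms(1) vf_hom_cmul[OF assms(3,2)]] cmp_hbr
        vapp_smult vapp_cmul_left smult_diff smult_scale)
      (simp add: sg_def)
qed

text \<open>Both sides are additive in f, which reduces the claim to the even and odd parts of
  f.\<close>

lemma brk_cmul:
  assumes "vf_hom a X" "vf_hom b Y" "vf_ok X" "vf_ok Y" "sfun_ok f"
  shows "brk X (vf_cmul f Y) = vf_cmul (vapp X f) Y + vf_cmul (tw a f) (brk X Y)"
proof -
  let ?f = "\<lambda>b. sf_part b f"
  have f: "f = ?f True + ?f False" by (auto simp: sf_part_def fun_eq_iff)
  have h: "shom b (?f b)" "sfun_ok (?f b)" for b
    using sfun_ok_sf_part[OF assms(5)] by (simp_all add: shom_def) (simp add: sf_part_def)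
  have c: "vf_cmul (g + h) Z = vf_cmul g Z + vf_cmul h Z" for g h Z
    by (rule vf_eqI) (simp add: smult_add)
  have t: "tw a (g + h) = tw a g + tw a h" for g h by (simp add: tw_def alpha_add)
  show ?thesis
    by (subst (1 2 3) f, simp only: c t)
      (use assms h in \<open>simp add: brk_add_right vapp_add c brk_cmul_hom[OF assms(1,2) h(1) assms(3,4) h(2)]\<close>)
qed

subsection \<open>Polynomial vector fields with integer coefficients\<close>

declare plus_fun_apply [simp del] zero_fun_apply [simp del] uminus_apply [simp del] minus_apply [simp del]
lemmas pointwise = fun_eq_iff plus_fun_apply zero_fun_apply uminus_apply minus_apply

lemma UNIV_5: "(UNIV :: 5 set) = {0, 1, 2, 3, 4}"
  and UNIV_6: "(UNIV :: 6 set) = {0, 1, 2, 3, 4, 5}"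
proof -
  have "card {0, 1, 2, 3, 4 :: 5} = CARD(5)" "card {0, 1, 2, 3, 4, 5 :: 6} = CARD(6)" by simp_all
  then show "(UNIV :: 5 set) = {0, 1, 2, 3, 4}" "(UNIV :: 6 set) = {0, 1, 2, 3, 4, 5}"
    by (metis card_subset_eq finite_code subset_UNIV)+
qed

lemma all_5: "(\<forall>i::5. P i) \<longleftrightarrow> P 0 \<and> P 1 \<and> P 2 \<and> P 3 \<and> P 4"
proof -
  have "(\<forall>i::5. P i) \<longleftrightarrow> (\<forall>i\<in>UNIV. P i)" by simp
  then show ?thesis unfolding UNIV_5 by simp
qed

lemma all_6: "(\<forall>i::6. P i) \<longleftrightarrow> P 0 \<and> P 1 \<and> P 2 \<and> P 3 \<and> P 4 \<and> P 5"
proof -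
  have "(\<forall>i::6. P i) \<longleftrightarrow> (\<forall>i\<in>UNIV. P i)" by simp
  then show ?thesis unfolding UNIV_6 by simp
qed

lemma sum_5: "(\<Sum>i\<in>(UNIV::5 set). f i) = f 0 + f 1 + f 2 + f 3 + (f 4 :: 'a::ab_group_add)"
  unfolding UNIV_5 by (simp add: add.assoc)

lemma sum_6: "(\<Sum>i\<in>(UNIV::6 set). f i) = f 0 + f 1 + f 2 + f 3 + f 4 + (f 5 :: 'a::ab_group_add)"
  unfolding UNIV_6 by (simp add: add.assoc)

section \<open>Executable polynomial superfunctions\<close>

datatype expo = Ex nat nat nat nat nat
datatype odds = Od bool bool bool bool bool bool
text \<open>Integer coefficient, exponents of the even coordinates, and one flag for each odd
  coordinate. Lists of monomials are kept unsorted and with repetitions; only the zero test collects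
  like terms.\<close>

datatype mono = M int expo odds
type_synonym poly = "mono list"
datatype pvf = PV poly poly poly poly poly poly poly poly poly poly poly

fun exv :: "expo \<Rightarrow> complex^5 \<Rightarrow> complex" where
  "exv (Ex a b c d e) p = p $ 0 ^ a * p $ 1 ^ b * p $ 2 ^ c * p $ 3 ^ d * p $ 4 ^ e"

fun pick5 where "pick5 a0 a1 a2 a3 a4 i = (if i = (0::5) then a0 else if i = 1 then a1 else if i = 2 then a2
  else if i = 3 then a3 else a4)"

fun pick6 where "pick6 a0 a1 a2 a3 a4 a5 i = (if i = (0::6) then a0 else if i = 1 then a1 else if i = 2 then a2
  else if i = 3 then a3 else if i = 4 then a4 else a5)"

fun oset :: "odds \<Rightarrow> 6 set" where
  "oset (Od b0 b1 b2 b3 b4 b5) = {k. pick6 b0 b1 b2 b3 b4 b5 k}"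

definition mon :: "6 set \<Rightarrow> (complex^5 \<Rightarrow> complex) \<Rightarrow> sfun" where
  "mon S a = (\<lambda>U p. if U = S then a p else 0)"

fun msem :: "mono \<Rightarrow> sfun" where
  "msem (M c e q) = mon (oset q) (\<lambda>p. of_int c * exv e p)"

primrec psem :: "poly \<Rightarrow> sfun" where
  "psem [] = 0" | "psem (m # P) = msem m + psem P"

fun vsem :: "pvf \<Rightarrow> vf" where
  "vsem (PV a0 a1 a2 a3 a4 b0 b1 b2 b3 b4 b5) =
     (\<lambda>i. psem (pick5 a0 a1 a2 a3 a4 i), \<lambda>k. psem (pick6 b0 b1 b2 b3 b4 b5 k))"

fun eadd where "eadd (Ex a b c d e) (Ex a' b' c' d' e') = Ex (a+a') (b+b') (c+c') (d+d') (e+e')"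

fun xr :: "bool \<Rightarrow> bool \<Rightarrow> bool" where "xr True b = (\<not> b)" | "xr False b = b"

text \<open>p is the parity of the number of odd coordinates of the right factor passed so far.\<close>

fun isg :: "bool \<Rightarrow> bool \<Rightarrow> bool list \<Rightarrow> bool list \<Rightarrow> bool" where
  "isg p r (True # as) (b # bs) = isg (xr b p) (xr p r) as bs"
| "isg p r (False # as) (b # bs) = isg (xr b p) r as bs"
| "isg p r _ _ = r"

fun osg where "osg (Od a0 a1 a2 a3 a4 a5) (Od b0 b1 b2 b3 b4 b5) =
  isg False False [a0, a1, a2, a3, a4, a5] [b0, b1, b2, b3, b4, b5]"

fun odisj where "odisj (Od a0 a1 a2 a3 a4 a5) (Od b0 b1 b2 b3 b4 b5) \<longleftrightarrow>
  \<not> (a0 \<and> b0) \<and> \<not> (a1 \<and> b1) \<and> \<not> (a2 \<and> b2) \<and> \<not> (a3 \<and> b3) \<and> \<not> (a4 \<and> b4) \<and> \<not> (a5 \<and> b5)"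

fun ouni where "ouni (Od a0 a1 a2 a3 a4 a5) (Od b0 b1 b2 b3 b4 b5) =
  Od (a0 \<or> b0) (a1 \<or> b1) (a2 \<or> b2) (a3 \<or> b3) (a4 \<or> b4) (a5 \<or> b5)"

fun sgi :: "bool \<Rightarrow> int \<Rightarrow> int" where "sgi True c = - c" | "sgi False c = c"

text \<open>Branching is by matching a Boolean argument, here and in similar functions below, so
  that rewriting selects a branch only once the condition has become a constant.\<close>

fun mulc where
  "mulc True c e q d e' q' R = M (sgi (osg q q') (c * d)) (eadd e e') (ouni q q') # R"
| "mulc False c e q d e' q' R = R"

fun mulm where
  "mulm c e q [] R = R"
| "mulm c e q (M d e' q' # Q) R = mulc (odisj q q') c e q d e' q' (mulm c e q Q R)"

text \<open>The last argument is an accumulator added to the product, so that sums of products are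
  built without concatenating lists.\<close>

fun pmul :: "poly \<Rightarrow> poly \<Rightarrow> poly \<Rightarrow> poly" where
  "pmul [] Q R = R" | "pmul (M c e q # P) Q R = mulm c e q Q (pmul P Q R)"

fun pscl :: "int \<Rightarrow> poly \<Rightarrow> poly \<Rightarrow> poly" where
  "pscl k [] R = R" | "pscl k (M c e q # P) R = M (k * c) e q # pscl k P R"

fun dx0 where "dx0 [] = []" | "dx0 (M k (Ex 0 b c d e) p # P) = dx0 P"
  | "dx0 (M k (Ex (Suc a) b c d e) p # P) = M (int (Suc a) * k) (Ex a b c d e) p # dx0 P"
fun dx1 where "dx1 [] = []" | "dx1 (M k (Ex a 0 c d e) p # P) = dx1 P"
  | "dx1 (M k (Ex a (Suc b) c d e) p # P) = M (int (Suc b) * k) (Ex a b c d e) p # dx1 P"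
fun dx2 where "dx2 [] = []" | "dx2 (M k (Ex a b 0 d e) p # P) = dx2 P"
  | "dx2 (M k (Ex a b (Suc c) d e) p # P) = M (int (Suc c) * k) (Ex a b c d e) p # dx2 P"
fun dx3 where "dx3 [] = []" | "dx3 (M k (Ex a b c 0 e) p # P) = dx3 P"
  | "dx3 (M k (Ex a b c (Suc d) e) p # P) = M (int (Suc d) * k) (Ex a b c d e) p # dx3 P"
fun dx4 where "dx4 [] = []" | "dx4 (M k (Ex a b c d 0) p # P) = dx4 P"
  | "dx4 (M k (Ex a b c d (Suc e)) p # P) = M (int (Suc e) * k) (Ex a b c d e) p # dx4 P"

fun dcons where "dcons True s c e q R = M (sgi s c) e q # R" | "dcons False s c e q R = R"

fun dt0 where "dt0 [] = []"
  | "dt0 (M c e (Od b0 b1 b2 b3 b4 b5) # P) = dcons b0 False c e (Od False b1 b2 b3 b4 b5) (dt0 P)"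
fun dt1 where "dt1 [] = []"
  | "dt1 (M c e (Od b0 b1 b2 b3 b4 b5) # P) = dcons b1 b0 c e (Od b0 False b2 b3 b4 b5) (dt1 P)"
fun dt2 where "dt2 [] = []"
  | "dt2 (M c e (Od b0 b1 b2 b3 b4 b5) # P) = dcons b2 (xr b0 b1) c e (Od b0 b1 False b3 b4 b5) (dt2 P)"
fun dt3 where "dt3 [] = []"
  | "dt3 (M c e (Od b0 b1 b2 b3 b4 b5) # P) = dcons b3 (xr b0 (xr b1 b2)) c e (Od b0 b1 b2 False b4 b5) (dt3 P)"
fun dt4 where "dt4 [] = []"
  | "dt4 (M c e (Od b0 b1 b2 b3 b4 b5) # P) = dcons b4 (xr b0 (xr b1 (xr b2 b3))) c e (Od b0 b1 b2 b3 False b5) (dt4 P)"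
fun dt5 where "dt5 [] = []"
  | "dt5 (M c e (Od b0 b1 b2 b3 b4 b5) # P) = dcons b5 (xr b0 (xr b1 (xr b2 (xr b3 b4)))) c e (Od b0 b1 b2 b3 b4 False) (dt5 P)"

fun pvapp :: "pvf \<Rightarrow> poly \<Rightarrow> poly \<Rightarrow> poly" where
  "pvapp (PV a0 a1 a2 a3 a4 b0 b1 b2 b3 b4 b5) P R =
     pmul a0 (dx0 P) (pmul a1 (dx1 P) (pmul a2 (dx2 P) (pmul a3 (dx3 P) (pmul a4 (dx4 P)
      (pmul b0 (dt0 P) (pmul b1 (dt1 P) (pmul b2 (dt2 P) (pmul b3 (dt3 P) (pmul b4 (dt4 P)
        (pmul b5 (dt5 P) R))))))))))"

section \<open>Correctness of the polynomial operations\<close>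

lemma mon_smult: "smult (mon S a) (mon T b) =
   (if S \<inter> T = {} then mon (S \<union> T) (\<lambda>p. inv_sign S T * (a p * b p)) else 0)"
proof (intro ext)
  fix U p
  have "smult (mon S a) (mon T b) U p =
      (\<Sum>W\<in>Pow U. if W = S then (if U - S = T then inv_sign S T * (a p * b p) else 0) else 0)"
    unfolding smult_def mon_def by (rule sum.cong) auto
  also have "\<dots> = (if S \<subseteq> U \<and> U - S = T then inv_sign S T * (a p * b p) else 0)"
    by (simp add: sum.delta)
  also have "\<dots> = (if S \<inter> T = {} then mon (S \<union> T) (\<lambda>p. inv_sign S T * (a p * b p)) else 0) U p"
    by (auto simp: mon_def zero_fun_apply)
  finally show "smult (mon S a) (mon T b) U p =
    (if S \<inter> T = {} then mon (S \<union> T) (\<lambda>p. inv_sign S T * (a p * b p)) else 0) U p" .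
qed

lemma sg_xr: "sg (xr a b) = sg a * sg b"
  by (cases a; cases b) simp_all

lemma isg_Cons: "isg p r (a # as) (b # bs) = isg (xr b p) (if a then xr p r else r) as bs"
  by (cases a) simp_all

lemma less_6: "(0::6) < 1" "(1::6) < 2" "(2::6) < 3" "(3::6) < 4" "(4::6) < 5"
  by (simp_all add: less_bit0_def bit0.Rep_0 bit0.Rep_1 bit0.Rep_numeral)

text \<open>One factor for each of the fifteen possible inversions among six odd coordinates. This
  turns the comparison with the scan \<open>isg\<close> into a finite propositional check.\<close>

lemma inv_sign_expand:
  fixes S T :: "6 set"
  defines "F \<equiv> \<lambda>a b. sg (a \<in> S \<and> b \<in> T)"
  shows "inv_sign S T = F 1 0 * (F 2 0 * F 2 1) * (F 3 0 * F 3 1 * F 3 2) * (F 4 0 * F 4 1 * F 4 2 * F 4 3)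
    * (F 5 0 * F 5 1 * F 5 2 * F 5 3 * F 5 4)"
proof -
  have *: "inv_sign S T = (\<Prod>a\<in>UNIV. \<Prod>b\<in>UNIV. if b < a then F a b else 1)"
  proof -
    have "(-1) ^ card {b\<in>T. b < a} = (\<Prod>b\<in>UNIV. if b \<in> T \<and> b < a then -1 else 1 :: complex)" for a
      by (simp add: prod.If_cases Int_def)
    then have "inv_sign S T = (\<Prod>a\<in>S. \<Prod>b\<in>UNIV. if b \<in> T \<and> b < a then -1 else 1)"
      by (simp add: inv_sign_prod)
    also have "\<dots> = (\<Prod>a\<in>UNIV. if a \<in> S then (\<Prod>b\<in>UNIV. if b \<in> T \<and> b < a then -1 else 1) else 1)"
      by (simp add: prod.If_cases)
    also have "\<dots> = (\<Prod>a\<in>UNIV. \<Prod>b\<in>UNIV. if b < a then F a b else 1)"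
    proof (intro prod.cong refl)
      fix a show "(if a \<in> S then (\<Prod>b\<in>UNIV. if b \<in> T \<and> b < a then -1 else 1) else 1)
        = (\<Prod>b\<in>UNIV. if b < a then F a b else 1)"
        by (cases "a \<in> S") (auto simp: F_def sg_def intro!: prod.neutral prod.cong)
    qed
    finally show ?thesis .
  qed
  have t: "(0::6) < 2" "(0::6) < 3" "(0::6) < 4" "(0::6) < 5" "(1::6) < 3" "(1::6) < 4" "(1::6) < 5"
    "(2::6) < 4" "(2::6) < 5" "(3::6) < 5"
    using less_6 by (meson less_trans)+
  have n: "a < b \<Longrightarrow> \<not> b < a" for a b :: 6 by simp
  show ?thesis
    unfolding * UNIV_6 by (simp add: less_6 t less_6[THEN n] t[THEN n])
qed

lemma inv_sign_oset: "inv_sign (oset A) (oset B) = sg (osg A B)"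
proof -
  obtain a0 a1 a2 a3 a4 a5 b0 b1 b2 b3 b4 b5
    where AB: "A = Od a0 a1 a2 a3 a4 a5" "B = Od b0 b1 b2 b3 b4 b5"
    by (metis odds.exhaust)
  show ?thesis unfolding AB inv_sign_expand
    by (cases a1; cases a2; cases a3; cases a4; cases a5; simp add: isg_Cons sg_xr mult_ac)
qed

lemma oset_ops: "oset A \<inter> oset B = {} \<longleftrightarrow> odisj A B" "oset (ouni A B) = oset A \<union> oset B"
  by (cases A; cases B; force simp: disjoint_iff all_6 set_eq_iff)+

lemma of_int_sgi: "of_int (sgi b c) = sg b * of_int c"
  by (cases b) simp_all

lemma exv_eadd: "exv (eadd e e') p = exv e p * exv e' p"
  by (cases e; cases e') (simp add: power_add mult_ac)

lemma mon_zero [simp]: "mon S (\<lambda>p. 0) = 0"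
  by (simp add: mon_def pointwise)

lemma msem_mult: "smult (msem (M c e q)) (msem (M d e' q')) + R =
    (if odisj q q' then msem (M (sgi (osg q q') (c * d)) (eadd e e') (ouni q q')) + R else R)"
  by (simp add: mon_smult oset_ops inv_sign_oset of_int_sgi exv_eadd mult_ac)

lemma psem_mulm: "psem (mulm c e q Q R) = smult (msem (M c e q)) (psem Q) + psem R"
proof (induction Q)
  case (Cons m Q)
  obtain d e' q' where m: "m = M d e' q'" by (cases m)
  have "psem (mulm c e q (m # Q) R) = (if odisj q q' then msem (M (sgi (osg q q') (c * d)) (eadd e e') (ouni q q'))
     + psem (mulm c e q Q R) else psem (mulm c e q Q R))"
    by (cases "odisj q q'") (simp_all add: m del: msem.simps)
  then show ?case using Cons
    by (simp add: m smult_add add.assoc flip: msem_mult del: msem.simps)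
qed simp

lemma psem_pmul: "psem (pmul P Q R) = smult (psem P) (psem Q) + psem R"
proof (induction P)
  case (Cons m P) then show ?case
    by (cases m) (simp add: psem_mulm smult_add add.assoc del: msem.simps)
qed simp

lemma psem_pscl: "psem (pscl k P R) = sscale (of_int k) (psem P) + psem R"
proof (induction P)
  case (Cons m P) then show ?case
    by (cases m) (auto simp: sscale_def mon_def pointwise algebra_simps)
qed simp

lemma hol5_exv [simp]: "hol5 (exv e)"
proof -
  have "hol5 (\<lambda>p. p $ i ^ n)" for i n by (induction n) simp_all
  then have "hol5 (\<lambda>p. exv (Ex a b c d e) p)" for a b c d e by (simp only: exv.simps hol5_mult)
  then show ?thesis by (cases e) (simp only:)
qed

lemma sfun_ok_mon [simp]: "hol5 a \<Longrightarrow> sfun_ok (mon S a)"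
proof -
  assume "hol5 a"
  then have "hol5 (mon S a U)" for U by (cases "U = S") (auto simp: mon_def)
  then show ?thesis by (simp add: sfun_ok_def)
qed

lemma sfun_ok_psem [simp]: "sfun_ok (psem P)"
proof (induction P)
  case (Cons m P) then show ?case by (cases m) simp
qed simp

lemma vf_ok_vsem [simp]: "vf_ok (vsem X)"
  by (cases X) (simp add: vf_ok_def)

lemma pdx_mon: "pdx i (mon S a) = mon S (pdf i a)"
  by (auto simp: pdx_pdf mon_def pointwise)

lemma pdth_mon: "pdth k (mon S a) = (if k \<in> S then mon (S - {k}) (\<lambda>p. inv_sign {k} (S - {k}) * a p) else 0)"
  by (auto simp: pdth_sign mon_def pointwise)

text \<open>At exponent zero the truncated difference is harmless, because the factor in front
  vanishes; hence no case distinction.\<close>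

lemma pdf_exv:
  "pdf 0 (\<lambda>p. k * exv (Ex a b c d e) p) = (\<lambda>p. of_nat a * k * exv (Ex (a-1) b c d e) p)"
  "pdf 1 (\<lambda>p. k * exv (Ex a b c d e) p) = (\<lambda>p. of_nat b * k * exv (Ex a (b-1) c d e) p)"
  "pdf 2 (\<lambda>p. k * exv (Ex a b c d e) p) = (\<lambda>p. of_nat c * k * exv (Ex a b (c-1) d e) p)"
  "pdf 3 (\<lambda>p. k * exv (Ex a b c d e) p) = (\<lambda>p. of_nat d * k * exv (Ex a b c (d-1) e) p)"
  "pdf 4 (\<lambda>p. k * exv (Ex a b c d e) p) = (\<lambda>p. of_nat e * k * exv (Ex a b c d (e-1)) p)"
  by (rule ext, rule pdf_eqI, auto simp: cupd_nth intro!: derivative_eq_intros)+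

lemma pdx_M:
  "pdx 0 (msem (M k (Ex a b c d e) q)) = msem (M (int a * k) (Ex (a-1) b c d e) q)"
  "pdx 1 (msem (M k (Ex a b c d e) q)) = msem (M (int b * k) (Ex a (b-1) c d e) q)"
  "pdx 2 (msem (M k (Ex a b c d e) q)) = msem (M (int c * k) (Ex a b (c-1) d e) q)"
  "pdx 3 (msem (M k (Ex a b c d e) q)) = msem (M (int d * k) (Ex a b c (d-1) e) q)"
  "pdx 4 (msem (M k (Ex a b c d e) q)) = msem (M (int e * k) (Ex a b c d (e-1)) q)"
  by (simp_all only: msem.simps pdx_mon pdf_exv of_int_mult of_int_of_nat_eq)

lemma sfun_ok_msem [simp]: "sfun_ok (msem m)"
  by (cases m) simp

lemma msem_0: "msem (M 0 e q) = 0"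
  by simp

lemma psem_dx: "psem (dx0 P) = pdx 0 (psem P)" "psem (dx1 P) = pdx 1 (psem P)" "psem (dx2 P) = pdx 2 (psem P)"
  "psem (dx3 P) = pdx 3 (psem P)" "psem (dx4 P) = pdx 4 (psem P)"
proof -
  have z: "pdx i 0 = 0" for i using der_zero[of "Inl i"] by simp
  note s = pdx_add[OF sfun_ok_msem sfun_ok_psem] pdx_M msem_0 z psem.simps diff_Suc_1 of_nat_0 mult_zero_left
    add_0_left diff_0_eq_0
  show "psem (dx0 P) = pdx 0 (psem P)"
    by (induction P rule: dx0.induct) (simp_all only: dx0.simps s)
  show "psem (dx1 P) = pdx 1 (psem P)"
    by (induction P rule: dx1.induct) (simp_all only: dx1.simps s)
  show "psem (dx2 P) = pdx 2 (psem P)"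
    by (induction P rule: dx2.induct) (simp_all only: dx2.simps s)
  show "psem (dx3 P) = pdx 3 (psem P)"
    by (induction P rule: dx3.induct) (simp_all only: dx3.simps s)
  show "psem (dx4 P) = pdx 4 (psem P)"
    by (induction P rule: dx4.induct) (simp_all only: dx4.simps s)
qed

lemma osg_single: 
  "osg (Od True False False False False False) q = False"
  "osg (Od False True False False False False) (Od b0 b1 b2 b3 b4 b5) = b0"
  "osg (Od False False True False False False) (Od b0 b1 b2 b3 b4 b5) = xr b0 b1"
  "osg (Od False False False True False False) (Od b0 b1 b2 b3 b4 b5) = xr b0 (xr b1 b2)"
  "osg (Od False False False False True False) (Od b0 b1 b2 b3 b4 b5) = xr b0 (xr b1 (xr b2 b3))"
  "osg (Od False False False False False True) (Od b0 b1 b2 b3 b4 b5) = xr b0 (xr b1 (xr b2 (xr b3 b4)))"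
proof -
  have xr: "xr b False = b" "xr b True = (\<not> b)" "xr (xr a b) c = xr a (xr b c)" "xr a b = xr b a" for a b c
    by (cases a; cases b; cases c; simp)+
  show "osg (Od True False False False False False) q = False" by (cases q) (simp add: isg_Cons)
  show "osg (Od False True False False False False) (Od b0 b1 b2 b3 b4 b5) = b0" by (simp add: isg_Cons xr(1))
  show "osg (Od False False True False False False) (Od b0 b1 b2 b3 b4 b5) = xr b0 b1" by (simp add: isg_Cons xr(1) xr(4)[of b1])
  show "osg (Od False False False True False False) (Od b0 b1 b2 b3 b4 b5) = xr b0 (xr b1 b2)"
    by (cases b0; cases b1; cases b2; simp)
  show "osg (Od False False False False True False) (Od b0 b1 b2 b3 b4 b5) = xr b0 (xr b1 (xr b2 b3))"
    by (cases b0; cases b1; cases b2; cases b3; simp)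
  show "osg (Od False False False False False True) (Od b0 b1 b2 b3 b4 b5) = xr b0 (xr b1 (xr b2 (xr b3 b4)))"
    by (cases b0; cases b1; cases b2; cases b3; cases b4; simp)
qed

lemma single_oset: 
  "{0::6} = oset (Od True False False False False False)" "{1::6} = oset (Od False True False False False False)"
  "{2::6} = oset (Od False False True False False False)" "{3::6} = oset (Od False False False True False False)"
  "{4::6} = oset (Od False False False False True False)" "{5::6} = oset (Od False False False False False True)"
  by (simp_all add: set_eq_iff all_6)

lemma oset_remove:
  "oset (Od b0 b1 b2 b3 b4 b5) - {0} = oset (Od False b1 b2 b3 b4 b5)"
  "oset (Od b0 b1 b2 b3 b4 b5) - {1} = oset (Od b0 False b2 b3 b4 b5)"
  "oset (Od b0 b1 b2 b3 b4 b5) - {2} = oset (Od b0 b1 False b3 b4 b5)"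
  "oset (Od b0 b1 b2 b3 b4 b5) - {3} = oset (Od b0 b1 b2 False b4 b5)"
  "oset (Od b0 b1 b2 b3 b4 b5) - {4} = oset (Od b0 b1 b2 b3 False b5)"
  "oset (Od b0 b1 b2 b3 b4 b5) - {5} = oset (Od b0 b1 b2 b3 b4 False)"
  by (simp_all add: set_eq_iff all_6)

lemma oset_mem:
  "0 \<in> oset (Od b0 b1 b2 b3 b4 b5) = b0" "1 \<in> oset (Od b0 b1 b2 b3 b4 b5) = b1" "2 \<in> oset (Od b0 b1 b2 b3 b4 b5) = b2"
  "3 \<in> oset (Od b0 b1 b2 b3 b4 b5) = b3" "4 \<in> oset (Od b0 b1 b2 b3 b4 b5) = b4" "5 \<in> oset (Od b0 b1 b2 b3 b4 b5) = b5"
  by simp_all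

lemma inv_sign_single:
  "inv_sign {0} (oset q) = sg (osg (Od True False False False False False) q)"
  "inv_sign {1} (oset q) = sg (osg (Od False True False False False False) q)"
  "inv_sign {2} (oset q) = sg (osg (Od False False True False False False) q)"
  "inv_sign {3} (oset q) = sg (osg (Od False False False True False False) q)"
  "inv_sign {4} (oset q) = sg (osg (Od False False False False True False) q)"
  "inv_sign {5} (oset q) = sg (osg (Od False False False False False True) q)"
  unfolding single_oset inv_sign_oset by (rule refl)+

lemma psem_dcons: "psem (dcons b s c e q R) = (if b then mon (oset q) (\<lambda>p. sg s * (of_int c * exv e p)) + psem R else psem R)"
  by (cases b) (simp_all add: of_int_sgi mult_ac)

lemma psem_dt: "psem (dt0 P) = pdth 0 (psem P)" "psem (dt1 P) = pdth 1 (psem P)" "psem (dt2 P) = pdth 2 (psem P)"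
  "psem (dt3 P) = pdth 3 (psem P)" "psem (dt4 P) = pdth 4 (psem P)" "psem (dt5 P) = pdth 5 (psem P)"
proof -
  have z: "pdth i 0 = 0" for i using der_zero[of "Inr i"] by simp
  note s = psem_dcons pdth_add pdth_mon psem.simps msem.simps oset_remove oset_mem inv_sign_single osg_single z
  show "psem (dt0 P) = pdth 0 (psem P)"
    by (induction P rule: dt0.induct) (simp_all only: s dt0.simps if_True if_False split: if_split, simp_all)
  show "psem (dt1 P) = pdth 1 (psem P)"
    by (induction P rule: dt1.induct) (simp_all only: s dt1.simps if_True if_False split: if_split, simp_all)
  show "psem (dt2 P) = pdth 2 (psem P)"
    by (induction P rule: dt2.induct) (simp_all only: s dt2.simps if_True if_False split: if_split, simp_all)
  show "psem (dt3 P) = pdth 3 (psem P)"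
    by (induction P rule: dt3.induct) (simp_all only: s dt3.simps if_True if_False split: if_split, simp_all)
  show "psem (dt4 P) = pdth 4 (psem P)"
    by (induction P rule: dt4.induct) (simp_all only: s dt4.simps if_True if_False split: if_split, simp_all)
  show "psem (dt5 P) = pdth 5 (psem P)"
    by (induction P rule: dt5.induct) (simp_all only: s dt5.simps if_True if_False split: if_split, simp_all)
qed

lemma psem_pvapp: "psem (pvapp X P R) = vapp (vsem X) (psem P) + psem R"
proof -
  have "vapp Y f = (\<Sum>i\<in>UNIV. smult (fst Y i) (pdx i f)) + (\<Sum>k\<in>UNIV. smult (snd Y k) (pdth k f))" for Y f
    by (simp add: vapp_def pointwise sum_fun_apply2)
  then show ?thesis
    by (cases X) (simp add: psem_pmul psem_dx psem_dt sum_5 sum_6 add.assoc)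
qed

text \<open>Zero test: monomials are grouped first by their odd part, then by their exponents.\<close>

fun ksel where "ksel True c e m (A, B) = ((c, e) # A, B)" | "ksel False c e m (A, B) = (A, m # B)"
fun selo :: "odds \<Rightarrow> poly \<Rightarrow> (int \<times> expo) list \<times> poly" where
  "selo q [] = ([], [])"
| "selo q (M c e q' # P) = ksel (q = q') c e (M c e q') (selo q P)"
fun kcol where "kcol True d e (s, A) = (s + d, A)" | "kcol False d e (s, A) = (s, (d, e) # A)"
fun col :: "expo \<Rightarrow> int \<Rightarrow> (int \<times> expo) list \<Rightarrow> int \<times> (int \<times> expo) list" where
  "col e s [] = (s, [])"
| "col e s ((d, e') # A) = kcol (e = e') d e' (col e s A)"
text \<open>The natural number is fuel: the recursion is on what \<open>col\<close> leaves over, not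
  on the tail of the list. Running out of fuel answers \<open>False\<close>, so soundness holds for
  any amount of it.\<close>

fun zl :: "nat \<Rightarrow> (int \<times> expo) list \<Rightarrow> bool" and zc :: "nat \<Rightarrow> int \<times> (int \<times> expo) list \<Rightarrow> bool" where
  "zl n [] = True" | "zl 0 (x # A) = False" | "zl (Suc n) ((c, e) # A) = zc n (col e c A)"
| "zc n (s, A) = (s = 0 \<and> zl n A)"
fun zp :: "nat \<Rightarrow> poly \<Rightarrow> bool" and zq where
  "zp n [] = True" | "zp 0 (x # P) = False" | "zp (Suc n) (M c e q # P) = zq n c e (selo q P)"
| "zq n c e (A, P) = (zl (Suc (length A)) ((c, e) # A) \<and> zp n P)"

definition pzero :: "poly \<Rightarrow> bool" where "pzero P = zp (length P) P"

primrec lsem :: "odds \<Rightarrow> (int \<times> expo) list \<Rightarrow> sfun" where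
  "lsem q [] = 0" | "lsem q (x # A) = msem (M (fst x) (snd x) q) + lsem q A"

lemma psem_selo: "psem P = lsem q (fst (selo q P)) + psem (snd (selo q P))"
proof (induction P)
  case (Cons m P)
  obtain c e q' where m: "m = M c e q'" by (cases m)
  show ?case using Cons
    by (cases "selo q P"; cases "q = q'") (simp_all add: m add_ac del: msem.simps)
qed simp

lemma msem_plus: "msem (M (c + d) e q) = msem (M c e q) + msem (M d e q)"
  by (simp add: mon_def pointwise algebra_simps)

lemma lsem_col: "lsem q ((c, e) # A) = msem (M (fst (col e c A)) e q) + lsem q (snd (col e c A))"
proof (induction A)
  case (Cons x A)
  obtain d e' where x: "x = (d, e')" by (cases x)
  show ?case using Cons
    by (cases "col e c A"; cases "e = e'") (simp_all add: x add_ac msem_plus del: msem.simps)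
qed simp

lemma zl_sound: "zl n A \<Longrightarrow> lsem q A = 0" and "zc n X \<Longrightarrow> fst X = 0 \<and> lsem q (snd X) = 0"
proof (induction n A and n X rule: zl_zc.induct)
  case (3 n c e A)
  then show ?case unfolding lsem_col by simp
qed auto

lemma zp_sound: "zp n P \<Longrightarrow> psem P = 0" and "zq n c e X \<Longrightarrow> \<forall>q. lsem q ((c, e) # fst X) = 0 \<and> psem (snd X) = 0"
proof (induction n P and n c e X rule: zp_zq.induct)
  case (3 n c e q P)
  then show ?case using psem_selo[of P q] by (simp add: add.assoc[symmetric] del: msem.simps)
next
  case (4 n c e A P)
  then show ?case using zl_sound(1) by (auto simp del: zl.simps lsem.simps)
qed auto

lemma pzero_sound: "pzero P \<Longrightarrow> psem P = 0"
  by (simp add: pzero_def zp_sound)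

section \<open>Polynomial vector fields: notation, brackets and contractions\<close>

datatype coord = Kx | Ku | Kux | Kuxx | Kz | Knu | Ktau | Kunu | Kutau | Kuxnu | Kuxtau

fun ins :: "coord \<Rightarrow> mono \<Rightarrow> mono" where
  "ins Kx (M k (Ex a b c d e) q) = M k (Ex (Suc a) b c d e) q"
| "ins Ku (M k (Ex a b c d e) q) = M k (Ex a (Suc b) c d e) q"
| "ins Kux (M k (Ex a b c d e) q) = M k (Ex a b (Suc c) d e) q"
| "ins Kuxx (M k (Ex a b c d e) q) = M k (Ex a b c (Suc d) e) q"
| "ins Kz (M k (Ex a b c d e) q) = M k (Ex a b c d (Suc e)) q"
| "ins Knu (M k e (Od b0 b1 b2 b3 b4 b5)) = M k e (Od True b1 b2 b3 b4 b5)"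
| "ins Ktau (M k e (Od b0 b1 b2 b3 b4 b5)) = M k e (Od b0 True b2 b3 b4 b5)"
| "ins Kunu (M k e (Od b0 b1 b2 b3 b4 b5)) = M k e (Od b0 b1 True b3 b4 b5)"
| "ins Kutau (M k e (Od b0 b1 b2 b3 b4 b5)) = M k e (Od b0 b1 b2 True b4 b5)"
| "ins Kuxnu (M k e (Od b0 b1 b2 b3 b4 b5)) = M k e (Od b0 b1 b2 b3 True b5)"
| "ins Kuxtau (M k e (Od b0 b1 b2 b3 b4 b5)) = M k e (Od b0 b1 b2 b3 b4 True)"

text \<open>A repeated even coordinate raises its exponent, while an odd one only sets its flag. The
  list therefore denotes the product with the odd coordinates in increasing order, and the order of
  the list carries no sign.\<close>

fun mo :: "int \<Rightarrow> coord list \<Rightarrow> mono" where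
  "mo k [] = M k (Ex 0 0 0 0 0) (Od False False False False False False)"
| "mo k (v # vs) = ins v (mo k vs)"

fun pvadd :: "int \<Rightarrow> pvf \<Rightarrow> pvf \<Rightarrow> pvf" where
  "pvadd k (PV a0 a1 a2 a3 a4 a5 a6 a7 a8 a9 a10) (PV b0 b1 b2 b3 b4 b5 b6 b7 b8 b9 b10) =
    PV (pscl k a0 b0) (pscl k a1 b1) (pscl k a2 b2) (pscl k a3 b3) (pscl k a4 b4) (pscl k a5 b5)
      (pscl k a6 b6) (pscl k a7 b7) (pscl k a8 b8) (pscl k a9 b9) (pscl k a10 b10)"

fun pvzero :: "pvf \<Rightarrow> bool" where
  "pvzero (PV a0 a1 a2 a3 a4 a5 a6 a7 a8 a9 a10) \<longleftrightarrow> pzero a0 \<and> pzero a1 \<and> pzero a2 \<and> pzero a3 \<and> pzero a4 \<and>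
    pzero a5 \<and> pzero a6 \<and> pzero a7 \<and> pzero a8 \<and> pzero a9 \<and> pzero a10"

fun pbc :: "int \<Rightarrow> pvf \<Rightarrow> pvf \<Rightarrow> poly \<Rightarrow> poly \<Rightarrow> poly" where
  "pbc s X Y a b = pvapp X b (pscl s (pvapp Y a []) [])"

text \<open>The two fields occur twice: as derivations, and taken apart into the components on which
  the derivations act. The integer s is minus the Koszul sign.\<close>

fun pbr2 :: "int \<Rightarrow> pvf \<Rightarrow> pvf \<Rightarrow> pvf \<Rightarrow> pvf \<Rightarrow> pvf" where
  "pbr2 s X Y (PV a0 a1 a2 a3 a4 a5 a6 a7 a8 a9 a10) (PV b0 b1 b2 b3 b4 b5 b6 b7 b8 b9 b10) =
     PV (pbc s X Y a0 b0) (pbc s X Y a1 b1) (pbc s X Y a2 b2) (pbc s X Y a3 b3) (pbc s X Y a4 b4) (pbc s X Y a5 b5)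
      (pbc s X Y a6 b6) (pbc s X Y a7 b7) (pbc s X Y a8 b8) (pbc s X Y a9 b9) (pbc s X Y a10 b10)"

definition pbr :: "int \<Rightarrow> pvf \<Rightarrow> pvf \<Rightarrow> pvf" where "pbr s X Y = pbr2 s X Y X Y"

fun plc :: "pvf list \<Rightarrow> (int \<times> nat) list \<Rightarrow> pvf" where
  "plc G [] = PV [] [] [] [] [] [] [] [] [] [] []"
| "plc G ((k, m) # L) = pvadd k (G ! m) (plc G L)"

fun pcon :: "pvf \<Rightarrow> pvf \<Rightarrow> poly \<Rightarrow> poly" where
  "pcon (PV a0 a1 a2 a3 a4 a5 a6 a7 a8 a9 a10) (PV b0 b1 b2 b3 b4 b5 b6 b7 b8 b9 b10) R =
    pmul a0 b0 (pmul a1 b1 (pmul a2 b2 (pmul a3 b3 (pmul a4 b4 (pmul a5 b5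
      (pmul a6 b6 (pmul a7 b7 (pmul a8 b8 (pmul a9 b9 (pmul a10 b10 R))))))))))"

fun opar where "opar (Od b0 b1 b2 b3 b4 b5) = xr b0 (xr b1 (xr b2 (xr b3 (xr b4 b5))))"
fun phom :: "bool \<Rightarrow> poly \<Rightarrow> bool" where
  "phom b [] = True" | "phom b (M c e q # P) = (opar q = b \<and> phom b P)"
fun pvhom :: "bool \<Rightarrow> pvf \<Rightarrow> bool" where
  "pvhom b (PV a0 a1 a2 a3 a4 b0 b1 b2 b3 b4 b5) \<longleftrightarrow> phom b a0 \<and> phom b a1 \<and> phom b a2 \<and> phom b a3 \<and> phom b a4 \<and>
    phom (\<not> b) b0 \<and> phom (\<not> b) b1 \<and> phom (\<not> b) b2 \<and> phom (\<not> b) b3 \<and> phom (\<not> b) b4 \<and> phom (\<not> b) b5"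

text \<open>Contraction with a one-form whose coefficients are stored in the same format as a
  polynomial field. The components of X stand on the left, which makes the contraction left linear
  over superfunctions.\<close>

definition con :: "pvf \<Rightarrow> vf \<Rightarrow> sfun" where
  "con W X = (\<Sum>A\<in>UNIV. smult (cmp X A) (cmp (vsem W) A))"

lemma con_linear: "con W (X + Y) = con W X + con W Y" "con W (X - Y) = con W X - con W Y"
  "con W (vf_scale c X) = sscale c (con W X)" "con W (vf_cmul f X) = smult f (con W X)" "con W 0 = 0"
  by (simp_all add: con_def smult_add smult_diff smult_scale sscale_sum smult_sum smult_assoc sum.distrib sum_subtractf)

lemma con_sum: "con W (\<Sum>a\<in>A. X a) = (\<Sum>a\<in>A. con W (X a))"
  by (induction A rule: infinite_finite_induct) (simp_all add: con_linear)

lemma con_expand: "con (PV w0 w1 w2 w3 w4 v0 v1 v2 v3 v4 v5) X =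
   smult (fst X 0) (psem w0) + smult (fst X 1) (psem w1) + smult (fst X 2) (psem w2) + smult (fst X 3) (psem w3)
   + smult (fst X 4) (psem w4) + smult (snd X 0) (psem v0) + smult (snd X 1) (psem v1) + smult (snd X 2) (psem v2)
   + smult (snd X 3) (psem v3) + smult (snd X 4) (psem v4) + smult (snd X 5) (psem v5)"
  unfolding con_def UNIV_Plus_UNIV[symmetric]
  by (subst sum.Plus) (simp_all add: sum_5 sum_6 add.assoc)

lemma sfun_ok_con [simp]: "vf_ok X \<Longrightarrow> sfun_ok (con W X)"
  by (simp add: con_def)

lemma psem_pcon: "psem (pcon X W R) = con W (vsem X) + psem R"
  by (cases X; cases W) (simp add: con_expand psem_pmul add.assoc)

lemma vsem_pvadd: "vsem (pvadd k X Y) = vf_scale (of_int k) (vsem X) + vsem Y"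
  by (cases X; cases Y; rule vf_eqI; rename_tac A; case_tac A) (auto simp: psem_pscl vf_scale_def plus_fun_apply)

lemma pvzero_sound: "pvzero X \<Longrightarrow> vsem X = 0"
proof (cases X)
  case (PV a0 a1 a2 a3 a4 a5 a6 a7 a8 a9 a10)
  assume "pvzero X"
  then show ?thesis
    by (intro vf_eqI, rename_tac A, case_tac A) (auto simp: PV pzero_sound zero_fun_apply)
qed

lemma vsem_pbr:
  assumes "of_int s = - sg (a \<and> b)"
  shows "vsem (pbr s X Y) = hbr a b (vsem X) (vsem Y)"
proof (rule vf_eqI)
  fix A
  have "psem (pbc s X Y p q) = vapp (vsem X) (psem q) - sscale (sg (a \<and> b)) (vapp (vsem Y) (psem p))" for p q
    using assms by (simp add: psem_pvapp psem_pscl sscale_def pointwise)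
  then show "cmp (vsem (pbr s X Y)) A = cmp (hbr a b (vsem X) (vsem Y)) A"
    unfolding cmp_hbr pbr_def by (cases X; cases Y; cases A) (auto simp del: pbc.simps)
qed

lemma vsem_plc_Nil: "vsem (plc G []) = 0"
  by (rule vf_eqI, rename_tac A, case_tac A) (auto simp: zero_fun_apply)

lemma vsem_plc_Cons: "vsem (plc G ((k, m) # L)) = vf_scale (of_int k) (vsem (G ! m)) + vsem (plc G L)"
  by (simp add: vsem_pvadd)

lemmas vsem_plc = vsem_plc_Nil vsem_plc_Cons

lemma minus_one_card: "(-1) ^ card S = sg (0 \<in> S) * sg (1 \<in> S) * sg (2 \<in> S) * sg (3 \<in> S) * sg (4 \<in> S) * sg (5 \<in> S)"
  for S :: "6 set"
proof -
  have "(-1) ^ card S = (\<Prod>k\<in>UNIV. sg (k \<in> S))"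
    by (simp add: sg_def prod.If_cases)
  then show ?thesis unfolding UNIV_6 by (simp add: mult.assoc)
qed

lemma opar_odd: "odd (card (oset q)) = opar q"
proof -
  obtain b0 b1 b2 b3 b4 b5 where q: "q = Od b0 b1 b2 b3 b4 b5" by (cases q)
  have "(-1) ^ card (oset q) = sg (opar q)"
    unfolding minus_one_card q oset_mem by (simp add: sg_xr)
  then show ?thesis by (cases "opar q") (auto simp: minus_one_power_iff split: if_splits)
qed

lemma phom_sound: "phom b P \<Longrightarrow> shom b (psem P)"
proof (induction P)
  case (Cons m P)
  obtain c e q where m: "m = M c e q" by (cases m)
  have "shom b (msem m)" using Cons.prems opar_odd[of q] by (auto simp: m shom_def mon_def)
  then show ?case using Cons by (simp add: m shom_add)
qed simp

lemma pvhom_sound: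
  assumes "pvhom b X"
  shows "vf_hom b (vsem X)"
proof -
  obtain a0 a1 a2 a3 a4 a5 a6 a7 a8 a9 a10 where X: "X = PV a0 a1 a2 a3 a4 a5 a6 a7 a8 a9 a10" by (cases X)
  show ?thesis unfolding vf_hom_iff
  proof
    fix A show "shom (b \<noteq> podd A) (cmp (vsem X) A)"
      using assms by (cases A) (auto simp: X phom_sound)
  qed
qed

definition pcheck :: "bool list \<Rightarrow> pvf list \<Rightarrow> nat \<Rightarrow> nat \<Rightarrow> (int \<times> nat) list \<Rightarrow> bool" where
  "pcheck ps G a b L = pvzero (pvadd (-1) (pbr (if ps ! a \<and> ps ! b then 1 else -1) (G ! a) (G ! b)) (plc G L))"

lemma pcheck_sound:
  assumes "pcheck ps G a b L"
  shows "hbr (ps ! a) (ps ! b) (vsem (G ! a)) (vsem (G ! b)) = vsem (plc G L)"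
proof -
  have s: "of_int (if ps ! a \<and> ps ! b then 1 else -1) = - sg (ps ! a \<and> ps ! b)" by (simp add: sg_def)
  have m: "vf_scale (of_int (-1)) H = - H" for H by (rule vf_eqI) simp
  have "vsem (plc G L) - hbr (ps ! a) (ps ! b) (vsem (G ! a)) (vsem (G ! b)) = 0"
    using pvzero_sound[OF assms[unfolded pcheck_def]]
    unfolding vsem_pvadd vsem_pbr[OF s] m by simp
  then show ?thesis by simp
qed

subsection \<open>An adapted frame\<close>

text \<open>The first six fields span the distribution, the next three the rest of its derived distribution. The
  factors 2 and 4 make all coefficients integral and all structure constants equal to 0, 1 or -1.\<close>

definition FL :: "pvf list" where
  "FL = [
    PV [mo 2 []] [mo 2 [Kux]] [mo 2 [Kuxx]] [] [mo 2 [Kuxnu, Kuxtau], mo 1 [Kuxx, Kuxx]] [] []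
     [mo 2 [Kuxnu]] [mo 2 [Kuxtau]] [] [],
    PV [] [] [] [mo 1 []] [] [] [] [] [] [] [],
    PV [] [mo 2 [Kutau]] [mo 2 [Kuxtau]] [] [mo 2 [Kuxx, Kuxtau]] [] [mo 2 []] [mo 2 [Kuxx]] [] [] [],
    PV [] [] [] [] [] [] [] [] [] [] [mo 1 []],
    PV [] [mo 2 [Kunu]] [mo 2 [Kuxnu]] [] [mo 2 [Kuxx, Kuxnu]] [mo 2 []] [] [] [mo (-2) [Kuxx]] [] [],
    PV [] [] [] [] [] [] [] [] [] [mo 1 []] [],
    PV [] [] [mo 2 []] [] [mo 2 [Kuxx]] [] [] [] [] [] [],
    PV [] [] [] [] [mo (-2) [Kuxnu]] [] [] [] [mo 2 []] [] [],
    PV [] [] [] [] [mo 2 [Kuxtau]] [] [] [mo 2 []] [] [] [],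
    PV [] [mo 4 []] [] [] [] [] [] [] [] [] [],
    PV [] [] [] [] [mo 2 []] [] [] [] [] [] []]"

definition fpar :: "bool list" where
  "fpar = [False, False, True, True, True, True, False, True, True, False, False]"

text \<open>The dual coframe, up to the factors in WK.\<close>

definition WL :: "pvf list" where
  "WL = [
    PV [mo 1 []] [] [] [] [] [] [] [] [] [] [],
    PV [] [] [] [mo 1 []] [] [] [] [] [] [] [],
    PV [] [] [] [] [] [] [mo 1 []] [] [] [] [],
    PV [] [] [] [] [] [] [] [] [] [] [mo 1 []],
    PV [] [] [] [] [] [mo 1 []] [] [] [] [] [],
    PV [] [] [] [] [] [] [] [] [] [mo 1 []] [],
    PV [mo (-1) [Kuxx]] [] [mo 1 []] [] [] [mo (-1) [Kuxnu]] [mo (-1) [Kuxtau]] [] [] [] [],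
    PV [mo (-1) [Kuxtau]] [] [] [] [] [mo 1 [Kuxx]] [] [] [mo 1 []] [] [],
    PV [mo (-1) [Kuxnu]] [] [] [] [] [] [mo (-1) [Kuxx]] [mo 1 []] [] [] [],
    PV [mo (-1) [Kux]] [mo 1 []] [] [] [] [mo (-1) [Kunu]] [mo (-1) [Kutau]] [] [] [] [],
    PV [mo 2 [Kuxnu, Kuxtau], mo 1 [Kuxx, Kuxx]] [] [mo (-2) [Kuxx]] [] [mo 2 []] [mo 2 [Kuxx, Kuxnu]]
     [mo 2 [Kuxx, Kuxtau]] [mo (-2) [Kuxtau]] [mo 2 [Kuxnu]] [] []]"

definition WK :: "int list" where "WK = [2, 1, 2, 1, 2, 1, 2, 2, 2, 4, 4]"

abbreviation fr :: "nat \<Rightarrow> vf" where "fr a \<equiv> vsem (FL ! a)"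

text \<open>Only brackets with the six generators are stored, and \<open>brl\<close> reads an absent
  pair as a zero bracket. The table exhibits the ranks (2|4), (3|6), (5|6) of the derived
  flag.\<close>

definition brtab :: "((nat \<times> nat) \<times> (int \<times> nat) list) list" where
  "brtab = [((0, 1), [(-1, 6)]), ((0, 3), [(-1, 7)]), ((0, 5), [(-1, 8)]), ((1, 0), [(1, 6)]),
    ((1, 2), [(1, 8)]), ((1, 4), [(-1, 7)]), ((2, 1), [(-1, 8)]), ((2, 3), [(1, 6)]), ((3, 0), [(1, 7)]),
    ((3, 2), [(1, 6)]), ((4, 1), [(1, 7)]), ((4, 5), [(1, 6)]), ((5, 0), [(1, 8)]), ((5, 4), [(1, 6)]),
    ((6, 0), [(1, 9)]), ((6, 1), [(-1, 10)]), ((7, 2), [(1, 9)]), ((7, 5), [(-1, 10)]),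
    ((8, 3), [(1, 10)]), ((8, 4), [(1, 9)])]"

definition brl :: "nat \<Rightarrow> nat \<Rightarrow> (int \<times> nat) list" where
  "brl a j = (case map_of brtab (a, j) of None \<Rightarrow> [] | Some L \<Rightarrow> L)"

text \<open>In the third check the accumulator of \<open>pcon\<close> holds minus the expected
  constant, so that the duality of frame and coframe also becomes a zero test.\<close>

lemma frame_checks:
  "list_all (\<lambda>a. list_all (\<lambda>j. pcheck fpar FL a j (brl a j)) [0..<6]) [0..<11]"
  "list_all (\<lambda>a. pvhom (fpar ! a) (FL ! a)) [0..<11]"
  "list_all (\<lambda>a. list_all (\<lambda>b. pzero (pcon (FL ! b) (WL ! a) [mo (if a = b then - (WK ! a) else 0) []])) [0..<11]) [0..<11]"
  "list_all (\<lambda>a. WK ! a \<noteq> 0) [0..<11]"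
  by code_simp+

lemma list_all_upt: "list_all P [0..<n] \<longleftrightarrow> (\<forall>a<n. P a)"
  by (auto simp: list_all_iff)

lemma fr_hom: "a < 11 \<Longrightarrow> vf_hom (fpar ! a) (fr a)"
  using frame_checks(2) pvhom_sound unfolding list_all_upt by blast

lemma hbr_fr: "a < 11 \<Longrightarrow> j < 6 \<Longrightarrow> hbr (fpar ! a) (fpar ! j) (fr a) (fr j) = vsem (plc FL (brl a j))"
  using frame_checks(1) pcheck_sound unfolding list_all_upt by blast

lemma psem_const: "psem [mo c []] = sconst (of_int c)"
proof -
  have "oset (Od False False False False False False) = {}" by (simp add: set_eq_iff all_6)
  then show ?thesis by (simp add: mon_def sconst_def del: oset.simps)
qed

lemma con_fr: "a < 11 \<Longrightarrow> b < 11 \<Longrightarrow> con (WL ! a) (fr b) = sconst (if a = b then of_int (WK ! a) else 0)"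
proof -
  assume ab: "a < 11" "b < 11"
  have "con (WL ! a) (fr b) + sconst (of_int (if a = b then - (WK ! a) else 0)) = 0"
  proof -
    have "pzero (pcon (FL ! b) (WL ! a) [mo (if a = b then - (WK ! a) else 0) []])"
      using frame_checks(3) ab unfolding list_all_upt by blast
    from pzero_sound[OF this] show ?thesis by (simp only: psem_pcon psem_const)
  qed
  then show ?thesis by (auto simp: sconst_def pointwise split: if_splits)
qed

lemma WK_nonzero: "a < 11 \<Longrightarrow> WK ! a \<noteq> 0"
  using frame_checks(4) unfolding list_all_upt by blast

text \<open>The coframe is triangular in the coordinate differentials: the first six forms are
  differentials themselves, and each later one contains a single component not yet known to vanish,
  with constant nonzero coefficient.\<close>

lemma con_eq_0_imp:
  assumes "\<And>a. a < 11 \<Longrightarrow> con (WL ! a) X = 0"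
  shows "X = 0"
proof -
  note c = psem_const smult_const sscale_simps psem.simps(1) smult_zero add_0_left add_0_right
  have n: "sscale k f = 0 \<Longrightarrow> k \<noteq> 0 \<Longrightarrow> f = 0" for k f by (auto simp: sscale_def pointwise)
  note w = assms[unfolded WL_def]
  have 0: "fst X 0 = 0" using w[of 0] unfolding nth_Cons_0 con_expand c by (auto dest: n)
  have 1: "fst X 3 = 0" using w[of "Suc 0"] unfolding nth_Cons_0 nth_Cons_Suc con_expand c by (auto dest: n)
  have 2: "snd X 1 = 0" using w[of "Suc (Suc 0)"] unfolding nth_Cons_0 nth_Cons_Suc con_expand c by (auto dest: n)
  have 3: "snd X 5 = 0" using w[of "Suc (Suc (Suc 0))"] unfolding nth_Cons_0 nth_Cons_Suc con_expand c by (auto dest: n)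
  have 4: "snd X 0 = 0" using w[of "Suc (Suc (Suc (Suc 0)))"] unfolding nth_Cons_0 nth_Cons_Suc con_expand c by (auto dest: n)
  have 5: "snd X 4 = 0" using w[of "Suc (Suc (Suc (Suc (Suc 0))))"] unfolding nth_Cons_0 nth_Cons_Suc con_expand c by (auto dest: n)
  note z = 0 1 2 3 4 5
  have 6: "fst X 2 = 0" using w[of "Suc (Suc (Suc (Suc (Suc (Suc 0)))))"] unfolding nth_Cons_0 nth_Cons_Suc con_expand c z by (auto dest: n)
  have 7: "snd X 3 = 0" using w[of "Suc (Suc (Suc (Suc (Suc (Suc (Suc 0))))))"] unfolding nth_Cons_0 nth_Cons_Suc con_expand c z by (auto dest: n)
  have 8: "snd X 2 = 0" using w[of "Suc (Suc (Suc (Suc (Suc (Suc (Suc (Suc 0)))))))"] unfolding nth_Cons_0 nth_Cons_Suc con_expand c z by (auto dest: n)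
  have 9: "fst X 1 = 0" using w[of "Suc (Suc (Suc (Suc (Suc (Suc (Suc (Suc (Suc 0))))))))"] unfolding nth_Cons_0 nth_Cons_Suc con_expand c z by (auto dest: n)
  have 10: "fst X 4 = 0" using w[of "Suc (Suc (Suc (Suc (Suc (Suc (Suc (Suc (Suc (Suc 0)))))))))"]
    unfolding nth_Cons_0 nth_Cons_Suc con_expand c z 6 7 8 9 by (auto dest: n)
  have "\<forall>i. fst X i = 0" "\<forall>k. snd X k = 0" unfolding all_5 all_6 using z 6 7 8 9 10 by simp_all
  then show ?thesis by (simp add: prod_eq_iff fun_eq_iff zero_fun_apply)
qed

text \<open>The a-th coefficient of a vector field in the frame.\<close>

definition fc :: "nat \<Rightarrow> vf \<Rightarrow> sfun" where
  "fc a X = sscale (1 / of_int (WK ! a)) (con (WL ! a) X)"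

lemma fc_linear: "fc a (X + Y) = fc a X + fc a Y" "fc a (X - Y) = fc a X - fc a Y"
  "fc a (vf_scale c X) = sscale c (fc a X)" "fc a (vf_cmul f X) = smult f (fc a X)" "fc a 0 = 0"
  by (simp_all add: fc_def con_linear sscale_add sscale_diff smult_scale mult.commute)

lemma fc_sum: "fc a (\<Sum>b\<in>B. X b) = (\<Sum>b\<in>B. fc a (X b))"
  by (simp add: fc_def con_sum sscale_sum)

lemma fc_fr: "a < 11 \<Longrightarrow> b < 11 \<Longrightarrow> fc a (fr b) = sconst (if a = b then 1 else 0)"
  using WK_nonzero[of a] by (auto simp: fc_def con_fr sscale_def sconst_def fun_eq_iff)

lemma sfun_ok_fc [simp]: "vf_ok X \<Longrightarrow> sfun_ok (fc a X)"
  by (simp add: fc_def)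

lemma frame_decomp: "X = (\<Sum>a<11. vf_cmul (fc a X) (fr a))"
proof -
  have "con (WL ! c) (X - (\<Sum>a<11. vf_cmul (fc a X) (fr a))) = 0" if c: "c < 11" for c
  proof -
    have "con (WL ! c) (\<Sum>a<11. vf_cmul (fc a X) (fr a)) = (\<Sum>a<11. smult (fc a X) (sconst (if c = a then of_int (WK ! c) else 0)))"
      using c by (simp add: con_sum con_linear con_fr)
    also have "\<dots> = (\<Sum>a<11. if a = c then sscale (of_int (WK ! c)) (fc a X) else 0)"
      by (intro sum.cong) (auto simp: smult_const)
    also have "\<dots> = sscale (of_int (WK ! c)) (fc c X)" using c by simp
    also have "\<dots> = con (WL ! c) X" using WK_nonzero[OF c] by (simp add: fc_def)
    finally show ?thesis by (simp add: con_linear)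
  qed
  then show ?thesis using con_eq_0_imp[of "X - (\<Sum>a<11. vf_cmul (fc a X) (fr a))"] by simp
qed

section \<open>Comparison of the frame with the given generators, and membership in the
  distribution\<close>

lemma evc_mon: "evc i = mon {} (\<lambda>p. p $ i)" "odc k = mon {k} (\<lambda>p. 1)" "sconst c = mon {} (\<lambda>p. c)"
  "sscale c (mon S a) = mon S (\<lambda>p. c * a p)"
  by (auto simp: evc_def odc_def sconst_def mon_def sscale_def fun_eq_iff)

lemma fr_gen:
  "fr 0 = vf_scale 2 Dx" "fr 1 = vf_scale 1 Duxx" "fr 2 = vf_scale 2 Dtau" "fr 3 = vf_scale 1 Duxtau"
  "fr 4 = vf_scale 2 Dnu" "fr 5 = vf_scale 1 Duxnu"
proof -
  have o: "oset (Od False False False False False False) = {}" "oset (Od True False False False False False) = {0}"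
    "oset (Od False True False False False False) = {1}" "oset (Od False False True False False False) = {2}"
    "oset (Od False False False True False False) = {3}" "oset (Od False False False False True False) = {4}"
    "oset (Od False False False False False True) = {5}" "oset (Od False False False False True True) = {4, 5}"
    by (simp_all add: set_eq_iff all_6)
  have i: "inv_sign {4} {5} = 1" using inv_sign_single(5)[of "Od False False False False False True"] single_oset(6) by simp
  have eq: "X = Y" if "\<forall>i. fst X i = fst Y i" "\<forall>k. snd X k = snd Y k" for X Y :: vf
    using that by (simp add: prod_eq_iff fun_eq_iff)
  have c: "{5, 4} = {4, 5 :: 6}" by (rule insert_commute)
  note s = c FL_def vf_scale_def evc_mon mon_smult o i power2_eq_square mult.assoc oset.simps
  note r = sadd_eq szero_eq sscale_simps sscale_add
  show "fr 0 = vf_scale 2 Dx"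
    by (rule eq; unfold all_5 all_6; simp add: s Dx_def sscale_add del: oset.simps)
  show "fr 1 = vf_scale 1 Duxx"
    by (rule eq; unfold all_5 all_6; simp add: s Duxx_def sscale_add del: oset.simps)
  show "fr 2 = vf_scale 2 Dtau"
    by (rule eq; unfold all_5 all_6; simp add: s Dtau_def sscale_add del: oset.simps)
  show "fr 3 = vf_scale 1 Duxtau"
    by (rule eq; unfold all_5 all_6; simp add: s Duxtau_def sscale_add del: oset.simps)
  show "fr 4 = vf_scale 2 Dnu"
    by (rule eq; unfold all_5 all_6; simp add: s Dnu_def sscale_add del: oset.simps)
  show "fr 5 = vf_scale 1 Duxnu"
    by (rule eq; unfold all_5 all_6; simp add: s Duxnu_def sscale_add del: oset.simps)
qed

definition gk :: "nat \<Rightarrow> complex" where "gk j = (if j \<in> {0, 2, 4} then 2 else 1)"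

lemma fr_shc_gen: "j < 6 \<Longrightarrow> fr j = vf_scale (gk j) (shc_gen j)"
proof -
  assume "j < 6"
  then consider "j = 0" | "j = 1" | "j = 2" | "j = 3" | "j = 4" | "j = 5" by linarith
  then show ?thesis by cases (simp_all add: shc_gen_def gk_def fr_gen fr_gen(2)[unfolded One_nat_def])
qed

lemma gk_nonzero [simp]: "gk j \<noteq> 0" by (simp add: gk_def)

lemma vf_scale_scale [simp]: "vf_scale c (vf_scale d X) = vf_scale (c * d) X" "vf_scale 1 X = X"
  by (rule vf_eqI, simp)+

lemma shc_gen_fr: "j < 6 \<Longrightarrow> shc_gen j = vf_scale (1 / gk j) (fr j)"
  by (simp add: fr_shc_gen)

lemma vf_comb_sum: "vf_comb c e n = (\<Sum>j<n. vf_cmul (c j) (e j))"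
  by (induction n) simp_all

lemma vf_ok_shc_gen [simp]: "j < 6 \<Longrightarrow> vf_ok (shc_gen j)"
  by (simp add: shc_gen_fr)

lemma vf_ok_sum: "(\<And>a. a \<in> A \<Longrightarrow> vf_ok (X a)) \<Longrightarrow> vf_ok (\<Sum>a\<in>A. X a)"
  by (induction A rule: infinite_finite_induct) auto

lemma vf_cmul_scale: "vf_cmul f (vf_scale c X) = vf_cmul (sscale c f) X"
  by (rule vf_eqI) (simp add: smult_scale)

text \<open>The frame is global and its coefficients are extracted by polynomial forms, hence are
  holomorphic for a holomorphic field. Membership thus turns from an existence statement into five
  equations.\<close>

lemma inD_iff: "inD Y \<longleftrightarrow> vf_ok Y \<and> (\<forall>a<11. 6 \<le> a \<longrightarrow> fc a Y = 0)"
proof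
  assume "inD Y"
  then obtain c where c: "\<And>j. j < 6 \<Longrightarrow> sfun_ok (c j)" and Y: "Y = (\<Sum>j<6. vf_cmul (c j) (shc_gen j))"
    by (auto simp: inD_def vf_comb_sum)
  have "fc a Y = 0" if "a < 11" "6 \<le> a" for a
  proof -
    have "fc a Y = (\<Sum>j<6. smult (c j) (sscale (1 / gk j) (fc a (fr j))))"
      by (simp add: Y fc_sum fc_linear shc_gen_fr)
    also have "\<dots> = (\<Sum>j<(6::nat). 0)"
      using that by (intro sum.cong) (auto simp: fc_fr sconst_def sscale_def smult_def pointwise)
    finally show ?thesis by simp
  qed
  then show "vf_ok Y \<and> (\<forall>a<11. 6 \<le> a \<longrightarrow> fc a Y = 0)" using c by (auto simp: Y intro!: vf_ok_sum)
next
  assume Y: "vf_ok Y \<and> (\<forall>a<11. 6 \<le> a \<longrightarrow> fc a Y = 0)"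
  have z: "vf_cmul 0 X = 0" for X by (rule vf_eqI) simp
  have "Y = (\<Sum>a<11. vf_cmul (fc a Y) (fr a))" by (rule frame_decomp)
  also have "\<dots> = (\<Sum>a<6. vf_cmul (fc a Y) (fr a))"
    using Y by (intro sum.mono_neutral_right) (auto simp: z)
  also have "\<dots> = vf_comb (\<lambda>j. sscale (gk j) (fc j Y)) shc_gen 6"
    unfolding vf_comb_sum by (intro sum.cong refl) (simp only: lessThan_iff fr_shc_gen vf_cmul_scale)
  finally have e: "Y = vf_comb (\<lambda>j. sscale (gk j) (fc j Y)) shc_gen 6" .
  show "inD Y" unfolding inD_def
    by (rule exI[of _ "\<lambda>j. sscale (gk j) (fc j Y)"], intro conjI e) (use Y in simp)
qed

subsection \<open>Prolongation\<close>

declare One_nat_def [simp del] plc.simps [simp del]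

lemma vf_cmul_zero [simp]: "vf_cmul 0 X = 0"
  by (rule vf_eqI) simp

text \<open>The frame derivations, with the signs of the super Leibniz rule absorbed by the grading automorphism.\<close>

definition d :: "nat \<Rightarrow> sfun \<Rightarrow> sfun" where
  "d j f = vapp (fr j) (tw (fpar ! j) f)"

lemma tw_linear: "tw b (f + g) = tw b f + tw b g" "tw b (sscale c f) = sscale c (tw b f)" "tw b 0 = 0"
  by (simp_all add: tw_def alpha_add alpha_scale)

lemma d_ok [simp]: "sfun_ok f \<Longrightarrow> sfun_ok (d j f)"
  by (simp add: d_def)

lemma d_scale: "sfun_ok f \<Longrightarrow> d j (sscale c f) = sscale c (d j f)"
  by (simp add: d_def tw_linear vapp_scale)

lemma d_add: "sfun_ok f \<Longrightarrow> sfun_ok g \<Longrightarrow> d j (f + g) = d j f + d j g"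
  by (simp add: d_def tw_linear vapp_add)

lemma d_zero [simp]: "d j 0 = 0"
  by (simp add: d_def tw_linear)

lemma d_minus: "sfun_ok f \<Longrightarrow> d j (- f) = - d j f"
  using d_scale[of f j "-1"] by simp

lemma d_diff: "sfun_ok f \<Longrightarrow> sfun_ok g \<Longrightarrow> d j (f - g) = d j f - d j g"
  by (simp only: diff_conv_add_uminus d_add d_minus sfun_ok_minus)

lemmas d_simps = d_add d_scale d_minus d_diff d_zero

lemma foldr_d_ok [simp]: "sfun_ok f \<Longrightarrow> sfun_ok (foldr d w f)"
  by (induction w) simp_all

lemma foldr_d_scale: "sfun_ok f \<Longrightarrow> foldr d w (sscale c f) = sscale c (foldr d w f)"
  by (induction w) (simp_all add: d_scale)

lemma foldr_d_add: "sfun_ok f \<Longrightarrow> sfun_ok g \<Longrightarrow> foldr d w (f + g) = foldr d w f + foldr d w g"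
  by (induction w) (simp_all add: d_add)

text \<open>The twisted derivations obey the graded commutation relations of the frame, except that
  the bracket term changes sign when both are odd: moving \<open>alpha\<close> past an odd field
  costs a sign.\<close>

lemma rel:
  assumes "j < 6" "k < 6" "sfun_ok f"
  shows "d j (d k f) = sscale (sg (fpar ! j \<and> fpar ! k)) (d k (d j f)
    + vapp (vsem (plc FL (brl j k))) (tw (fpar ! j \<noteq> fpar ! k) f))"
proof -
  let ?b = "fpar ! j" and ?c = "fpar ! k"
  have h: "vf_hom ?b (fr j)" "vf_hom ?c (fr k)" using assms by (simp_all add: fr_hom)
  have c: "tw a (vapp X g) = sscale (sg (a \<and> b)) (vapp X (tw a g))" if "vf_hom b X" "sfun_ok g" for a b X g
    using vapp_alpha[OF that] by (cases a; cases b) simp_all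
  have t: "tw a (tw b f) = tw (b \<noteq> a) f" for a b by (cases a; cases b) simp_all
  define g where "g = tw (?b \<noteq> ?c) f"
  have g: "sfun_ok g" using assms by (simp add: g_def)
  have g': "tw (?c = (\<not> ?b)) f = g" by (cases ?b; cases ?c) (simp_all add: g_def)
  have "d j (d k f) = sscale (sg (?b \<and> ?c)) (vapp (fr j) (vapp (fr k) g))"
    using assms h(2) by (simp add: d_def c[OF h(2)] t g_def vapp_scale tw_tw)
  moreover have "d k (d j f) = sscale (sg (?b \<and> ?c)) (vapp (fr k) (vapp (fr j) g))"
    using assms by (simp add: d_def c[OF h(1)] t vapp_scale tw_tw conj_commute g' g)
  moreover have "vapp (vsem (plc FL (brl j k))) g =
      vapp (fr j) (vapp (fr k) g) - sscale (sg (?b \<and> ?c)) (vapp (fr k) (vapp (fr j) g))"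
    using vapp_hbr[OF vf_ok_vsem vf_ok_vsem h g] hbr_fr[of j k] assms by simp
  ultimately show ?thesis by (simp add: g_def)
qed

lemma fpar_nth: "fpar ! 0 = False" "fpar ! 1 = False" "fpar ! 2 = True" "fpar ! 3 = True" "fpar ! 4 = True" "fpar ! 5 = True"
  "fpar ! 6 = False" "fpar ! 7 = True" "fpar ! 8 = True" "fpar ! 9 = False" "fpar ! 10 = False"
  by (simp_all add: fpar_def One_nat_def)

lemmas rel_simps = fpar_nth brl_def brtab_def vsem_plc vapp_add_left vapp_scale_left sscale_add sscale_minus

lemma eq_neg_imp: "f = - f \<Longrightarrow> f = (0::sfun)"
  by (simp add: pointwise)

text \<open>There are nineteen graded brackets of the six generators, counting odd squares, and they
  span only the three fields \<open>fr 6\<close>, \<open>fr 7\<close>, \<open>fr 8\<close>.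
  Eliminating these leaves the sixteen quadratic relations that follow. \<open>TA\<close>,
  \<open>TB\<close>, \<open>T1\<close>, \<open>T2\<close> equate two expressions for the same
  transverse field; \<open>c\<close>, \<open>a\<close> and \<open>s\<close> stand for commuting
  pairs, anticommuting pairs and squares.\<close>

lemma rel_TA: "sfun_ok f \<Longrightarrow> d 0 (d 1 f) - d 1 (d 0 f) - d 2 (d 3 f) - d 3 (d 2 f) = 0"
  using rel[of 0 1 f] rel[of 2 3 f] by (simp add: rel_simps)
lemma rel_TB: "sfun_ok f \<Longrightarrow> d 0 (d 1 f) - d 1 (d 0 f) - d 4 (d 5 f) - d 5 (d 4 f) = 0"
  using rel[of 0 1 f] rel[of 4 5 f] by (simp add: rel_simps)
lemma rel_T1: "sfun_ok f \<Longrightarrow> d 0 (d 3 f) - d 3 (d 0 f) - d 1 (d 4 f) + d 4 (d 1 f) = 0"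
  using rel[of 0 3 f] rel[of 1 4 f] by (simp add: rel_simps)
lemma rel_T2: "sfun_ok f \<Longrightarrow> d 0 (d 5 f) - d 5 (d 0 f) + d 1 (d 2 f) - d 2 (d 1 f) = 0"
  using rel[of 0 5 f] rel[of 1 2 f] by (simp add: rel_simps)
lemma rel_c02: "sfun_ok f \<Longrightarrow> d 0 (d 2 f) - d 2 (d 0 f) = 0"
  using rel[of 0 2 f] by (simp add: rel_simps)
lemma rel_c04: "sfun_ok f \<Longrightarrow> d 0 (d 4 f) - d 4 (d 0 f) = 0"
  using rel[of 0 4 f] by (simp add: rel_simps)
lemma rel_c13: "sfun_ok f \<Longrightarrow> d 1 (d 3 f) - d 3 (d 1 f) = 0"
  using rel[of 1 3 f] by (simp add: rel_simps)
lemma rel_c15: "sfun_ok f \<Longrightarrow> d 1 (d 5 f) - d 5 (d 1 f) = 0"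
  using rel[of 1 5 f] by (simp add: rel_simps)
lemma rel_a24: "sfun_ok f \<Longrightarrow> d 2 (d 4 f) + d 4 (d 2 f) = 0"
  using rel[of 2 4 f] by (simp add: rel_simps)
lemma rel_a25: "sfun_ok f \<Longrightarrow> d 2 (d 5 f) + d 5 (d 2 f) = 0"
  using rel[of 2 5 f] by (simp add: rel_simps)
lemma rel_a34: "sfun_ok f \<Longrightarrow> d 3 (d 4 f) + d 4 (d 3 f) = 0"
  using rel[of 3 4 f] by (simp add: rel_simps)
lemma rel_a35: "sfun_ok f \<Longrightarrow> d 3 (d 5 f) + d 5 (d 3 f) = 0"
  using rel[of 3 5 f] by (simp add: rel_simps)
lemma rel_s2: "sfun_ok f \<Longrightarrow> d 2 (d 2 f) = 0"
  using rel[of 2 2 f] by (auto simp: rel_simps intro: eq_neg_imp)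
lemma rel_s3: "sfun_ok f \<Longrightarrow> d 3 (d 3 f) = 0"
  using rel[of 3 3 f] by (auto simp: rel_simps intro: eq_neg_imp)
lemma rel_s4: "sfun_ok f \<Longrightarrow> d 4 (d 4 f) = 0"
  using rel[of 4 4 f] by (auto simp: rel_simps intro: eq_neg_imp)
lemma rel_s5: "sfun_ok f \<Longrightarrow> d 5 (d 5 f) = 0"
  using rel[of 5 5 f] by (auto simp: rel_simps intro: eq_neg_imp)

lemma sscale_apply: "sscale c f S p = c * f S p"
  by (simp add: sscale_def)

lemmas lin_simps = plus_fun_apply zero_fun_apply uminus_apply minus_apply sscale_apply complex_eq_iff

text \<open>At a fixed index set and point, equations between superfunctions become equations
  between complex numbers. With \<open>lin_simps\<close> these split into real and imaginary parts
  and are settled by linear arithmetic.\<close>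

lemma lin1:
  fixes f g :: sfun
  assumes "r0 = 0" and "\<And>S p. r0 S p = 0 \<Longrightarrow> f S p = g S p"
  shows "f = g"
  using assms by (simp add: fun_eq_iff zero_fun_apply)

lemma lin2:
  fixes f g :: sfun
  assumes "r0 = 0" "r1 = 0" and "\<And>S p. r0 S p = 0 \<Longrightarrow> r1 S p = 0 \<Longrightarrow> f S p = g S p"
  shows "f = g"
  using assms by (simp add: fun_eq_iff zero_fun_apply)

lemma lin3:
  fixes f g :: sfun
  assumes "r0 = 0" "r1 = 0" "r2 = 0" and "\<And>S p. r0 S p = 0 \<Longrightarrow> r1 S p = 0 \<Longrightarrow> r2 S p = 0 \<Longrightarrow> f S p = g S p"
  shows "f = g"
  using assms by (simp add: fun_eq_iff zero_fun_apply)

lemma lin4: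
  fixes f g :: sfun
  assumes "r0 = 0" "r1 = 0" "r2 = 0" "r3 = 0" and "\<And>S p. r0 S p = 0 \<Longrightarrow> r1 S p = 0 \<Longrightarrow> r2 S p = 0 \<Longrightarrow> r3 S p = 0 \<Longrightarrow> f S p = g S p"
  shows "f = g"
  using assms by (simp add: fun_eq_iff zero_fun_apply)

lemma lin5:
  fixes f g :: sfun
  assumes "r0 = 0" "r1 = 0" "r2 = 0" "r3 = 0" "r4 = 0" and "\<And>S p. r0 S p = 0 \<Longrightarrow> r1 S p = 0 \<Longrightarrow> r2 S p = 0 \<Longrightarrow> r3 S p = 0 \<Longrightarrow> r4 S p = 0 \<Longrightarrow> f S p = g S p"
  shows "f = g"
  using assms by (simp add: fun_eq_iff zero_fun_apply)

subsection \<open>Symmetries are determined by finitely many jets\<close>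

text \<open>A symmetry need not be homogeneous, so its frame coefficients f are arbitrary functions;
  only the frame fields have a parity.\<close>

lemma brk_cmul_left:
  assumes "vf_hom a F" "vf_hom b E" "vf_ok F" "vf_ok E" "sfun_ok f"
  shows "brk (vf_cmul f F) E = vf_cmul f (brk F E) - vf_scale (sg (a \<and> b)) (vf_cmul (vapp E (tw b f)) F)"
proof (rule vf_eqI)
  fix A
  have s: "alpha (cmp F A) = sscale (sg (a \<noteq> podd A)) (cmp F A)"
    by (rule alpha_shom[OF vf_homD[OF assms(1)]])
  have t: "tv b A (smult f (cmp F A)) = sscale (sg (a \<and> b)) (smult (tw b f) (cmp F A))"
    by (cases b; cases a; cases "podd A") (simp_all add: tv_def alpha_smult s smult_scale smult_minus)
  show "cmp (brk (vf_cmul f F) E) A =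
      cmp (vf_cmul f (brk F E) - vf_scale (sg (a \<and> b)) (vf_cmul (vapp E (tw b f)) F)) A"
    using assms
    by (simp add: cmp_brk_hom[OF assms(2)] t vapp_scale vapp_smult[OF assms(2)] vapp_cmul_left brk_hom[OF assms(1,2)]
        cmp_hbr sscale_add smult_diff smult_scale algebra_simps)
qed

definition cf :: "nat \<Rightarrow> (int \<times> nat) list \<Rightarrow> int" where
  "cf c L = sum_list (map (\<lambda>(k, m). if m = c then k else 0) L)"

lemma fc_plc: "c < 11 \<Longrightarrow> \<forall>(k, m)\<in>set L. m < 11 \<Longrightarrow> fc c (vsem (plc FL L)) = sconst (of_int (cf c L))"
proof (induction L)
  case (Cons x L)
  then show ?case
    by (cases x) (auto simp: cf_def vsem_plc fc_linear fc_fr sconst_def sscale_def pointwise)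
qed (auto simp: cf_def vsem_plc fc_linear sconst_def pointwise)

lemma brl_less: "list_all (\<lambda>a. list_all (\<lambda>j. list_all (\<lambda>(k, m). m < 11) (brl a j)) [0..<6]) [0..<11]"
  by code_simp

lemma inD_fr: "j < 6 \<Longrightarrow> inD (fr j)"
  by (auto simp: inD_iff fc_fr sconst_def pointwise)

text \<open>The coefficient of \<open>fr c\<close> in the bracket of X with \<open>fr j\<close> must
  vanish when \<open>fr c\<close> is transverse. It consists of the structure constants applied to
  the coefficients of X and of one term in which \<open>fr j\<close> differentiates the coefficient
  \<open>fc c X\<close>.\<close>

lemma sym_eq:
  assumes X: "X \<in> shc_sym" and j: "j < 6" and c: "6 \<le> c" "c < 11"
  shows "d j (fc c X) = sscale (sg (fpar ! c \<and> fpar ! j)) (\<Sum>a<11. sscale (of_int (cf c (brl a j))) (fc a X))"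
proof -
  have ok: "vf_ok X" and "inD (brk X (fr j))" using X inD_fr[OF j] unfolding shc_sym_def by blast+
  then have "0 = fc c (brk X (fr j))" using c by (simp add: inD_iff)
  also have "brk X (fr j) = brk (\<Sum>a<11. vf_cmul (fc a X) (fr a)) (fr j)"
    by (subst frame_decomp[of X]) (rule refl)
  also have "\<dots> = (\<Sum>a<11. brk (vf_cmul (fc a X) (fr a)) (fr j))"
  proof -
    have "brk (\<Sum>a\<in>A. vf_cmul (fc a X) (fr a)) (fr j) = (\<Sum>a\<in>A. brk (vf_cmul (fc a X) (fr a)) (fr j))"
      if "finite A" for A
      using that
    proof (induction A rule: finite_induct)
      case empty then show ?case by (simp add: brk_def vf_part_hom[of False 0] vf_hom_iff)
    next
      case (insert a A)
      then show ?case using ok by (simp add: brk_add_left vf_ok_sum)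
    qed
    then show ?thesis by simp
  qed
  \<comment> \<open>Differentiating the coefficient of \<open>fr a\<close> yields a multiple of
    \<open>fr a\<close>, so by duality this term survives only for a = c.\<close>
  also have "fc c \<dots> = (\<Sum>a<11. sscale (of_int (cf c (brl a j))) (fc a X)
      - (if a = c then sscale (sg (fpar ! c \<and> fpar ! j)) (d j (fc c X)) else 0))"
    unfolding fc_sum
  proof (rule sum.cong[OF refl])
    fix a assume "a \<in> {..<11::nat}"
    then have a: "a < 11" by simp
    have h: "vf_hom (fpar ! a) (fr a)" "vf_hom (fpar ! j) (fr j)" using a j by (simp_all add: fr_hom)
    have "\<forall>(k, m)\<in>set (brl a j). m < 11" using brl_less a j by (auto simp: list_all_upt list_all_iff)
    then have "fc c (brk (fr a) (fr j)) = sconst (of_int (cf c (brl a j)))"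
      using a c j by (simp add: brk_hom[OF h] hbr_fr fc_plc)
    then show "fc c (brk (vf_cmul (fc a X) (fr a)) (fr j)) = sscale (of_int (cf c (brl a j))) (fc a X)
        - (if a = c then sscale (sg (fpar ! c \<and> fpar ! j)) (d j (fc c X)) else 0)"
      using ok a c by (simp add: brk_cmul_left[OF h] fc_linear smult_const fc_fr d_def)
  qed
  also have "\<dots> = (\<Sum>a<11. sscale (of_int (cf c (brl a j))) (fc a X)) - sscale (sg (fpar ! c \<and> fpar ! j)) (d j (fc c X))"
    using c by (simp add: sum_subtractf)
  finally have "sscale (sg (fpar ! c \<and> fpar ! j)) (d j (fc c X)) = (\<Sum>a<11. sscale (of_int (cf c (brl a j))) (fc a X))"
    by simp
  from arg_cong[OF this, of "sscale (sg (fpar ! c \<and> fpar ! j))"] show ?thesis by simp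
qed

lemma sum_lessThan_11: "(\<Sum>a<11. g a) = g 0 + g 1 + g 2 + g 3 + g 4 + g 5 + g 6 + g 7 + g 8 + g 9 + g 10"
  for g :: "nat \<Rightarrow> sfun"
  by (simp add: numeral_eq_Suc One_nat_def)

lemma sym_eqs:
  assumes "X \<in> shc_sym"
  shows "d 0 (fc 6 X) = fc 1 X" "d 1 (fc 6 X) = - fc 0 X" "d 2 (fc 6 X) = fc 3 X" "d 3 (fc 6 X) = fc 2 X"
    "d 4 (fc 6 X) = fc 5 X" "d 5 (fc 6 X) = fc 4 X" "d 0 (fc 7 X) = fc 3 X" "d 1 (fc 7 X) = fc 4 X"
    "d 2 (fc 7 X) = 0" "d 3 (fc 7 X) = fc 0 X" "d 4 (fc 7 X) = fc 1 X" "d 5 (fc 7 X) = 0"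
    "d 0 (fc 8 X) = fc 5 X" "d 1 (fc 8 X) = - fc 2 X" "d 2 (fc 8 X) = - fc 1 X" "d 3 (fc 8 X) = 0"
    "d 4 (fc 8 X) = 0" "d 5 (fc 8 X) = fc 0 X" "d 0 (fc 9 X) = fc 6 X" "d 1 (fc 9 X) = 0"
    "d 2 (fc 9 X) = fc 7 X" "d 3 (fc 9 X) = 0" "d 4 (fc 9 X) = fc 8 X" "d 5 (fc 9 X) = 0" "d 0 (fc 10 X) = 0"
    "d 1 (fc 10 X) = - fc 6 X" "d 2 (fc 10 X) = 0" "d 3 (fc 10 X) = fc 8 X" "d 4 (fc 10 X) = 0"
    "d 5 (fc 10 X) = - fc 7 X"
  by (simp_all add: sym_eq[OF assms] sum_lessThan_11 fpar_nth cf_def brl_def brtab_def)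

section \<open>Functions annihilated by the generators\<close>

lemma vapp_expand: "vapp (vsem (PV a0 a1 a2 a3 a4 b0 b1 b2 b3 b4 b5)) f =
   smult (psem a0) (pdx 0 f) + smult (psem a1) (pdx 1 f) + smult (psem a2) (pdx 2 f) + smult (psem a3) (pdx 3 f)
   + smult (psem a4) (pdx 4 f) + smult (psem b0) (pdth 0 f) + smult (psem b1) (pdth 1 f) + smult (psem b2) (pdth 2 f)
   + smult (psem b3) (pdth 3 f) + smult (psem b4) (pdth 4 f) + smult (psem b5) (pdth 5 f)"
  unfolding vapp_sum_der UNIV_Plus_UNIV[symmetric]
  by (subst sum.Plus) (simp_all add: sum_5 sum_6 add.assoc)

text \<open>Every coefficient with nonempty index set is, up to sign, a coefficient of an odd
  derivative and so vanishes. The remaining one does not change when the even coordinates are set to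
  zero one after another.\<close>

lemma der_zero_const:
  assumes "sfun_ok f" "\<forall>i. pdx i f = 0" "\<forall>k. pdth k f = 0"
  shows "f = sconst (f {} 0)"
proof -
  have o: "f S p = 0" if ne: "S \<noteq> {}" for S p
  proof -
    obtain k where k: "k \<in> S" using ne by blast
    have "pdth k f (S - {k}) p = 0" using assms(3) by (simp add: zero_fun_apply)
    then show ?thesis using k by (simp add: pdth_sign inv_sign_singleton insert_absorb)
  qed
  have g: "hol5 (f {})" using assms(1) by (simp add: sfun_ok_def)
  have "f {} (cupd p i 0) = f {} p" for p i
  proof -
    have "((\<lambda>z. f {} (cupd p i z)) has_field_derivative 0) (at w)" for w
      using hol5_has_pdf[OF g, of p i w] assms(2) by (simp add: pdx_pdf fun_eq_iff zero_fun_apply)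
    then obtain c where "\<And>z. f {} (cupd p i z) = c"
      using has_field_derivative_zero_constant[of UNIV "\<lambda>z. f {} (cupd p i z)"] by auto
    then show ?thesis by (metis cupd_self)
  qed
  then have "f {} p = f {} (cupd (cupd (cupd (cupd (cupd p 0 0) 1 0) 2 0) 3 0) 4 0)" for p by simp
  moreover have "cupd (cupd (cupd (cupd (cupd p 0 0) 1 0) 2 0) 3 0) 4 0 = 0" for p
    unfolding vec_eq_iff all_5 by (simp add: cupd_nth)
  ultimately have "f {} p = f {} 0" for p by metis
  then show ?thesis using o by (auto simp: sconst_def fun_eq_iff)
qed

text \<open>The generators are bracket generating: a function killed by two fields is killed by
  their bracket, hence by the whole frame, and so by all coordinate derivatives. Such a function is
  constant, and its value at the origin decides.\<close>

lemma const_zero: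
  assumes ok: "sfun_ok f" and v: "f {} 0 = 0"
    and d: "d 0 f = 0" "d 1 f = 0" "d 2 f = 0" "d 3 f = 0" "d 4 f = 0" "d 5 f = 0"
  shows "f = 0"
proof -
  have tw0: "tw b g = 0 \<Longrightarrow> g = 0" for b g by (metis tw_simps(3) tw_linear(3))
  have V: "vapp (fr j) f = 0" if j: "j < 6" for j
  proof -
    have "d j f = 0" using j d by (auto simp: less_Suc_eq numeral_eq_Suc One_nat_def)
    moreover have "d j f = sscale (sg (fpar ! j)) (tw (fpar ! j) (vapp (fr j) f))"
      using vapp_alpha[OF fr_hom ok, of j] j by (cases "fpar ! j") (simp_all add: d_def)
    ultimately have "tw (fpar ! j) (vapp (fr j) f) = 0"
      by (metis sscale_simps(1,3,4) sg_simps(3))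
    then show ?thesis by (rule tw0)
  qed
  have B: "vapp (vsem (plc FL (brl a j))) f = 0" if "vapp (fr a) f = 0" "j < 6" "a < 11" for a j
    using vapp_hbr[OF vf_ok_vsem vf_ok_vsem fr_hom fr_hom ok, of a j] that V by (simp add: hbr_fr)
  have 6: "vapp (fr 6) f = 0" using B[of 0 1] V by (simp add: rel_simps)
  have 7: "vapp (fr 7) f = 0" using B[of 0 3] V by (simp add: rel_simps)
  have 8: "vapp (fr 8) f = 0" using B[of 0 5] V by (simp add: rel_simps)
  have 9: "vapp (fr 9) f = 0" using B[of 6 0] 6 by (simp add: rel_simps)
  have 10: "vapp (fr 10) f = 0" using B[of 6 1] 6 by (simp add: rel_simps)
  have n: "sscale k f = 0 \<Longrightarrow> k \<noteq> 0 \<Longrightarrow> f = 0" for k f by (auto simp: sscale_def pointwise)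
  note w = FL_def One_nat_def vapp_expand psem_const smult_const
  \<comment> \<open>The frame is solved for the coordinate derivatives in triangular order, starting
    with the frame fields that are constant multiples of such derivatives once the known ones are
    dropped.\<close>
  have 1: "pdx 1 f = 0" by (rule n[of 4]) (use 9 in \<open>simp_all add: w del: mo.simps psem.simps(2) vsem.simps\<close>)
  have 4: "pdx 4 f = 0" by (rule n[of 2]) (use 10 in \<open>simp_all add: w del: mo.simps psem.simps(2) vsem.simps\<close>)
  have 3: "pdx 3 f = 0" by (rule n[of 1]) (use V[of 1] in \<open>simp_all add: w del: mo.simps psem.simps(2) vsem.simps\<close>)
  have t5: "pdth 5 f = 0" by (rule n[of 1]) (use V[of 3] in \<open>simp_all add: w del: mo.simps psem.simps(2) vsem.simps\<close>)
  have t4: "pdth 4 f = 0" by (rule n[of 1]) (use V[of 5] in \<open>simp_all add: w del: mo.simps psem.simps(2) vsem.simps\<close>)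
  note e = 1 4 3 t5 t4
  have 2: "pdx 2 f = 0" by (rule n[of 2]) (use 6 in \<open>simp_all add: w e del: mo.simps psem.simps(2) vsem.simps\<close>)
  have t3: "pdth 3 f = 0" by (rule n[of 2]) (use 7 in \<open>simp_all add: w e del: mo.simps psem.simps(2) vsem.simps\<close>)
  have t2: "pdth 2 f = 0" by (rule n[of 2]) (use 8 in \<open>simp_all add: w e del: mo.simps psem.simps(2) vsem.simps\<close>)
  have 0: "pdx 0 f = 0" by (rule n[of 2]) (use V[of 0] in \<open>simp_all add: w e 2 t3 t2 del: mo.simps psem.simps(2) vsem.simps\<close>)
  have t1: "pdth 1 f = 0" by (rule n[of 2]) (use V[of 2] in \<open>simp_all add: w e 2 t3 t2 del: mo.simps psem.simps(2) vsem.simps\<close>)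
  have t0: "pdth 0 f = 0" by (rule n[of 2]) (use V[of 4] in \<open>simp_all add: w e 2 t3 t2 del: mo.simps psem.simps(2) vsem.simps\<close>)
  have "f = sconst (f {} 0)"
    by (rule der_zero_const[OF ok]) (unfold all_5 all_6, simp_all add: 0 e 2 t0 t1 t2 t3)
  then show ?thesis using v by (auto simp: sconst_def pointwise)
qed

text \<open>An entry is a word of derivations, the head acting last, together with a frame
  coefficient. The empty words give 2, 3 and 6 entries for the three steps of the flag, and the
  words of length one to four give 9, 6, 3 and 2: the dimensions of the graded pieces. The first 17
  entries belong to the even symmetries, the other 14 to the odd ones.\<close>

definition wd :: "(nat list \<times> nat) list" where
  "wd = [([], 9), ([], 10), ([], 6), ([], 0), ([], 1), ([1], 0), ([5], 3), ([0], 0), ([1], 1), ([3], 3), ([3], 5),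
    ([0], 1), ([1, 0], 0), ([0, 3], 3), ([1, 0, 3], 3), ([1, 1, 0, 3], 3), ([0, 1, 0, 3], 3), ([], 7),
    ([], 8), ([], 4), ([], 2), ([], 3), ([], 5), ([1], 3), ([1], 5), ([1, 1], 3), ([1, 1], 5), ([0, 1], 3),
    ([0, 1], 5), ([1, 0, 1], 3), ([1, 0, 1], 5)]"

text \<open>The unnormalised contraction \<open>con\<close> replaces \<open>fc\<close>, so that the
  jets of a field with integer coefficients are integers.\<close>

definition jet :: "nat \<Rightarrow> vf \<Rightarrow> complex" where
  "jet m X = foldr d (fst (wd ! m)) (con (WL ! snd (wd ! m)) X) {} 0"

lemma jet_add: "vf_ok X \<Longrightarrow> vf_ok Y \<Longrightarrow> jet m (X + Y) = jet m X + jet m Y"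
  by (simp add: jet_def con_linear foldr_d_add plus_fun_apply)

lemma jet_scale: "vf_ok X \<Longrightarrow> jet m (vf_scale c X) = c * jet m X"
  by (simp add: jet_def con_linear foldr_d_scale sscale_apply)

text \<open>At each level the relations express all derivatives of the current unknowns through a
  few of them, which become the unknowns of the next level; after four levels nothing new appears.
  Since the jets are the values of all these unknowns at the origin, \<open>const_zero\<close> then
  eliminates the levels from the top down.\<close>

lemma sym_eq_0:
  assumes "X \<in> shc_sym" "\<And>m. m < 31 \<Longrightarrow> jet m X = 0"
  shows "X = 0"
proof -
  have X: "vf_ok X" using assms(1) by (simp add: shc_sym_def)
  have z: "foldr d (fst (wd ! m)) (fc (snd (wd ! m)) X) {} 0 = 0" if "m < 31" for m
    using assms(2)[OF that] by (simp add: jet_def fc_def foldr_d_scale X sscale_apply)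
  define p q w f0 f1 f2 f3 f4 f5
    where X_defs: "p = fc 6 X" "q = fc 7 X" "w = fc 8 X" "f0 = fc 0 X" "f1 = fc 1 X" "f2 = fc 2 X" "f3 = fc 3 X"
      "f4 = fc 4 X" "f5 = fc 5 X"
  \<comment> \<open>The derivatives left free by the relations: 9 of 36 here, then 6 of 54, 3 of 36
    and 2 of 18 in the three definitions below. The facts \<open>L0\<close> to \<open>L3\<close>
    express the others through them.\<close>
  define a0 a1 a2 a3 a4 a5 a6 a7 a8
    where D0: "a0 = d 0 f0" "a1 = d 1 f0" "a2 = d 0 f1" "a3 = d 1 f1" "a4 = d 1 f3" "a5 = d 3 f3" "a6 = d 5 f3"
      "a7 = d 1 f5" "a8 = d 3 f5"
  define b0 b1 b2 b3 b4 b5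
    where D1: "b0 = d 1 a0" "b1 = d 0 a4" "b2 = d 1 a4" "b3 = d 0 a5" "b4 = d 0 a7" "b5 = d 1 a7"
  define c0 c1 c2
    where D2: "c0 = d 1 b1" "c1 = d 1 b3" "c2 = d 1 b4"
  define e0 e1
    where D3: "e0 = d 0 c1" "e1 = d 1 c1"
  note D = D0 D1 D2 D3
  have ok: "sfun_ok p" "sfun_ok q" "sfun_ok w" "sfun_ok f0" "sfun_ok f1" "sfun_ok f2" "sfun_ok f3" "sfun_ok f4"
    "sfun_ok f5" "sfun_ok a0" "sfun_ok a1" "sfun_ok a2" "sfun_ok a3" "sfun_ok a4" "sfun_ok a5"
    "sfun_ok a6" "sfun_ok a7" "sfun_ok a8" "sfun_ok b0" "sfun_ok b1" "sfun_ok b2" "sfun_ok b3"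
    "sfun_ok b4" "sfun_ok b5" "sfun_ok c0" "sfun_ok c1" "sfun_ok c2" "sfun_ok e0" "sfun_ok e1"
    unfolding D X_defs by (simp_all add: X)
  have E: "d 0 p = f1" "d 1 p = - f0" "d 2 p = f3" "d 3 p = f2" "d 4 p = f5" "d 5 p = f4" "d 0 q = f3"
    "d 1 q = f4" "d 2 q = 0" "d 3 q = f0" "d 4 q = f1" "d 5 q = 0" "d 0 w = f5" "d 1 w = - f2"
    "d 2 w = - f1" "d 3 w = 0" "d 4 w = 0" "d 5 w = f0"
    using sym_eqs[OF assms(1)] by (simp_all add: X_defs)
  note s = ok D[symmetric] E d_simps lin_simps
  \<comment> \<open>Each relation is instantiated at every unknown in the order of
    \<open>ok\<close>, so the number after a relation name below selects the function: 1 to 3 for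
    \<open>p\<close>, \<open>q\<close>, \<open>w\<close>, 4 to 9 for the \<open>f\<close>, 10 to 18
    for the \<open>a\<close>, 19 to 24 for the \<open>b\<close>, 25 to 27 for the
    \<open>c\<close>.\<close>
  note TA = ok[THEN rel_TA] and TB = ok[THEN rel_TB] and T1 = ok[THEN rel_T1] and T2 = ok[THEN rel_T2]
    and c02 = ok[THEN rel_c02] and c04 = ok[THEN rel_c04] and c13 = ok[THEN rel_c13]
    and c15 = ok[THEN rel_c15] and a24 = ok[THEN rel_a24] and a25 = ok[THEN rel_a25]
    and a34 = ok[THEN rel_a34] and a35 = ok[THEN rel_a35] and s2 = ok[THEN rel_s2] and s3 = ok[THEN rel_s3]
    and s4 = ok[THEN rel_s4] and s5 = ok[THEN rel_s5]
  \<comment> \<open>Each equation is a linear combination of the instances cited for it, after the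
    derivatives already known have been inserted.\<close>
  have L0: "d 2 f0 = sscale (-2) a4" "d 3 f0 = 0" "d 4 f0 = sscale (-2) a7" "d 5 f0 = 0" "d 2 f1 = 0"
    "d 3 f1 = sscale 2 a7" "d 4 f1 = 0" "d 5 f1 = sscale (-2) a4" "d 0 f2 = a7" "d 1 f2 = 0"
    "d 2 f2 = - a0 - a3 - a5" "d 3 f2 = 0" "d 4 f2 = - a8" "d 5 f2 = - a1" "d 0 f3 = 0" "d 2 f3 = 0"
    "d 4 f3 = a2" "d 0 f4 = - a4" "d 1 f4 = 0" "d 2 f4 = - a6" "d 3 f4 = a1" "d 4 f4 = - a0 + a3 + a5"
    "d 5 f4 = 0" "d 0 f5 = 0" "d 2 f5 = - a2" "d 4 f5 = 0" "d 5 f5 = - a5 - sscale 2 a3"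
    apply (rule lin2[OF T2(1) TB(2)], simp add: s)
    apply (rule lin1[OF s3(2)], simp add: s)
    apply (rule lin2[OF TA(3) T1(1)], simp add: s)
    apply (rule lin1[OF a35(2)], simp add: s)
    apply (rule lin1[OF a24(2)], simp add: s)
    apply (rule lin3[OF TA(3) a34(2) T1(1)], simp add: s)
    apply (rule lin1[OF s4(2)], simp add: s)
    apply (rule lin3[OF TB(2) TA(2) T2(1)], simp add: s)
    apply (rule lin2[OF a34(2) T1(1)], simp add: s)
    apply (rule lin2[OF s3(2) c13(1)], simp add: s)
    apply (rule lin1[OF TA(1)], simp add: s)
    apply (rule lin1[OF s3(1)], simp add: s)
    apply (rule lin1[OF a34(1)], simp add: s)
    apply (rule lin2[OF a35(1) c13(2)], simp add: s)
    apply (rule lin2[OF a24(2) c02(1)], simp add: s)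
    apply (rule lin1[OF s2(1)], simp add: s)
    apply (rule lin1[OF c04(2)], simp add: s)
    apply (rule lin3[OF TA(2) T2(1) TB(2)], simp add: s)
    apply (rule lin2[OF a35(2) c15(1)], simp add: s)
    apply (rule lin1[OF a25(1)], simp add: s)
    apply (rule lin1[OF c13(2)], simp add: s)
    apply (rule lin1[OF T1(2)], simp add: s)
    apply (rule lin1[OF s5(1)], simp add: s)
    apply (rule lin2[OF s4(2) c04(1)], simp add: s)
    apply (rule lin2[OF c04(2) a24(1)], simp add: s)
    apply (rule lin1[OF s4(1)], simp add: s)
    apply (rule lin2[OF T1(2) TB(1)], simp add: s)
    done
  note s = s L0
  have L1: "d 0 a0 = sscale 2 b3" "d 2 a0 = sscale (-2) b1" "d 3 a0 = - b5" "d 4 a0 = sscale (-2) b4"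
    "d 5 a0 = b2" "d 0 a1 = sscale (-3) b0" "d 1 a1 = 0" "d 2 a1 = sscale (-3) b2" "d 3 a1 = 0"
    "d 4 a1 = sscale (-3) b5" "d 5 a1 = 0" "d 0 a2 = 0" "d 1 a2 = sscale 3 b3" "d 2 a2 = 0"
    "d 3 a2 = sscale 3 b4" "d 4 a2 = 0" "d 5 a2 = sscale (-3) b1" "d 0 a3 = - b3"
    "d 1 a3 = sscale (-2) b0" "d 2 a3 = b1" "d 3 a3 = sscale 2 b5" "d 4 a3 = b4"
    "d 5 a3 = sscale (-2) b2" "d 2 a4 = 0" "d 3 a4 = sscale 2 b0" "d 4 a4 = sscale 2 b3" "d 5 a4 = 0"
    "d 1 a5 = sscale 2 b0" "d 2 a5 = b1" "d 3 a5 = 0" "d 4 a5 = sscale (-3) b4" "d 5 a5 = sscale 4 b2"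
    "d 0 a6 = 0" "d 1 a6 = 0" "d 2 a6 = 0" "d 3 a6 = sscale (-4) b2" "d 4 a6 = sscale 4 b1" "d 5 a6 = 0"
    "d 2 a7 = sscale (-2) b3" "d 3 a7 = 0" "d 4 a7 = 0" "d 5 a7 = sscale 2 b0" "d 0 a8 = 0" "d 1 a8 = 0"
    "d 2 a8 = sscale 4 b4" "d 3 a8 = 0" "d 4 a8 = 0" "d 5 a8 = sscale 4 b5"
    apply (rule lin4[OF T1(7) a24(4) TA(5) c04(8)], simp add: s)
    apply (rule lin1[OF c02(4)], simp add: s)
    apply (rule lin3[OF s3(7) TA(6) c13(5)], simp add: s)
    apply (rule lin1[OF c04(4)], simp add: s)
    apply (rule lin4[OF TA(8) a35(7) a25(6) c15(5)], simp add: s)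
    apply (rule lin4[OF TA(4) T1(8) T2(6) TB(4)], simp add: s)
    apply (rule lin1[OF c15(6)], simp add: s)
    apply (rule lin5[OF T2(4) TA(8) a35(7) a25(6) c15(5)], simp add: s)
    apply (rule lin1[OF c13(4)], simp add: s)
    apply (rule lin4[OF T1(4) s3(7) TA(6) c13(5)], simp add: s)
    apply (rule lin1[OF c15(4)], simp add: s)
    apply (rule lin1[OF c04(7)], simp add: s)
    apply (rule lin5[OF c04(8) T1(7) a24(4) TA(5) c02(6)], simp add: s)
    apply (rule lin1[OF c02(5)], simp add: s)
    apply (rule lin5[OF TA(9) a34(7) a24(6) c04(4) T1(5)], simp add: s)
    apply (rule lin1[OF c04(5)], simp add: s)
    apply (rule lin4[OF TA(7) s2(6) c02(4) T2(5)], simp add: s)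
    apply (rule lin3[OF a24(4) c04(8) c02(6)], simp add: s)
    apply (rule lin4[OF c13(7) T2(6) TA(4) TB(4)], simp add: s)
    apply (rule lin3[OF TA(7) s2(6) c02(4)], simp add: s)
    apply (rule lin1[OF c13(5)], simp add: s)
    apply (rule lin4[OF TA(9) a34(7) a24(6) c04(4)], simp add: s)
    apply (rule lin1[OF c15(5)], simp add: s)
    apply (rule lin1[OF s2(4)], simp add: s)
    apply (rule lin4[OF T1(8) TA(4) T2(6) TB(4)], simp add: s)
    apply (rule lin5[OF T1(7) c04(8) a24(4) TA(5) c02(6)], simp add: s)
    apply (rule lin1[OF a25(4)], simp add: s)
    apply (rule lin5[OF T1(8) c13(7) TA(4) T2(6) TB(4)], simp add: s)
    apply (rule lin1[OF TA(7)], simp add: s)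
    apply (rule lin1[OF s3(7)], simp add: s)
    apply (rule lin5[OF a34(7) TA(9) a24(6) c04(4) T1(5)], simp add: s)
    apply (rule lin3[OF a25(6) T2(4) c15(5)], simp add: s)
    apply (rule lin2[OF T2(7) s2(4)], simp add: s)
    apply (rule lin2[OF c15(7) a25(4)], simp add: s)
    apply (rule lin1[OF a25(7)], simp add: s)
    apply (rule lin4[OF a35(7) a25(6) T2(4) c15(5)], simp add: s)
    apply (rule lin5[OF TB(7) TA(7) s2(6) c02(4) T2(5)], simp add: s)
    apply (rule lin1[OF s5(7)], simp add: s)
    apply (rule lin5[OF T1(7) a24(4) c04(8) TA(5) c02(6)], simp add: s)
    apply (rule lin1[OF a34(4)], simp add: s)
    apply (rule lin1[OF s4(4)], simp add: s)
    apply (rule lin4[OF TB(4) TA(4) T1(8) T2(6)], simp add: s)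
    apply (rule lin2[OF c04(6) s4(4)], simp add: s)
    apply (rule lin2[OF T1(6) a34(4)], simp add: s)
    apply (rule lin4[OF a34(7) a24(6) c04(4) T1(5)], simp add: s)
    apply (rule lin1[OF a34(6)], simp add: s)
    apply (rule lin1[OF s4(6)], simp add: s)
    apply (rule lin5[OF TB(6) T1(4) s3(7) TA(6) c13(5)], simp add: s)
    done
  note s = s L1
  have L2: "d 0 b0 = c1" "d 1 b0 = 0" "d 2 b0 = - c0" "d 3 b0 = 0" "d 4 b0 = - c2" "d 5 b0 = 0" "d 0 b1 = 0"
    "d 2 b1 = 0" "d 3 b1 = c1" "d 4 b1 = 0" "d 5 b1 = 0" "d 0 b2 = - c0" "d 1 b2 = 0" "d 2 b2 = 0"
    "d 3 b2 = 0" "d 4 b2 = c1" "d 5 b2 = 0" "d 0 b3 = 0" "d 2 b3 = 0" "d 3 b3 = c2" "d 4 b3 = 0"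
    "d 5 b3 = - c0" "d 0 b4 = 0" "d 2 b4 = 0" "d 3 b4 = 0" "d 4 b4 = 0" "d 5 b4 = c1" "d 0 b5 = - c2"
    "d 1 b5 = 0" "d 2 b5 = - c1" "d 3 b5 = 0" "d 4 b5 = 0" "d 5 b5 = 0"
    apply (rule lin4[OF T1(14) TA(13) TA(10) a24(11)], simp add: s)
    apply (rule lin2[OF c13(14) TA(11)], simp add: s)
    apply (rule lin2[OF c02(11) TA(14)], simp add: s)
    apply (rule lin1[OF s3(14)], simp add: s)
    apply (rule lin3[OF c04(11) a34(14) T1(10)], simp add: s)
    apply (rule lin1[OF a35(14)], simp add: s)
    apply (rule lin2[OF a24(14) c02(10)], simp add: s)
    apply (rule lin1[OF s2(10)], simp add: s)
    apply (rule lin2[OF TA(13) TA(10)], simp add: s)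
    apply (rule lin3[OF a24(10) TA(12) c04(14)], simp add: s)
    apply (rule lin2[OF s2(11) a25(10)], simp add: s)
    apply (rule lin2[OF TA(14) c02(11)], simp add: s)
    apply (rule lin2[OF a35(14) c15(10)], simp add: s)
    apply (rule lin1[OF s2(11)], simp add: s)
    apply (rule lin2[OF TA(11) c13(14)], simp add: s)
    apply (rule lin4[OF a24(11) TA(10) TA(13) T1(14)], simp add: s)
    apply (rule lin1[OF s5(10)], simp add: s)
    apply (rule lin3[OF c04(14) a24(10) TA(12)], simp add: s)
    apply (rule lin1[OF a24(14)], simp add: s)
    apply (rule lin2[OF c04(11) T1(10)], simp add: s)
    apply (rule lin1[OF s4(14)], simp add: s)
    apply (rule lin2[OF c02(11) T2(10)], simp add: s)
    apply (rule lin2[OF s4(14) c04(10)], simp add: s)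
    apply (rule lin3[OF TA(12) c04(14) a24(10)], simp add: s)
    apply (rule lin2[OF s4(11) a34(10)], simp add: s)
    apply (rule lin1[OF s4(10)], simp add: s)
    apply (rule lin4[OF a24(11) TA(10) TB(10) TA(13)], simp add: s)
    apply (rule lin3[OF a34(14) c04(11) T1(10)], simp add: s)
    apply (rule lin2[OF s3(14) c13(10)], simp add: s)
    apply (rule lin4[OF TA(10) TA(13) T1(14) a24(11)], simp add: s)
    apply (rule lin1[OF s3(10)], simp add: s)
    apply (rule lin1[OF s4(11)], simp add: s)
    apply (rule lin3[OF a35(10) TA(11) c13(14)], simp add: s)
    done
  note s = s L2
  have L3: "d 0 c0 = 0" "d 1 c0 = 0" "d 2 c0 = 0" "d 3 c0 = e1" "d 4 c0 = - e0" "d 5 c0 = 0" "d 2 c1 = 0"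
    "d 3 c1 = 0" "d 4 c1 = 0" "d 5 c1 = 0" "d 0 c2 = 0" "d 1 c2 = 0" "d 2 c2 = e0" "d 3 c2 = 0"
    "d 4 c2 = 0" "d 5 c2 = e1"
    apply (rule lin2[OF TA(20) c02(19)], simp add: s)
    apply (rule lin2[OF a35(20) T2(19)], simp add: s)
    apply (rule lin1[OF s2(19)], simp add: s)
    apply (rule lin1[OF TA(19)], simp add: s)
    apply (rule lin1[OF T1(20)], simp add: s)
    apply (rule lin1[OF a25(19)], simp add: s)
    apply (rule lin2[OF c02(19) TA(20)], simp add: s)
    apply (rule lin1[OF s3(20)], simp add: s)
    apply (rule lin1[OF a34(20)], simp add: s)
    apply (rule lin1[OF a35(20)], simp add: s)
    apply (rule lin2[OF a34(20) c04(19)], simp add: s)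
    apply (rule lin2[OF s3(20) T1(19)], simp add: s)
    apply (rule lin2[OF T1(20) a24(19)], simp add: s)
    apply (rule lin1[OF a34(19)], simp add: s)
    apply (rule lin1[OF s4(19)], simp add: s)
    apply (rule lin1[OF TB(19)], simp add: s)
    done
  note s = s L3
  \<comment> \<open>The prolongation stops here: no free derivative remains and all derivatives of
    the top unknowns vanish.\<close>
  have L4: "d 0 e0 = 0" "d 1 e0 = 0" "d 2 e0 = 0" "d 3 e0 = 0" "d 4 e0 = 0" "d 5 e0 = 0" "d 0 e1 = 0"
    "d 1 e1 = 0" "d 2 e1 = 0" "d 3 e1 = 0" "d 4 e1 = 0" "d 5 e1 = 0"
    apply (rule lin1[OF c04(25)], simp add: s)
    apply (rule lin2[OF TA(26) T1(25)], simp add: s)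
    apply (rule lin1[OF a24(25)], simp add: s)
    apply (rule lin1[OF TA(27)], simp add: s)
    apply (rule lin1[OF s4(25)], simp add: s)
    apply (rule lin1[OF TB(25)], simp add: s)
    apply (rule lin2[OF T1(25) TA(26)], simp add: s)
    apply (rule lin1[OF c13(25)], simp add: s)
    apply (rule lin1[OF TA(25)], simp add: s)
    apply (rule lin1[OF s3(25)], simp add: s)
    apply (rule lin2[OF a34(25) TA(27)], simp add: s)
    apply (rule lin1[OF a35(25)], simp add: s)
    done
  note s = s L4
  note zs = z[of 7] z[of 5] z[of 11] z[of 8] z[of 23] z[of 9] z[of 6] z[of 24] z[of 10] z[of 12] z[of 27]
    z[of 25] z[of 13] z[of 28] z[of 26] z[of 29] z[of 14] z[of 30] z[of 16] z[of 15] z[of 3] z[of 4]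
    z[of 20] z[of 21] z[of 19] z[of 22] z[of 2] z[of 17] z[of 18] z[of 0] z[of 1]
  note zs = zs[simplified wd_def D X_defs One_nat_def, simplified]
  have v: "a0 {} 0 = 0" "a1 {} 0 = 0" "a2 {} 0 = 0" "a3 {} 0 = 0" "a4 {} 0 = 0" "a5 {} 0 = 0" "a6 {} 0 = 0"
    "a7 {} 0 = 0" "a8 {} 0 = 0" "b0 {} 0 = 0" "b1 {} 0 = 0" "b2 {} 0 = 0" "b3 {} 0 = 0" "b4 {} 0 = 0"
    "b5 {} 0 = 0" "c0 {} 0 = 0" "c1 {} 0 = 0" "c2 {} 0 = 0" "e0 {} 0 = 0" "e1 {} 0 = 0" "f0 {} 0 = 0"
    "f1 {} 0 = 0" "f2 {} 0 = 0" "f3 {} 0 = 0" "f4 {} 0 = 0" "f5 {} 0 = 0" "p {} 0 = 0" "q {} 0 = 0"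
    "w {} 0 = 0" "fc 9 X {} 0 = 0" "fc 10 X {} 0 = 0"
    by (simp_all add: zs D X_defs One_nat_def)
  \<comment> \<open>The descent: once a level vanishes, the unknowns one level below have zero
    derivatives along the generators and vanish at the origin, so they vanish too.\<close>
  have Z4: "e0 = 0" "e1 = 0"
    by (rule const_zero; simp add: ok v L4 D[symmetric])+
  have Z3: "c0 = 0" "c1 = 0" "c2 = 0"
    by (rule const_zero; simp add: ok v L3 D[symmetric] Z4)+
  have Z2: "b0 = 0" "b1 = 0" "b2 = 0" "b3 = 0" "b4 = 0" "b5 = 0"
    by (rule const_zero; simp add: ok v L2 D[symmetric] Z3)+
  have Z1: "a0 = 0" "a1 = 0" "a2 = 0" "a3 = 0" "a4 = 0" "a5 = 0" "a6 = 0" "a7 = 0" "a8 = 0"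
    by (rule const_zero; simp add: ok v L1 D[symmetric] Z2)+
  have Z0: "f0 = 0" "f1 = 0" "f2 = 0" "f3 = 0" "f4 = 0" "f5 = 0"
    by (rule const_zero; simp add: ok v L0 D[symmetric] Z1)+
  have Z: "p = 0" "q = 0" "w = 0"
    by (rule const_zero; simp add: ok v E Z0)+
  have Z9: "fc 9 X = 0" "fc 10 X = 0"
    by (rule const_zero; simp add: X v sym_eqs[OF assms(1)] Z flip: X_defs)+
  have "fc a X = 0" if "a < 11" for a
  proof -
    from that have "a = 0 \<or> a = 1 \<or> a = 2 \<or> a = 3 \<or> a = 4 \<or> a = 5 \<or> a = 6 \<or> a = 7 \<or> a = 8 \<or> a = 9 \<or> a = 10"
      by presburger
    then show ?thesis using Z0 Z Z9 by (auto simp: X_defs)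
  qed
  then show "X = 0" using frame_decomp[of X] by simp
qed

subsection \<open>The 31 symmetries\<close>

text \<open>By \<open>sym_eq_0\<close> a symmetry is determined by its jets. The k-th field is the
  multiple by the integer \<open>jn ! k\<close> of the symmetry whose k-th jet is 1 and whose other
  jets are 0; the multiples make all coefficients integral. Entries 7, 8, 9 commute and act
  diagonally on the whole list.\<close>

definition SL :: "pvf list" where
  "SL = [
    PV [] [mo 1 []] [] [] [] [] [] [] [] [] [],
    PV [] [] [] [] [mo (-1) []] [] [] [] [] [] [],
    PV [] [mo 1 [Kx]] [mo 1 []] [] [] [] [] [] [] [] [],
    PV [mo 2 []] [] [] [] [] [] [] [] [] [] [],
    PV [] [mo 2 [Knu, Ktau], mo 1 [Kx, Kx]] [mo 2 [Kx]] [mo 2 []] [mo 2 [Kux]] [] [] [mo 2 [Ktau]]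
     [mo (-2) [Knu]] [] [],
    PV [mo 6 [Kuxx]] [mo (-6) [Kutau, Kuxnu], mo 6 [Kunu, Kuxtau], mo (-6) [Kz], mo 6 [Kux, Kuxx]]
     [mo 6 [Kuxnu, Kuxtau], mo 3 [Kuxx, Kuxx]] []
     [mo 6 [Kuxx, Kuxnu, Kuxtau], mo 1 [Kuxx, Kuxx, Kuxx]] [mo (-6) [Kuxtau]] [mo 6 [Kuxnu]]
     [mo 6 [Kuxx, Kuxnu]] [mo 6 [Kuxx, Kuxtau]] [] [],
    PV [] [] [] [] [] [mo 1 [Ktau]] [] [] [mo (-1) [Kunu]] [] [mo (-1) [Kuxnu]],
    PV [mo 1 [Kx]] [mo 2 [Ku]] [mo 1 [Kux]] [] [mo 1 [Kz]] [mo 1 [Knu]] [mo 1 [Ktau]] [mo 1 [Kunu]]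
     [mo 1 [Kutau]] [] [],
    PV [] [mo 1 [Ku]] [mo 1 [Kux]] [mo 1 [Kuxx]] [mo 2 [Kz]] [mo (-1) [Knu]] [mo 1 [Ktau]] [mo 2 [Kunu]]
     [] [mo 2 [Kuxnu]] [],
    PV [] [] [] [] [] [mo 1 [Knu]] [mo (-1) [Ktau]] [mo (-1) [Kunu]] [mo 1 [Kutau]] [mo (-1) [Kuxnu]]
     [mo 1 [Kuxtau]],
    PV [] [] [] [] [] [] [mo (-1) [Knu]] [mo 1 [Kutau]] [] [mo 1 [Kuxtau]] [],
    PV [] [mo (-6) [Kx, Knu, Ktau], mo (-1) [Kx, Kx, Kx]] [mo (-6) [Knu, Ktau], mo (-3) [Kx, Kx]]
     [mo (-6) [Kx]] [mo (-6) [Knu, Kunu], mo (-6) [Ktau, Kutau], mo 6 [Ku], mo (-6) [Kx, Kux]] [] []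
     [mo (-6) [Kx, Ktau]] [mo 6 [Kx, Knu]] [mo (-6) [Ktau]] [mo 6 [Knu]],
    PV [mo 8 [Kux], mo (-6) [Kx, Kuxx]]
     [mo 2 [Kunu, Kutau], mo 4 [Kux, Kux], mo 6 [Kx, Kutau, Kuxnu], mo (-6) [Kx, Kunu, Kuxtau], mo 6 [Kx, Kz], mo (-6) [Kx, Kux, Kuxx]]
     [mo 6 [Kz], mo (-6) [Kx, Kuxnu, Kuxtau], mo (-3) [Kx, Kuxx, Kuxx]]
     [mo 8 [Kuxnu, Kuxtau], mo (-2) [Kuxx, Kuxx]]
     [mo (-6) [Kx, Kuxx, Kuxnu, Kuxtau], mo (-1) [Kx, Kuxx, Kuxx, Kuxx]]
     [mo (-2) [Kutau], mo 6 [Kx, Kuxtau]] [mo 2 [Kunu], mo (-6) [Kx, Kuxnu]]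
     [mo (-6) [Kx, Kuxx, Kuxnu]] [mo (-6) [Kx, Kuxx, Kuxtau]] [mo (-4) [Kuxx, Kuxnu]]
     [mo (-4) [Kuxx, Kuxtau]],
    PV [mo 8 [Knu, Ktau], mo (-2) [Kx, Kx]] [mo (-6) [Kx, Ku]]
     [mo 4 [Knu, Kunu], mo 4 [Ktau, Kutau], mo (-6) [Ku], mo (-2) [Kx, Kux]]
     [mo 8 [Knu, Kuxnu], mo 8 [Ktau, Kuxtau], mo (-8) [Kux], mo 2 [Kx, Kuxx]]
     [mo (-2) [Kunu, Kutau], mo (-4) [Kux, Kux]] [mo (-4) [Kx, Knu]] [mo (-4) [Kx, Ktau]]
     [mo (-8) [Kux, Ktau], mo (-2) [Kx, Kunu]] [mo 8 [Kux, Knu], mo (-2) [Kx, Kutau]]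
     [mo (-2) [Kunu], mo (-4) [Kuxx, Ktau], mo 2 [Kx, Kuxnu]]
     [mo (-2) [Kutau], mo 4 [Kuxx, Knu], mo 2 [Kx, Kuxtau]],
    PV
     [mo 4 [Knu, Kunu], mo 4 [Ktau, Kutau], mo (-12) [Kuxx, Knu, Ktau], mo (-12) [Ku], mo 16 [Kx, Kux], mo (-6) [Kx, Kx, Kuxx]]
     [mo 12 [Knu, Ktau, Kutau, Kuxnu], mo (-12) [Knu, Ktau, Kunu, Kuxtau], mo 12 [Kz, Knu, Ktau], mo 4 [Kux, Knu, Kunu], mo 4 [Kux, Ktau, Kutau], mo (-12) [Kux, Kuxx, Knu, Ktau], mo 4 [Kx, Kunu, Kutau], mo 8 [Kx, Kux, Kux], mo 6 [Kx, Kx, Kutau, Kuxnu], mo (-6) [Kx, Kx, Kunu, Kuxtau], mo 6 [Kx, Kx, Kz], mo (-6) [Kx, Kx, Kux, Kuxx]]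
     [mo (-4) [Kunu, Kutau], mo (-12) [Knu, Ktau, Kuxnu, Kuxtau], mo (-6) [Kuxx, Kuxx, Knu, Ktau], mo 4 [Kux, Kux], mo 12 [Kx, Kz], mo (-6) [Kx, Kx, Kuxnu, Kuxtau], mo (-3) [Kx, Kx, Kuxx, Kuxx]]
     [mo 8 [Kutau, Kuxnu], mo (-8) [Kunu, Kuxtau], mo 12 [Kz], mo (-8) [Kuxx, Knu, Kuxnu], mo (-8) [Kuxx, Ktau, Kuxtau], mo 4 [Kux, Kuxx], mo 16 [Kx, Kuxnu, Kuxtau], mo (-4) [Kx, Kuxx, Kuxx]]
     [mo (-12) [Kuxx, Knu, Ktau, Kuxnu, Kuxtau], mo (-2) [Kuxx, Kuxx, Kuxx, Knu, Ktau], mo 12 [Kux, Kz], mo (-6) [Kx, Kx, Kuxx, Kuxnu, Kuxtau], mo (-1) [Kx, Kx, Kuxx, Kuxx, Kuxx]]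
     [mo 12 [Knu, Ktau, Kuxtau], mo 4 [Kux, Knu], mo (-4) [Kx, Kutau], mo 6 [Kx, Kx, Kuxtau]]
     [mo (-12) [Knu, Ktau, Kuxnu], mo 4 [Kux, Ktau], mo 4 [Kx, Kunu], mo (-6) [Kx, Kx, Kuxnu]]
     [mo 12 [Kz, Ktau], mo (-12) [Kuxx, Knu, Ktau, Kuxnu], mo 8 [Kux, Kunu], mo (-6) [Kx, Kx, Kuxx, Kuxnu]]
     [mo (-12) [Kz, Knu], mo (-12) [Kuxx, Knu, Ktau, Kuxtau], mo 8 [Kux, Kutau], mo (-6) [Kx, Kx, Kuxx, Kuxtau]]
     [mo 16 [Ktau, Kuxnu, Kuxtau], mo 4 [Kuxx, Kunu], mo 2 [Kuxx, Kuxx, Ktau], mo 4 [Kux, Kuxnu], mo (-8) [Kx, Kuxx, Kuxnu]]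
     [mo (-16) [Knu, Kuxnu, Kuxtau], mo 4 [Kuxx, Kutau], mo (-2) [Kuxx, Kuxx, Knu], mo 4 [Kux, Kuxtau], mo (-8) [Kx, Kuxx, Kuxtau]],
    PV [mo 12 [Kunu, Kutau], mo 24 [Kux, Kux], mo (-36) [Ku, Kuxx]]
     [mo 24 [Kux, Kunu, Kutau], mo 16 [Kux, Kux, Kux], mo 36 [Ku, Kutau, Kuxnu], mo (-36) [Ku, Kunu, Kuxtau], mo 36 [Ku, Kz], mo (-36) [Ku, Kux, Kuxx]]
     [mo 36 [Kux, Kz], mo (-36) [Ku, Kuxnu, Kuxtau], mo (-18) [Ku, Kuxx, Kuxx]]
     [mo 24 [Kuxx, Kutau, Kuxnu], mo (-24) [Kuxx, Kunu, Kuxtau], mo 36 [Kuxx, Kz], mo 48 [Kux, Kuxnu, Kuxtau], mo (-12) [Kux, Kuxx, Kuxx]]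
     [mo 36 [Kz, Kz], mo (-36) [Ku, Kuxx, Kuxnu, Kuxtau], mo (-6) [Ku, Kuxx, Kuxx, Kuxx]]
     [mo (-12) [Kux, Kutau], mo 36 [Ku, Kuxtau]] [mo 12 [Kux, Kunu], mo (-36) [Ku, Kuxnu]]
     [mo 36 [Kz, Kunu], mo (-36) [Ku, Kuxx, Kuxnu]] [mo 36 [Kz, Kutau], mo (-36) [Ku, Kuxx, Kuxtau]]
     [mo 48 [Kunu, Kuxnu, Kuxtau], mo 36 [Kz, Kuxnu], mo 6 [Kuxx, Kuxx, Kunu], mo (-24) [Kux, Kuxx, Kuxnu]]
     [mo 48 [Kutau, Kuxnu, Kuxtau], mo 36 [Kz, Kuxtau], mo 6 [Kuxx, Kuxx, Kutau], mo (-24) [Kux, Kuxx, Kuxtau]],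
    PV
     [mo 48 [Kux, Knu, Ktau], mo 12 [Kx, Knu, Kunu], mo 12 [Kx, Ktau, Kutau], mo (-36) [Kx, Kuxx, Knu, Ktau], mo (-36) [Kx, Ku], mo 24 [Kx, Kx, Kux], mo (-6) [Kx, Kx, Kx, Kuxx]]
     [mo 12 [Knu, Ktau, Kunu, Kutau], mo 24 [Kux, Kux, Knu, Ktau], mo (-36) [Ku, Ku], mo 36 [Kx, Knu, Ktau, Kutau, Kuxnu], mo (-36) [Kx, Knu, Ktau, Kunu, Kuxtau], mo 36 [Kx, Kz, Knu, Ktau], mo 12 [Kx, Kux, Knu, Kunu], mo 12 [Kx, Kux, Ktau, Kutau], mo (-36) [Kx, Kux, Kuxx, Knu, Ktau], mo 6 [Kx, Kx, Kunu, Kutau], mo 12 [Kx, Kx, Kux, Kux], mo 6 [Kx, Kx, Kx, Kutau, Kuxnu], mo (-6) [Kx, Kx, Kx, Kunu, Kuxtau], mo 6 [Kx, Kx, Kx, Kz], mo (-6) [Kx, Kx, Kx, Kux, Kuxx]]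
     [mo 36 [Kz, Knu, Ktau], mo 24 [Kux, Knu, Kunu], mo 24 [Kux, Ktau, Kutau], mo (-36) [Ku, Kux], mo (-12) [Kx, Kunu, Kutau], mo (-36) [Kx, Knu, Ktau, Kuxnu, Kuxtau], mo (-18) [Kx, Kuxx, Kuxx, Knu, Ktau], mo 12 [Kx, Kux, Kux], mo 18 [Kx, Kx, Kz], mo (-6) [Kx, Kx, Kx, Kuxnu, Kuxtau], mo (-3) [Kx, Kx, Kx, Kuxx, Kuxx]]
     [mo (-12) [Kunu, Kutau], mo 48 [Knu, Ktau, Kuxnu, Kuxtau], mo 12 [Kuxx, Knu, Kunu], mo 12 [Kuxx, Ktau, Kutau], mo (-12) [Kuxx, Kuxx, Knu, Ktau], mo 48 [Kux, Knu, Kuxnu], mo 48 [Kux, Ktau, Kuxtau], mo (-24) [Kux, Kux], mo 24 [Kx, Kutau, Kuxnu], mo (-24) [Kx, Kunu, Kuxtau], mo 36 [Kx, Kz], mo (-24) [Kx, Kuxx, Knu, Kuxnu], mo (-24) [Kx, Kuxx, Ktau, Kuxtau], mo 12 [Kx, Kux, Kuxx], mo 24 [Kx, Kx, Kuxnu, Kuxtau], mo (-6) [Kx, Kx, Kuxx, Kuxx]]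
     [mo 36 [Kz, Knu, Kunu], mo 36 [Kz, Ktau, Kutau], mo (-12) [Kux, Kunu, Kutau], mo (-8) [Kux, Kux, Kux], mo (-36) [Ku, Kz], mo (-36) [Kx, Kuxx, Knu, Ktau, Kuxnu, Kuxtau], mo (-6) [Kx, Kuxx, Kuxx, Kuxx, Knu, Ktau], mo 36 [Kx, Kux, Kz], mo (-6) [Kx, Kx, Kx, Kuxx, Kuxnu, Kuxtau], mo (-1) [Kx, Kx, Kx, Kuxx, Kuxx, Kuxx]]
     [mo (-12) [Knu, Ktau, Kutau], mo (-36) [Ku, Knu], mo 36 [Kx, Knu, Ktau, Kuxtau], mo 12 [Kx, Kux, Knu], mo (-6) [Kx, Kx, Kutau], mo 6 [Kx, Kx, Kx, Kuxtau]]
     [mo 12 [Knu, Ktau, Kunu], mo (-36) [Ku, Ktau], mo (-36) [Kx, Knu, Ktau, Kuxnu], mo 12 [Kx, Kux, Ktau], mo 6 [Kx, Kx, Kunu], mo (-6) [Kx, Kx, Kx, Kuxnu]]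
     [mo (-48) [Ktau, Kunu, Kutau], mo (-24) [Kux, Kux, Ktau], mo (-36) [Ku, Kunu], mo 36 [Kx, Kz, Ktau], mo (-36) [Kx, Kuxx, Knu, Ktau, Kuxnu], mo 24 [Kx, Kux, Kunu], mo (-6) [Kx, Kx, Kx, Kuxx, Kuxnu]]
     [mo 48 [Knu, Kunu, Kutau], mo 24 [Kux, Kux, Knu], mo (-36) [Ku, Kutau], mo (-36) [Kx, Kz, Knu], mo (-36) [Kx, Kuxx, Knu, Ktau, Kuxtau], mo 24 [Kx, Kux, Kutau], mo (-6) [Kx, Kx, Kx, Kuxx, Kuxtau]]
     [mo (-12) [Knu, Kunu, Kuxnu], mo 36 [Ktau, Kutau, Kuxnu], mo (-48) [Ktau, Kunu, Kuxtau], mo 36 [Kz, Ktau], mo (-24) [Kuxx, Knu, Ktau, Kuxnu], mo (-12) [Kux, Kunu], mo (-24) [Kux, Kuxx, Ktau], mo 48 [Kx, Ktau, Kuxnu, Kuxtau], mo 12 [Kx, Kuxx, Kunu], mo 6 [Kx, Kuxx, Kuxx, Ktau], mo 12 [Kx, Kux, Kuxnu], mo (-12) [Kx, Kx, Kuxx, Kuxnu]]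
     [mo (-48) [Knu, Kutau, Kuxnu], mo 36 [Knu, Kunu, Kuxtau], mo (-12) [Ktau, Kutau, Kuxtau], mo (-36) [Kz, Knu], mo (-24) [Kuxx, Knu, Ktau, Kuxtau], mo (-12) [Kux, Kutau], mo 24 [Kux, Kuxx, Knu], mo (-48) [Kx, Knu, Kuxnu, Kuxtau], mo 12 [Kx, Kuxx, Kutau], mo (-6) [Kx, Kuxx, Kuxx, Knu], mo 12 [Kx, Kux, Kuxtau], mo (-12) [Kx, Kx, Kuxx, Kuxtau]],
    PV [] [mo (-1) [Ktau]] [] [] [] [] [] [] [mo 1 []] [] [],
    PV [] [mo 1 [Knu]] [] [] [] [] [] [mo (-1) []] [] [] [],
    PV [] [] [] [] [] [mo 1 []] [] [] [] [] [],
    PV [] [] [] [] [] [] [mo (-1) []] [] [] [] [],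
    PV [] [mo (-1) [Kx, Ktau]] [mo (-1) [Ktau]] [] [mo (-1) [Kunu]] [] [] [] [mo 1 [Kx]] [] [mo 1 []],
    PV [] [mo 1 [Kx, Knu]] [mo 1 [Knu]] [] [mo (-1) [Kutau]] [] [] [mo (-1) [Kx]] [] [mo (-1) []] [],
    PV [mo (-2) [Ktau]] [] [mo (-1) [Kunu]] [mo (-2) [Kuxnu]] [] [mo 1 [Kx]] [] [] [mo (-2) [Kux]] []
     [mo (-1) [Kuxx]],
    PV [mo (-2) [Knu]] [] [mo 1 [Kutau]] [mo 2 [Kuxtau]] [] [] [mo (-1) [Kx]] [mo (-2) [Kux]] []
     [mo (-1) [Kuxx]] [],
    PV [mo 2 [Kunu], mo (-6) [Kuxx, Ktau]]
     [mo 6 [Ktau, Kutau, Kuxnu], mo (-6) [Ktau, Kunu, Kuxtau], mo 6 [Kz, Ktau], mo 2 [Kux, Kunu], mo (-6) [Kux, Kuxx, Ktau]]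
     [mo (-6) [Ktau, Kuxnu, Kuxtau], mo (-3) [Kuxx, Kuxx, Ktau]] [mo (-4) [Kuxx, Kuxnu]]
     [mo (-6) [Kuxx, Ktau, Kuxnu, Kuxtau], mo (-1) [Kuxx, Kuxx, Kuxx, Ktau]]
     [mo 6 [Ktau, Kuxtau], mo 2 [Kux]] [mo (-6) [Ktau, Kuxnu]] [mo (-6) [Kuxx, Ktau, Kuxnu]]
     [mo (-6) [Kz], mo (-6) [Kuxx, Ktau, Kuxtau]] [] [mo (-8) [Kuxnu, Kuxtau], mo (-1) [Kuxx, Kuxx]],
    PV [mo 2 [Kutau], mo 6 [Kuxx, Knu]]
     [mo (-6) [Knu, Kutau, Kuxnu], mo 6 [Knu, Kunu, Kuxtau], mo (-6) [Kz, Knu], mo 2 [Kux, Kutau], mo 6 [Kux, Kuxx, Knu]]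
     [mo 6 [Knu, Kuxnu, Kuxtau], mo 3 [Kuxx, Kuxx, Knu]] [mo (-4) [Kuxx, Kuxtau]]
     [mo 6 [Kuxx, Knu, Kuxnu, Kuxtau], mo 1 [Kuxx, Kuxx, Kuxx, Knu]] [mo (-6) [Knu, Kuxtau]]
     [mo 6 [Knu, Kuxnu], mo 2 [Kux]] [mo 6 [Kz], mo 6 [Kuxx, Knu, Kuxnu]] [mo 6 [Kuxx, Knu, Kuxtau]]
     [mo 8 [Kuxnu, Kuxtau], mo 1 [Kuxx, Kuxx]] [],
    PV [mo (-4) [Kx, Ktau]] [mo (-6) [Ku, Ktau]] [mo (-2) [Kux, Ktau], mo (-2) [Kx, Kunu]]
     [mo (-2) [Kunu], mo 2 [Kuxx, Ktau], mo (-4) [Kx, Kuxnu]] [mo (-2) [Kux, Kunu]]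
     [mo 8 [Knu, Ktau], mo 1 [Kx, Kx]] [] [mo 2 [Ktau, Kunu]]
     [mo (-8) [Knu, Kunu], mo (-6) [Ktau, Kutau], mo 6 [Ku], mo (-4) [Kx, Kux]] [mo 6 [Ktau, Kuxnu]]
     [mo (-8) [Knu, Kuxnu], mo (-2) [Ktau, Kuxtau], mo 2 [Kux], mo (-2) [Kx, Kuxx]],
    PV [mo (-4) [Kx, Knu]] [mo (-6) [Ku, Knu]] [mo (-2) [Kux, Knu], mo 2 [Kx, Kutau]]
     [mo 2 [Kutau], mo 2 [Kuxx, Knu], mo 4 [Kx, Kuxtau]] [mo 2 [Kux, Kutau]] []
     [mo (-8) [Knu, Ktau], mo (-1) [Kx, Kx]]
     [mo (-6) [Knu, Kunu], mo (-8) [Ktau, Kutau], mo 6 [Ku], mo (-4) [Kx, Kux]] [mo 2 [Knu, Kutau]]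
     [mo (-2) [Knu, Kuxnu], mo (-8) [Ktau, Kuxtau], mo 2 [Kux], mo (-2) [Kx, Kuxx]]
     [mo 6 [Knu, Kuxtau]],
    PV [mo 8 [Kux, Ktau], mo 2 [Kx, Kunu], mo (-6) [Kx, Kuxx, Ktau]]
     [mo 2 [Ktau, Kunu, Kutau], mo 4 [Kux, Kux, Ktau], mo 6 [Kx, Ktau, Kutau, Kuxnu], mo (-6) [Kx, Ktau, Kunu, Kuxtau], mo 6 [Kx, Kz, Ktau], mo 2 [Kx, Kux, Kunu], mo (-6) [Kx, Kux, Kuxx, Ktau]]
     [mo 6 [Kz, Ktau], mo 4 [Kux, Kunu], mo (-6) [Kx, Ktau, Kuxnu, Kuxtau], mo (-3) [Kx, Kuxx, Kuxx, Ktau]]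
     [mo 8 [Ktau, Kuxnu, Kuxtau], mo 2 [Kuxx, Kunu], mo (-2) [Kuxx, Kuxx, Ktau], mo 8 [Kux, Kuxnu], mo (-4) [Kx, Kuxx, Kuxnu]]
     [mo 6 [Kz, Kunu], mo (-6) [Kx, Kuxx, Ktau, Kuxnu, Kuxtau], mo (-1) [Kx, Kuxx, Kuxx, Kuxx, Ktau]]
     [mo (-2) [Ktau, Kutau], mo (-6) [Ku], mo 6 [Kx, Ktau, Kuxtau], mo 2 [Kx, Kux]]
     [mo 2 [Ktau, Kunu], mo (-6) [Kx, Ktau, Kuxnu]] [mo (-6) [Kx, Kuxx, Ktau, Kuxnu]]
     [mo 8 [Kunu, Kutau], mo 4 [Kux, Kux], mo (-6) [Kx, Kz], mo (-6) [Kx, Kuxx, Ktau, Kuxtau]]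
     [mo (-2) [Kunu, Kuxnu], mo (-4) [Kuxx, Ktau, Kuxnu]]
     [mo (-8) [Kutau, Kuxnu], mo 6 [Kunu, Kuxtau], mo (-6) [Kz], mo (-4) [Kuxx, Ktau, Kuxtau], mo 4 [Kux, Kuxx], mo (-8) [Kx, Kuxnu, Kuxtau], mo (-1) [Kx, Kuxx, Kuxx]],
    PV [mo (-8) [Kux, Knu], mo 2 [Kx, Kutau], mo 6 [Kx, Kuxx, Knu]]
     [mo (-2) [Knu, Kunu, Kutau], mo (-4) [Kux, Kux, Knu], mo (-6) [Kx, Knu, Kutau, Kuxnu], mo 6 [Kx, Knu, Kunu, Kuxtau], mo (-6) [Kx, Kz, Knu], mo 2 [Kx, Kux, Kutau], mo 6 [Kx, Kux, Kuxx, Knu]]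
     [mo (-6) [Kz, Knu], mo 4 [Kux, Kutau], mo 6 [Kx, Knu, Kuxnu, Kuxtau], mo 3 [Kx, Kuxx, Kuxx, Knu]]
     [mo (-8) [Knu, Kuxnu, Kuxtau], mo 2 [Kuxx, Kutau], mo 2 [Kuxx, Kuxx, Knu], mo 8 [Kux, Kuxtau], mo (-4) [Kx, Kuxx, Kuxtau]]
     [mo 6 [Kz, Kutau], mo 6 [Kx, Kuxx, Knu, Kuxnu, Kuxtau], mo 1 [Kx, Kuxx, Kuxx, Kuxx, Knu]]
     [mo 2 [Knu, Kutau], mo (-6) [Kx, Knu, Kuxtau]]
     [mo (-2) [Knu, Kunu], mo (-6) [Ku], mo 6 [Kx, Knu, Kuxnu], mo 2 [Kx, Kux]]
     [mo (-8) [Kunu, Kutau], mo (-4) [Kux, Kux], mo 6 [Kx, Kz], mo 6 [Kx, Kuxx, Knu, Kuxnu]]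
     [mo 6 [Kx, Kuxx, Knu, Kuxtau]]
     [mo 6 [Kutau, Kuxnu], mo (-8) [Kunu, Kuxtau], mo 6 [Kz], mo 4 [Kuxx, Knu, Kuxnu], mo (-4) [Kux, Kuxx], mo 8 [Kx, Kuxnu, Kuxtau], mo 1 [Kx, Kuxx, Kuxx]]
     [mo (-2) [Kutau, Kuxtau], mo 4 [Kuxx, Knu, Kuxtau]]]"

definition spar :: "bool list" where "spar = replicate 17 False @ replicate 14 True"

definition jn :: "int list" where
  "jn = [1, -2, 1, 2, 2, 6, 1, 2, 1, -1, -1, -12, 4, -4, 8, 24, 48, 1, -1, 1, -1, 1, -1, -1, -1, -2, 2, -4, -4, 4, -4]"

text \<open>Row k lists the brackets of the k-th field with the fields k, k + 1, ..., 30.\<close>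

definition stab :: "(int \<times> nat) list list list" where
  "stab = [
   [[], [], [], [], [], [], [], [(2, 0)], [(1, 0)], [], [], [(-6, 1)], [], [(-6, 2)], [(-6, 3)], [(-6, 5)],
   [(-36, 7)], [], [], [], [], [], [], [], [], [], [], [(6, 17)], [(-6, 18)], [(-6, 19)], [(6, 20)]],
   [[], [], [], [], [(6, 0)], [], [(1, 1)], [(2, 1)], [], [], [], [(-6, 2)], [], [(-6, 4)], [(-36, 8), (-36,
   9)], [(6, 11)], [], [], [], [], [], [], [], [], [(6, 17)], [(6, 18)], [], [], [(6, 21)], [(6, 22)]],
   [[], [(-2, 0)], [(-2, 1)], [], [], [(1, 2)], [(1, 2)], [], [], [], [(4, 3)], [(-4, 4)], [(4, 7), (4, 8),
   (4, 9)], [(6, 12)], [(6, 13)], [], [], [], [], [], [], [(-2, 17)], [(2, 18)], [(2, 19)], [(-2, 20)], [(2,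
   21)], [(-2, 22)], [(-4, 23)], [(4, 24)]],
   [[], [(4, 2)], [], [], [(1, 3)], [], [], [], [(-6, 4)], [(-2, 5)], [(-8, 7), (4, 8), (4, 9)], [(4, 12)],
   [], [(6, 14)], [], [], [], [], [(2, 17)], [(2, 18)], [(2, 19)], [(2, 20)], [], [], [(4, 23)], [(4, 24)],
   [(2, 25)], [(2, 26)]],
   [[], [(6, 3)], [], [], [(1, 4)], [], [], [], [(4, 7), (-8, 8), (-8, 9)], [(2, 11)], [(-4, 13)], [(6, 14)],
   [], [], [], [(2, 17)], [(-2, 18)], [], [], [(-2, 21)], [(2, 22)], [(4, 23)], [(-4, 24)], [], [], [(-2,
   27)], [(2, 28)]],
   [[], [], [(1, 5)], [(-1, 5)], [], [], [(36, 7), (-36, 8), (-36, 9)], [], [(6, 12)], [], [], [(6, 15)], [],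
   [], [], [], [(6, 19)], [(-6, 20)], [], [], [], [], [(6, 25)], [(-6, 26)], [], []],
   [[], [], [(-2, 6)], [(2, 6)], [(1, 9)], [], [], [], [], [], [], [], [(-1, 17)], [], [(1, 19)], [], [(-1,
   21)], [], [(1, 23)], [], [(-1, 25)], [], [(1, 27)], [], [(-1, 29)]],
   [[], [], [], [], [(1, 11)], [], [(1, 13)], [(1, 14)], [(1, 15)], [(2, 16)], [(-1, 17)], [(-1, 18)], [(-1,
   19)], [(-1, 20)], [], [], [], [], [], [], [(1, 27)], [(1, 28)], [(1, 29)], [(1, 30)]],
   [[], [], [(-2, 10)], [(-1, 11)], [(1, 12)], [], [(1, 14)], [(2, 15)], [(1, 16)], [], [(-2, 18)], [(1, 19)],
   [(-1, 20)], [], [(-2, 22)], [(1, 23)], [(-1, 24)], [(2, 25)], [], [(1, 27)], [(-1, 28)], [(2, 29)], []],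
   [[], [(2, 10)], [], [], [], [], [], [], [(-1, 17)], [(1, 18)], [(-1, 19)], [(1, 20)], [(-1, 21)], [(1,
   22)], [(-1, 23)], [(1, 24)], [(-1, 25)], [(1, 26)], [(-1, 27)], [(1, 28)], [(-1, 29)], [(1, 30)]],
   [[], [], [], [], [], [], [], [(1, 18)], [], [(-1, 20)], [], [(1, 22)], [], [(-1, 24)], [], [(1, 26)], [],
   [(-1, 28)], [], [(1, 30)], []],
   [[], [(-6, 13)], [], [], [(-6, 16)], [], [], [], [(-6, 21)], [(6, 22)], [], [], [], [], [(-6, 27)], [(6,
   28)], [], [], [], []],
   [[], [(-4, 14)], [(2, 15)], [], [], [(2, 19)], [(-2, 20)], [], [], [(-4, 23)], [(4, 24)], [(2, 25)], [(-2,
   26)], [], [], [(-2, 29)], [(2, 30)], [], []],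
   [[], [(2, 16)], [], [], [(2, 21)], [(2, 22)], [(4, 23)], [(4, 24)], [], [], [(2, 27)], [(2, 28)], [(2,
   29)], [(2, 30)], [], [], [], []],
   [[], [], [], [(4, 23)], [(-4, 24)], [(-2, 25)], [(2, 26)], [(-2, 27)], [(2, 28)], [(2, 29)], [(-2, 30)],
   [], [], [], [], [], []],
   [[], [], [(6, 25)], [(6, 26)], [], [], [(6, 29)], [(6, 30)], [], [], [], [], [], [], [], []],
   [[], [(6, 27)], [(-6, 28)], [(-6, 29)], [(6, 30)], [], [], [], [], [], [], [], [], [], []],
   [[], [], [], [(1, 0)], [], [(1, 1)], [], [(1, 2)], [], [(1, 3)], [], [(1, 4)], [(8, 6)], [(2, 7), (2, 8),
   (-2, 9)]],
   [[], [(1, 0)], [], [(-1, 1)], [], [(1, 2)], [], [(-1, 3)], [], [(1, 4)], [], [(-2, 7), (-2, 8), (-6, 9)],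
   [(8, 10)]],
   [[], [], [], [(1, 2)], [], [(-1, 3)], [], [(1, 5)], [(8, 6)], [(-4, 7), (2, 8), (6, 9)], [], [(-1, 12)]],
   [[], [(1, 2)], [], [(1, 3)], [], [(1, 5)], [], [(4, 7), (-2, 8), (2, 9)], [(8, 10)], [(-1, 12)], []],
   [[], [], [], [(1, 4)], [(-8, 6)], [(2, 7), (-4, 8)], [], [(-1, 11)], [], [(-1, 13)]],
   [[], [(1, 4)], [], [(-2, 7), (4, 8), (8, 9)], [(-8, 10)], [(-1, 11)], [], [(1, 13)], []],
   [[(-4, 6)], [(-2, 9)], [], [(-1, 12)], [], [(1, 13)], [], [(-1, 14)]],
   [[(-4, 10)], [(-1, 12)], [], [(-1, 13)], [], [(-1, 14)], []],
   [[], [], [], [(-1, 14)], [], [(-1, 15)]],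
   [[], [(-1, 14)], [], [(1, 15)], []],
   [[], [], [], [(-1, 16)]],
   [[], [(-1, 16)], []],
   [[], []],
   [[]]]"

section \<open>Certificates for the brackets, the symmetry property and the jets\<close>

fun sgq :: "bool \<Rightarrow> bool \<Rightarrow> int" where "sgq True True = 1" | "sgq True False = -1" | "sgq False q = -1"

text \<open>The checks advance along several lists in parallel. Entries of the table without
  partners answer \<open>False\<close>, so a successful check covers every entry.\<close>

fun rowc :: "pvf list \<Rightarrow> bool \<Rightarrow> pvf \<Rightarrow> bool list \<Rightarrow> pvf list \<Rightarrow> (int \<times> nat) list list \<Rightarrow> bool" where
  "rowc G p X qs Ys [] = True"
| "rowc G p X (q # qs) (Y # Ys) (L # Ls) \<longleftrightarrow>
     pvzero (pvadd (-1) (pbr (sgq p q) X Y) (plc G L)) \<and> rowc G p X qs Ys Ls"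
| "rowc G p X _ _ (L # Ls) = False"

fun tabc :: "pvf list \<Rightarrow> bool list \<Rightarrow> pvf list \<Rightarrow> (int \<times> nat) list list list \<Rightarrow> bool" where
  "tabc G ps Xs [] = True"
| "tabc G (p # ps) (X # Xs) (R # Rs) \<longleftrightarrow> rowc G p X (p # ps) (X # Xs) R \<and> tabc G ps Xs Rs"
| "tabc G _ _ (R # Rs) = False"

text \<open>The bracket is an argument, so that it is computed once for all the forms with which it
  is contracted. Below, the forms are the last five of the coframe, which cut out the
  distribution.\<close>

fun symw :: "pvf list \<Rightarrow> pvf \<Rightarrow> bool" where
  "symw [] B = True" | "symw (W # Ws) B \<longleftrightarrow> pzero (pcon B W []) \<and> symw Ws B"
fun symf :: "pvf list \<Rightarrow> bool list \<Rightarrow> pvf list \<Rightarrow> bool \<Rightarrow> pvf \<Rightarrow> bool" where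
  "symf Ws (q # qs) (F # Fs) p X \<longleftrightarrow> symw Ws (pbr (sgq p q) X F) \<and> symf Ws qs Fs p X"
| "symf Ws [] [] p X = True" | "symf Ws [] (F # Fs) p X = False" | "symf Ws (q # qs) [] p X = False"
fun symx :: "pvf list \<Rightarrow> bool list \<Rightarrow> pvf list \<Rightarrow> bool list \<Rightarrow> pvf list \<Rightarrow> bool" where
  "symx Ws qs Fs (p # ps) (X # Xs) \<longleftrightarrow> pvhom p X \<and> symf Ws qs Fs p X \<and> symx Ws qs Fs ps Xs"
| "symx Ws qs Fs [] [] = True" | "symx Ws qs Fs [] (X # Xs) = False" | "symx Ws qs Fs (p # ps) [] = False"

fun palpha :: "poly \<Rightarrow> poly" where
  "palpha [] = []" | "palpha (M c e q # P) = M (sgi (opar q) c) e q # palpha P"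
fun pd :: "bool \<Rightarrow> pvf \<Rightarrow> poly \<Rightarrow> poly" where
  "pd True F P = pvapp F (palpha P) []" | "pd False F P = pvapp F P []"
fun pword :: "bool list \<Rightarrow> pvf list \<Rightarrow> nat list \<Rightarrow> poly \<Rightarrow> poly" where
  "pword qs Fs [] P = P" | "pword qs Fs (j # w) P = pd (qs ! j) (Fs ! j) (pword qs Fs w P)"
fun kif :: "bool \<Rightarrow> int \<Rightarrow> int" where "kif True c = c" | "kif False c = 0"
text \<open>Jets are taken at the origin, where only the constant term contributes.\<close>

fun pc0 :: "poly \<Rightarrow> int" where
  "pc0 [] = 0"
| "pc0 (M c e q # P) = kif (e = Ex 0 0 0 0 0 \<and> q = Od False False False False False False) c + pc0 P"
fun jetw where
  "jetw qs Fs Ws k m [] X n = True"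
| "jetw qs Fs Ws k m ((w, a) # wds) X n \<longleftrightarrow>
     pc0 (pword qs Fs w (pcon X (Ws ! a) [])) = kif (k = m) n \<and> jetw qs Fs Ws k (Suc m) wds X n"
fun jetx where
  "jetx qs Fs Ws wds k (n # ns) (X # Xs) \<longleftrightarrow> jetw qs Fs Ws k 0 wds X n \<and> jetx qs Fs Ws wds (Suc k) ns Xs"
| "jetx qs Fs Ws wds k [] [] = True" | "jetx qs Fs Ws wds k [] (X # Xs) = False"
| "jetx qs Fs Ws wds k (n # ns) [] = False"

lemma sym_check: "symx (drop 6 WL) (take 6 fpar) (take 6 FL) spar SL"
  by code_simp

lemma jet_check: "jetx fpar FL WL wd 0 jn SL"
  by code_simp

lemma tab_check: "tabc SL spar SL stab"
  by code_simp

section \<open>Soundness of the certificates\<close>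

abbreviation Sv :: "nat \<Rightarrow> vf" where "Sv k \<equiv> vsem (SL ! k)"

lemma sgq_sg: "of_int (sgq p q) = - sg (p \<and> q)"
  by (cases p; cases q) simp_all

lemma rowc_sound:
  assumes "rowc G p X qs Ys Ls" "l < length Ls"
  shows "hbr p (qs ! l) (vsem X) (vsem (Ys ! l)) = vsem (plc G (Ls ! l))"
  using assms
proof (induction G p X qs Ys Ls arbitrary: l rule: rowc.induct)
  case (2 G p X q qs Y Ys L Ls)
  show ?case
  proof (cases l)
    case 0
    have m: "vf_scale (of_int (-1)) H = - H" for H by (rule vf_eqI) simp
    have "pvzero (pvadd (-1) (pbr (sgq p q) X Y) (plc G L))" using 2 by simp
    from pvzero_sound[OF this] have "vsem (plc G L) = hbr p q (vsem X) (vsem Y)"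
      unfolding vsem_pvadd vsem_pbr[OF sgq_sg] m by simp
    then show ?thesis using 0 by simp
  next
    case (Suc n)
    then show ?thesis using 2 by simp
  qed
qed simp_all

lemma tabc_sound:
  assumes "tabc G ps Xs Rs" "k < length Rs" "l < length (Rs ! k)"
  shows "hbr (ps ! k) (ps ! (k + l)) (vsem (Xs ! k)) (vsem (Xs ! (k + l))) = vsem (plc G (Rs ! k ! l))"
  using assms
proof (induction G ps Xs Rs arbitrary: k rule: tabc.induct)
  case (2 G p ps X Xs R Rs)
  show ?case
  proof (cases k)
    case 0
    then show ?thesis using 2 rowc_sound[of G p X "p # ps" "X # Xs" R l] by simp
  next
    case (Suc n)
    then show ?thesis using 2 by simp
  qed
qed simp_all

lemma symw_sound: "symw Ws B \<Longrightarrow> W \<in> set Ws \<Longrightarrow> con W (vsem B) = 0"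
  by (induction Ws) (auto dest!: pzero_sound simp: psem_pcon)

lemma symf_sound:
  assumes "symf Ws qs Fs p X" "j < length Fs" "W \<in> set Ws"
  shows "con W (hbr p (qs ! j) (vsem X) (vsem (Fs ! j))) = 0"
  using assms
proof (induction Ws qs Fs p X arbitrary: j rule: symf.induct)
  case (1 Ws q qs F Fs p X)
  show ?case
  proof (cases j)
    case 0
    have "symw Ws (pbr (sgq p q) X F)" using 1 by simp
    from symw_sound[OF this 1(4)] show ?thesis using 0 by (simp add: vsem_pbr[OF sgq_sg])
  next
    case (Suc n)
    then show ?thesis using 1 by simp
  qed
qed simp_all

lemma symx_sound:
  assumes "symx Ws qs Fs ps Xs" "k < length Xs"
  shows "pvhom (ps ! k) (Xs ! k) \<and> symf Ws qs Fs (ps ! k) (Xs ! k)"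
  using assms
proof (induction Ws qs Fs ps Xs arbitrary: k rule: symx.induct)
  case (1 Ws qs Fs p ps X Xs)
  then show ?case by (cases k) simp_all
qed simp_all

lemma psem_palpha: "psem (palpha P) = alpha (psem P)"
proof (induction P)
  case (Cons m P)
  obtain c e q where m: "m = M c e q" by (cases m)
  have "msem (M (sgi (opar q) c) e q) = alpha (msem m)"
    using opar_odd[of q] by (auto simp: m mon_def alpha_def fun_eq_iff minus_one_power_iff of_int_sgi)
  then show ?case using Cons by (simp add: m alpha_add del: msem.simps)
qed simp

lemma psem_pd: "psem (pd (fpar ! j) (FL ! j) P) = d j (psem P)"
  by (cases "fpar ! j") (simp_all add: d_def psem_pvapp psem_palpha)

lemma psem_pword: "psem (pword fpar FL w P) = foldr d w (psem P)"
  by (induction w) (simp_all add: psem_pd)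

lemma oset_empty_iff: "{} = oset q \<longleftrightarrow> q = Od False False False False False False"
  by (cases q) (auto simp: set_eq_iff all_6)

lemma exv_0: "exv e 0 = (if e = Ex 0 0 0 0 0 then 1 else 0)"
  by (cases e) (auto simp: power_0_left)

lemma psem_0: "psem P {} 0 = of_int (pc0 P)"
proof (induction P)
  case (Cons m P)
  obtain c e q where m: "m = M c e q" by (cases m)
  have "kif b c = (if b then c else 0)" for b by (cases b) simp_all
  then show ?case using Cons by (auto simp: m mon_def plus_fun_apply oset_empty_iff exv_0 simp del: exv.simps)
qed (simp add: zero_fun_apply)

lemma kif_eq: "kif b c = (if b then c else 0)"
  by (cases b) simp_all

lemma jetw_sound:
  assumes "jetw fpar FL WL k i wds X n" "m < length wds"
  shows "foldr d (fst (wds ! m)) (con (WL ! snd (wds ! m)) (vsem X)) {} 0 = (if k = i + m then of_int n else 0)"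
  using assms
proof (induction wds arbitrary: i m)
  case (Cons x wds)
  obtain w a where x: "x = (w, a)" by (cases x)
  show ?case
  proof (cases m)
    case 0
    have "psem (pword fpar FL w (pcon X (WL ! a) [])) {} 0 = of_int (kif (k = i) n)"
      using Cons.prems(1) by (simp add: psem_0 x)
    then show ?thesis using 0 by (simp add: x psem_pword psem_pcon kif_eq)
  next
    case (Suc m')
    then show ?thesis using Cons.IH[of "Suc i" m'] Cons.prems by (simp add: x)
  qed
qed simp

lemma jetx_sound:
  assumes "jetx fpar FL WL wds i ns Xs" "k < length Xs" "m < length wds"
  shows "foldr d (fst (wds ! m)) (con (WL ! snd (wds ! m)) (vsem (Xs ! k))) {} 0
    = (if i + k = m then of_int (ns ! k) else 0)"
  using assms
proof (induction ns arbitrary: i k Xs)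
  case Nil then show ?case by (cases Xs) auto
next
  case (Cons n ns)
  then obtain X Ys where Xs: "Xs = X # Ys" by (cases Xs) auto
  show ?case
  proof (cases k)
    case 0
    then show ?thesis using Cons.prems jetw_sound[of i 0 wds X n m] by (simp add: Xs)
  next
    case (Suc k')
    then show ?thesis using Cons.IH[of "Suc i" Ys k'] Cons.prems by (simp add: Xs)
  qed
qed

lemma frame_lengths: "length FL = 11" "length WL = 11" "length fpar = 11"
  by code_simp+

lemma lengths: "length SL = 31" "length wd = 31" "length jn = 31" "length stab = 31"
  "list_all (\<lambda>k. length (stab ! k) = 31 - k \<and> jn ! k \<noteq> 0 \<and> list_all (list_all (\<lambda>(c, m). m < 31)) (stab ! k)) [0..<31]"
  by code_simp+

lemma Sv_hom: "k < 31 \<Longrightarrow> vf_hom (spar ! k) (Sv k)"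
  using symx_sound[OF sym_check] pvhom_sound lengths(1) by metis

lemma jet_Sv: "k < 31 \<Longrightarrow> m < 31 \<Longrightarrow> jet m (Sv k) = (if k = m then of_int (jn ! k) else 0)"
  using jetx_sound[OF jet_check, of k m] lengths by (simp add: jet_def)

lemma jn_nonzero: "k < 31 \<Longrightarrow> jn ! k \<noteq> 0"
  using lengths(5) unfolding list_all_upt by blast

lemma fr_brk_Sv:
  assumes "k < 31" "j < 6"
  shows "inD (brk (Sv k) (fr j))"
proof -
  have h: "vf_hom (fpar ! j) (fr j)" using assms by (simp add: fr_hom)
  have l: "length (take 6 FL) = 6" "length WL = 11" "take 6 fpar ! j = fpar ! j" "take 6 FL ! j = FL ! j"
    using assms by (simp_all add: frame_lengths)
  have "fc a (brk (Sv k) (fr j)) = 0" if "a < 11" "6 \<le> a" for a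
  proof -
    have "drop 6 WL ! (a - 6) = WL ! a" using that l by (simp add: nth_drop)
    then have "WL ! a \<in> set (drop 6 WL)" using that l by (metis diff_less_mono length_drop nth_mem)
    then show ?thesis
      using symf_sound[of "drop 6 WL" "take 6 fpar" "take 6 FL" "spar ! k" "SL ! k" j "WL ! a"]
        symx_sound[OF sym_check, of k] assms l lengths(1)
      by (simp add: fc_def brk_hom[OF Sv_hom[OF assms(1)] h])
  qed
  then show ?thesis by (simp add: inD_iff)
qed

section \<open>The vector space of symmetries and its coordinates\<close>

lemma brk_zero [simp]: "brk X 0 = 0" "brk 0 X = 0"
  using brk_scale_right[of 0 X 0] brk_scale_left[of 0 0 X]
  by (simp_all add: vf_eqI[of "vf_scale 0 _" 0])

lemma brk_sum_right: "finite A \<Longrightarrow> (\<And>a. a \<in> A \<Longrightarrow> vf_ok (Y a)) \<Longrightarrow> brk X (\<Sum>a\<in>A. Y a) = (\<Sum>a\<in>A. brk X (Y a))"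
  by (induction A rule: finite_induct) (simp_all add: brk_add_right vf_ok_sum)

lemma brk_sum_left: "finite A \<Longrightarrow> (\<And>a. a \<in> A \<Longrightarrow> vf_ok (Y a)) \<Longrightarrow> brk (\<Sum>a\<in>A. Y a) X = (\<Sum>a\<in>A. brk (Y a) X)"
  by (induction A rule: finite_induct) (simp_all add: brk_add_left vf_ok_sum)

lemma inD_add: "inD X \<Longrightarrow> inD Y \<Longrightarrow> inD (X + Y)"
  and inD_cmul: "sfun_ok f \<Longrightarrow> inD X \<Longrightarrow> inD (vf_cmul f X)"
  and inD_scale: "inD X \<Longrightarrow> inD (vf_scale c X)"
  and inD_zero: "inD 0"
  by (auto simp: inD_iff fc_linear)

lemma inD_sum: "(\<And>a. a \<in> A \<Longrightarrow> inD (Y a)) \<Longrightarrow> inD (\<Sum>a\<in>A. Y a)"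
  by (induction A rule: infinite_finite_induct) (auto intro: inD_add inD_zero)

text \<open>By the Leibniz rule, function coefficients contribute only further multiples of the
  generators, so brackets with the six generators suffice.\<close>

lemma Sv_sym: "k < 31 \<Longrightarrow> Sv k \<in> shc_sym"
proof -
  assume k: "k < 31"
  have "inD (brk (Sv k) Y)" if Y: "inD Y" for Y
  proof -
    have ok: "vf_ok Y" using Y by (simp add: inD_iff)
    have "Y = (\<Sum>a<11. vf_cmul (fc a Y) (fr a))" by (rule frame_decomp)
    also have "\<dots> = (\<Sum>a<6. vf_cmul (fc a Y) (fr a))"
      using Y by (intro sum.mono_neutral_right) (auto simp: inD_iff)
    finally have "brk (Sv k) Y = brk (Sv k) (\<Sum>a<6. vf_cmul (fc a Y) (fr a))" by simp
    also have "\<dots> = (\<Sum>a<6. brk (Sv k) (vf_cmul (fc a Y) (fr a)))"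
      using ok by (intro brk_sum_right) auto
    also have "\<dots> = (\<Sum>a<6. vf_cmul (vapp (Sv k) (fc a Y)) (fr a) + vf_cmul (tw (spar ! k) (fc a Y)) (brk (Sv k) (fr a)))"
      by (intro sum.cong refl brk_cmul[OF Sv_hom[OF k] fr_hom]) (use ok in auto)
    finally show ?thesis
      using ok k by (auto intro!: inD_sum inD_add inD_cmul inD_fr fr_brk_Sv)
  qed
  then show ?thesis by (simp add: shc_sym_def)
qed

lemma shc_sym_add: "X \<in> shc_sym \<Longrightarrow> Y \<in> shc_sym \<Longrightarrow> X + Y \<in> shc_sym"
  unfolding shc_sym_def by (auto simp: brk_add_left inD_add simp del: split_paired_All)

lemma shc_sym_scale: "X \<in> shc_sym \<Longrightarrow> vf_scale c X \<in> shc_sym"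
  unfolding shc_sym_def by (auto simp: brk_scale_left inD_scale simp del: split_paired_All)

lemma shc_sym_ok: "X \<in> shc_sym \<Longrightarrow> vf_ok X"
  by (simp add: shc_sym_def)

lemma vf_lincomb_sum: "vf_lincomb c e n = (\<Sum>k<n. vf_scale (c k) (e k))"
  by (induction n) simp_all

lemma lincomb_sym: "(\<And>k. k < n \<Longrightarrow> e k \<in> shc_sym) \<Longrightarrow> vf_lincomb c e n \<in> shc_sym"
proof (induction n)
  case 0
  have "(0::vf) \<in> shc_sym" by (simp add: shc_sym_def inD_zero)
  then show ?case by simp
next
  case (Suc n)
  then show ?case by (simp add: shc_sym_add shc_sym_scale)
qed

lemma jet_sum: "finite A \<Longrightarrow> (\<And>a. a \<in> A \<Longrightarrow> vf_ok (Y a)) \<Longrightarrow> jet m (\<Sum>a\<in>A. Y a) = (\<Sum>a\<in>A. jet m (Y a))"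
proof (induction A rule: finite_induct)
  case empty
  have "jet m (vf_scale 0 0) = 0" by (subst jet_scale) simp_all
  then show ?case by (simp add: vf_eqI[of "vf_scale 0 _" 0])
qed (simp add: jet_add vf_ok_sum)

definition coord :: "nat \<Rightarrow> vf \<Rightarrow> complex" where "coord m X = jet m X / of_int (jn ! m)"

lemma coord_lincomb: "m < 31 \<Longrightarrow> coord m (vf_lincomb c Sv 31) = c m"
proof -
  assume m: "m < 31"
  have "jet m (vf_lincomb c Sv 31) = (\<Sum>k<31. if k = m then c k * of_int (jn ! k) else 0)"
    using m by (simp add: vf_lincomb_sum jet_sum jet_scale jet_Sv if_distrib cong: if_cong)
  then show ?thesis using m jn_nonzero[OF m] by (simp add: coord_def)
qed

text \<open>The difference of the two sides is a symmetry with vanishing jets, hence zero.\<close>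

lemma sym_expand:
  assumes "X \<in> shc_sym"
  shows "X = vf_lincomb (\<lambda>m. coord m X) Sv 31"
proof -
  let ?Y = "vf_lincomb (\<lambda>m. coord m X) Sv 31"
  have Y: "?Y \<in> shc_sym" by (rule lincomb_sym) (rule Sv_sym)
  have m: "vf_scale (-1) ?Y = - ?Y" by (rule vf_eqI) simp
  have "X + vf_scale (-1) ?Y = 0"
  proof (rule sym_eq_0)
    show "X + vf_scale (- 1) ?Y \<in> shc_sym" using assms Y by (intro shc_sym_add shc_sym_scale)
    fix m :: nat assume "m < 31"
    then show "jet m (X + vf_scale (- 1) ?Y) = 0"
      using coord_lincomb[of m "\<lambda>m. coord m X"] jn_nonzero[of m] shc_sym_ok[OF assms] shc_sym_ok[OF Y]
      by (simp add: jet_add jet_scale coord_def)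
  qed
  then show ?thesis unfolding m by simp
qed

text \<open>Row k of \<open>stab\<close> starts at column k, whence the offset l - k. The other half
  of the structure constants follows by graded skew symmetry.\<close>

definition sc :: "nat \<Rightarrow> nat \<Rightarrow> nat \<Rightarrow> complex" where
  "sc k l m = (if k \<le> l then of_int (cf m (stab ! k ! (l - k)))
     else - sg (spar ! k \<and> spar ! l) * of_int (cf m (stab ! l ! (k - l))))"

lemma vsem_plc_SL: "\<forall>(c, m)\<in>set L. m < 31 \<Longrightarrow> vsem (plc SL L) = vf_lincomb (\<lambda>m. of_int (cf m L)) Sv 31"
proof (induction L)
  case Nil
  have "vf_scale 0 X = 0" for X by (rule vf_eqI) simp
  then show ?case by (simp add: vf_lincomb_sum cf_def vsem_plc)
next
  case (Cons x L)
  obtain c i where x: "x = (c, i)" by (cases x)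
  have s: "vf_scale (a + b) X = vf_scale a X + vf_scale b X" "vf_scale 0 X = 0" for a b X
    by (rule vf_eqI, simp add: sscale_def pointwise algebra_simps)+
  have "(\<Sum>m<31. vf_scale (of_int (cf m (x # L))) (Sv m)) =
     (\<Sum>m<31. (if m = i then vf_scale (of_int c) (Sv m) else 0) + vf_scale (of_int (cf m L)) (Sv m))"
    by (intro sum.cong refl) (auto simp: x cf_def s)
  also have "\<dots> = vf_scale (of_int c) (Sv i) + (\<Sum>m<31. vf_scale (of_int (cf m L)) (Sv m))"
    using Cons.prems by (simp add: sum.distrib x)
  finally show ?case using Cons by (simp add: vf_lincomb_sum vsem_plc x)
qed

lemma length_stab: "k < 31 \<Longrightarrow> length (stab ! k) = 31 - k"
  using lengths(5) unfolding list_all_upt by blast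

lemma hbr_Sv: "k < 31 \<Longrightarrow> k \<le> l \<Longrightarrow> l < 31 \<Longrightarrow>
    hbr (spar ! k) (spar ! l) (Sv k) (Sv l) = vsem (plc SL (stab ! k ! (l - k)))"
  using tabc_sound[OF tab_check, of k "l - k"] lengths(4) length_stab[of k] by simp

lemma stab_less:
  assumes "k < 31" "k \<le> l" "l < 31"
  shows "\<forall>(c, m)\<in>set (stab ! k ! (l - k)). m < 31"
proof -
  have "list_all (list_all (\<lambda>(c, m). m < 31)) (stab ! k)"
    using lengths(5) assms(1) unfolding list_all_upt by blast
  moreover have "stab ! k ! (l - k) \<in> set (stab ! k)"
    using assms by (intro nth_mem) (simp add: length_stab)
  ultimately show ?thesis by (auto simp: list_all_iff)
qed

lemma brk_Sv:
  assumes "k < 31" "l < 31"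
  shows "brk (Sv k) (Sv l) = vf_lincomb (sc k l) Sv 31"
proof -
  have *: "hbr (spar ! k) (spar ! l) (Sv k) (Sv l) = vf_lincomb (\<lambda>m. of_int (cf m (stab ! k ! (l - k)))) Sv 31"
    if "k < 31" "l < 31" "k \<le> l" for k l
    using hbr_Sv[OF that(1,3,2)] vsem_plc_SL[OF stab_less[OF that(1,3,2)]] by simp
  show ?thesis
  proof (cases "k \<le> l")
    case True
    then show ?thesis using *[OF assms] by (simp add: brk_hom[OF Sv_hom Sv_hom] assms sc_def vf_lincomb_sum)
  next
    case False
    have "hbr (spar ! k) (spar ! l) (Sv k) (Sv l) =
        vf_scale (- sg (spar ! k \<and> spar ! l)) (hbr (spar ! l) (spar ! k) (Sv l) (Sv k))"
      by (rule vf_eqI) (simp add: cmp_hbr sg_def sscale_def pointwise)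
    also have "\<dots> = vf_lincomb (sc k l) Sv 31"
    proof -
      have "vf_scale c (\<Sum>k\<in>A. vf_scale (x k) (Sv k)) = (\<Sum>k\<in>A. vf_scale (c * x k) (Sv k))" for c x A
        by (induction A rule: infinite_finite_induct) (auto simp: vf_scale_add vf_eqI[of "vf_scale _ 0" 0])
      then show ?thesis using *[of l k] False assms by (simp add: vf_lincomb_sum sc_def)
    qed
    finally show ?thesis by (simp add: brk_hom[OF Sv_hom Sv_hom] assms)
  qed
qed

subsection \<open>The matrix model of G(3)\<close>

text \<open>Constructors instead of numerals modulo 7 and 2, so that equality of indices is decided
  by plain rewriting.\<close>

datatype i7 = I0 | I1 | I2 | I3 | I4 | I5 | I6
datatype i2 = L0 | L1
datatype gi = G int int

fun t7 :: "i7 \<Rightarrow> 7" where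
  "t7 I0 = 0" | "t7 I1 = 1" | "t7 I2 = 2" | "t7 I3 = 3" | "t7 I4 = 4" | "t7 I5 = 5" | "t7 I6 = 6"
fun t2 :: "i2 \<Rightarrow> 2" where "t2 L0 = 0" | "t2 L1 = 1"

fun gc :: "gi \<Rightarrow> complex" where "gc (G a b) = of_int a + \<i> * of_int b"
fun gmul where "gmul (G a b) (G c e) = G (a * c - b * e) (a * e + b * c)"
fun gadd where "gadd (G a b) (G c e) = G (a + c) (b + e)"
fun gsc :: "int \<Rightarrow> gi \<Rightarrow> gi" where "gsc k (G a b) = G (k * a) (k * b)"

lemma gc_simps: "gc (gmul x y) = gc x * gc y" "gc (gadd x y) = gc x + gc y" "gc (gsc k x) = of_int k * gc x"
  by ((cases x; cases y)?, (cases x)?, simp add: algebra_simps)+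

lemma t7_eq: "t7 a = t7 b \<longleftrightarrow> a = b"
  by (cases a; cases b) simp_all

lemma t2_eq: "t2 a = t2 b \<longleftrightarrow> a = b"
  by (cases a; cases b) simp_all

lemma UNIV_7: "(UNIV :: 7 set) = {0, 1, 2, 3, 4, 5, 6}" and UNIV_2: "(UNIV :: 2 set) = {0, 1}"
proof -
  have "card {0, 1, 2, 3, 4, 5, 6 :: 7} = CARD(7)" "card {0, 1 :: 2} = CARD(2)" by simp_all
  then show "(UNIV :: 7 set) = {0, 1, 2, 3, 4, 5, 6}" "(UNIV :: 2 set) = {0, 1}"
    by (metis card_subset_eq finite_code subset_UNIV)+
qed

definition i7s :: "i7 list" where "i7s = [I0, I1, I2, I3, I4, I5, I6]"

lemma UNIV_i7: "(UNIV :: i7 set) = {I0, I1, I2, I3, I4, I5, I6}" and UNIV_i2: "(UNIV :: i2 set) = {L0, L1}"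
  by (auto intro: i7.exhaust i2.exhaust)

instance i7 :: finite by standard (simp add: UNIV_i7)
instance i2 :: finite by standard (simp add: UNIV_i2)

lemma bij_t7: "bij t7" and bij_t2: "bij t2"
proof -
  have "range t7 = UNIV" unfolding UNIV_7 UNIV_i7 by simp
  then show "bij t7" by (simp add: bij_def inj_def t7_eq)
  have "range t2 = UNIV" unfolding UNIV_2 UNIV_i2 by simp
  then show "bij t2" by (simp add: bij_def inj_def t2_eq)
qed

lemma all_t7: "(\<forall>i. P i) \<longleftrightarrow> (\<forall>a. P (t7 a))" and all_t2: "(\<forall>i. Q i) \<longleftrightarrow> (\<forall>a. Q (t2 a))"
  using bij_t7 bij_t2 by (metis bij_pointE)+

lemma sum_t7: "(\<Sum>i\<in>UNIV. f i) = (\<Sum>a\<in>UNIV. f (t7 a))"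
  using sum.reindex_bij_betw[OF bij_t7, of f] by simp

lemma list_all_i7s: "list_all P i7s \<longleftrightarrow> (\<forall>a. P a)"
proof -
  have "set i7s = UNIV" by (simp add: i7s_def UNIV_i7)
  then show ?thesis by (simp add: list_all_iff)
qed

subsection \<open>Sparse matrices\<close>

definition un :: "'r \<Rightarrow> 'c \<Rightarrow> complex \<Rightarrow> complex^'c^'r" where
  "un i j z = (\<chi> k l. if k = i \<and> l = j then z else 0)"

fun smx :: "('a \<Rightarrow> 'r::finite) \<Rightarrow> ('b \<Rightarrow> 'c::finite) \<Rightarrow> ('a \<times> 'b \<times> gi) list \<Rightarrow> complex^'c^'r" where
  "smx r c [] = 0" | "smx r c ((a, b, z) # L) = un (r a) (c b) (gc z) + smx r c L"

fun kc where "kc True x R = x # R" | "kc False x R = R"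
fun sm1 where "sm1 a b c [] R = R" | "sm1 a b c ((b', l, e) # L) R = kc (b = b') (a, l, gmul c e) (sm1 a b c L R)"
fun smul where "smul [] L R = R" | "smul ((a, b, c) # K) L R = sm1 a b c L (smul K L R)"
fun str where "str [] = []" | "str ((a, b, c) # L) = (b, a, c) # str L"
fun ssc where "ssc k [] R = R" | "ssc k ((a, b, c) # L) R = (a, b, gsc k c) # ssc k L R"

fun kg where "kg True e x (s, A) = (gadd s e, A)" | "kg False e x (s, A) = (s, x # A)"
fun scol where "scol a b s [] = (s, [])"
  | "scol a b s ((a', b', e) # L) = kg (a = a' \<and> b = b') e (a', b', e) (scol a b s L)"
text \<open>The natural number is again fuel, and exhaustion rejects.\<close>

fun sz and szc where "sz n [] = True" | "sz 0 (x # L) = False" | "sz (Suc n) ((a, b, c) # L) = szc n (scol a b c L)"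
  | "szc n (s, A) \<longleftrightarrow> s = G 0 0 \<and> sz n A"

lemma un_mult: "un i j z ** un k l w = (if j = k then un i l (z * w) else 0)"
proof -
  have "(\<Sum>r\<in>UNIV. un i j z $ p $ r * un k l w $ r $ q) = (\<Sum>r\<in>UNIV. if r = j then (if p = i \<and> j = k \<and> q = l then z * w else 0) else 0)" for p q
    by (rule sum.cong) (auto simp: un_def)
  then show ?thesis by (auto simp: vec_eq_iff matrix_matrix_mult_def) (auto simp: un_def)
qed

lemma matrix_distrib:
  fixes A A' :: "complex^'n^'m" and B C :: "complex^'p^'n"
  shows "A ** (B + C) = A ** B + A ** C" "(A + A') ** C = A ** C + A' ** C"
    "A ** (0 :: complex^'p^'n) = 0" "(0 :: complex^'n^'m) ** B = 0"
  by (simp_all add: vec_eq_iff matrix_matrix_mult_def algebra_simps sum.distrib)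

lemma smx_sm1: "inj tb \<Longrightarrow> smx ta te (sm1 a b c L R) = un (ta a) (tb b) (gc c) ** smx tb te L + smx ta te R"
proof (induction L)
  case (Cons x L)
  obtain b' e z where x: "x = (b', e, z)" by (cases x)
  have "tb b = tb b' \<longleftrightarrow> b = b'" using Cons.prems by (auto dest: injD)
  then show ?case using Cons by (cases "b = b'") (simp_all add: x matrix_distrib un_mult gc_simps add.assoc)
qed (simp add: matrix_distrib)

lemma smx_smul: "inj tb \<Longrightarrow> smx ta te (smul K L R) = smx ta tb K ** smx tb te L + smx ta te R"
proof (induction K)
  case (Cons x K)
  then show ?case by (cases x) (simp add: smx_sm1 matrix_distrib add.assoc)
qed (simp add: matrix_distrib)

lemma smx_str: "smx tb ta (str L) = transpose (smx ta tb L)"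
proof (induction L)
  case Nil then show ?case by (simp add: vec_eq_iff transpose_def)
next
  case (Cons x L)
  then show ?case by (cases x) (auto simp: vec_eq_iff transpose_def un_def)
qed

lemma smx_ssc: "smx ta tb (ssc k L R) = msc (of_int k) (smx ta tb L) + smx ta tb R"
proof (induction L)
  case Nil then show ?case by (simp add: vec_eq_iff msc_def)
next
  case (Cons x L)
  then show ?case by (cases x) (auto simp: vec_eq_iff msc_def un_def gc_simps algebra_simps)
qed

lemma un_add: "un i j (z + w) = un i j z + un i j w"
  by (simp add: vec_eq_iff un_def)

lemma smx_scol: "un (ta a) (tb b) (gc c) + smx ta tb L =
   un (ta a) (tb b) (gc (fst (scol a b c L))) + smx ta tb (snd (scol a b c L))"
proof (induction L)
  case (Cons x L)
  obtain a' b' z where x: "x = (a', b', z)" by (cases x)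
  show ?case
  proof (cases "a = a' \<and> b = b'")
    case True
    then show ?thesis using Cons by (cases "scol a b c L") (simp add: x gc_simps un_add add_ac)
  next
    case False
    then have f: "(a = a' \<and> b = b') = False" by simp
    show ?thesis using Cons by (cases "scol a b c L") (simp add: x f add.left_commute)
  qed
qed simp

lemma sz_sound: "sz n L \<Longrightarrow> smx ta tb L = 0" and "szc n X \<Longrightarrow> fst X = G 0 0 \<and> smx ta tb (snd X) = 0"
proof (induction n L and n X rule: sz_szc.induct)
  case (3 n a b c L)
  have "un i j 0 = 0" for i j by (simp add: vec_eq_iff un_def)
  then show ?case using 3 smx_scol[of ta a tb b c L] by simp
qed auto

subsection \<open>The three-form\<close>

text \<open>The multiplication table of the imaginary octonion units: for distinct a and b there is
  exactly one c with \<open>phi\<close> nonzero, the third point of the line through a and b in the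
  Fano plane.\<close>

fun nb :: "i7 \<Rightarrow> i7 \<Rightarrow> (i7 \<times> int) list" where
  "nb I0 I0 = []" | "nb I0 I1 = [(I2, 1)]" | "nb I0 I2 = [(I1, -1)]" | "nb I0 I3 = [(I4, 1)]" |
  "nb I0 I4 = [(I3, -1)]" | "nb I0 I5 = [(I6, 1)]" | "nb I0 I6 = [(I5, -1)]" | "nb I1 I0 = [(I2, -1)]" |
  "nb I1 I1 = []" | "nb I1 I2 = [(I0, 1)]" | "nb I1 I3 = [(I5, 1)]" | "nb I1 I4 = [(I6, -1)]" |
  "nb I1 I5 = [(I3, -1)]" | "nb I1 I6 = [(I4, 1)]" | "nb I2 I0 = [(I1, 1)]" | "nb I2 I1 = [(I0, -1)]" |
  "nb I2 I2 = []" | "nb I2 I3 = [(I6, -1)]" | "nb I2 I4 = [(I5, -1)]" | "nb I2 I5 = [(I4, 1)]" |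
  "nb I2 I6 = [(I3, 1)]" | "nb I3 I0 = [(I4, -1)]" | "nb I3 I1 = [(I5, -1)]" | "nb I3 I2 = [(I6, 1)]" |
  "nb I3 I3 = []" | "nb I3 I4 = [(I0, 1)]" | "nb I3 I5 = [(I1, 1)]" | "nb I3 I6 = [(I2, -1)]" |
  "nb I4 I0 = [(I3, 1)]" | "nb I4 I1 = [(I6, 1)]" | "nb I4 I2 = [(I5, 1)]" | "nb I4 I3 = [(I0, -1)]" |
  "nb I4 I4 = []" | "nb I4 I5 = [(I2, -1)]" | "nb I4 I6 = [(I1, -1)]" | "nb I5 I0 = [(I6, -1)]" |
  "nb I5 I1 = [(I3, 1)]" | "nb I5 I2 = [(I4, -1)]" | "nb I5 I3 = [(I1, -1)]" | "nb I5 I4 = [(I2, 1)]" |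
  "nb I5 I5 = []" | "nb I5 I6 = [(I0, 1)]" | "nb I6 I0 = [(I5, 1)]" | "nb I6 I1 = [(I4, -1)]" |
  "nb I6 I2 = [(I3, -1)]" | "nb I6 I3 = [(I2, 1)]" | "nb I6 I4 = [(I1, 1)]" | "nb I6 I5 = [(I0, -1)]" |
  "nb I6 I6 = []"

text \<open>The same tensor sorted by its first index, the form needed for the matrix of a cross
  product.\<close>

fun nb2 :: "i7 \<Rightarrow> (i7 \<times> i7 \<times> int) list" where
  "nb2 I0 = [(I1, I2, 1), (I2, I1, -1), (I3, I4, 1), (I4, I3, -1), (I5, I6, 1), (I6, I5, -1)]" |
  "nb2 I1 = [(I0, I2, -1), (I2, I0, 1), (I3, I5, 1), (I4, I6, -1), (I5, I3, -1), (I6, I4, 1)]" |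
  "nb2 I2 = [(I0, I1, 1), (I1, I0, -1), (I3, I6, -1), (I4, I5, -1), (I5, I4, 1), (I6, I3, 1)]" |
  "nb2 I3 = [(I0, I4, -1), (I1, I5, -1), (I2, I6, 1), (I4, I0, 1), (I5, I1, 1), (I6, I2, -1)]" |
  "nb2 I4 = [(I0, I3, 1), (I1, I6, 1), (I2, I5, 1), (I3, I0, -1), (I5, I2, -1), (I6, I1, -1)]" |
  "nb2 I5 = [(I0, I6, -1), (I1, I3, 1), (I2, I4, -1), (I3, I1, -1), (I4, I2, 1), (I6, I0, 1)]" |
  "nb2 I6 = [(I0, I5, 1), (I1, I4, -1), (I2, I3, -1), (I3, I2, 1), (I4, I1, 1), (I5, I0, -1)]"

fun ptl :: "(i7 \<times> int) list \<Rightarrow> i7 \<Rightarrow> int" where "ptl [] c = 0" | "ptl ((i, s) # L) c = kif (c = i) s + ptl L c"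
fun ptl2 :: "(i7 \<times> i7 \<times> int) list \<Rightarrow> i7 \<Rightarrow> i7 \<Rightarrow> int" where
  "ptl2 [] j k = 0" | "ptl2 ((j', k', s) # L) j k = kif (j = j' \<and> k = k') s + ptl2 L j k"
fun pt :: "i7 \<Rightarrow> i7 \<Rightarrow> i7 \<Rightarrow> int" where "pt a b c = ptl (nb a b) c"

text \<open>The defining formula of \<open>phi\<close> transcribed to the enumerated indices,
  against which the two tables are checked.\<close>

definition phi7 :: "i7 \<Rightarrow> i7 \<Rightarrow> i7 \<Rightarrow> int" where
  "phi7 i j k = sum_list (map (\<lambda>(a, b, c, s).
      s * ((if (i,j,k) = (a,b,c) \<or> (i,j,k) = (b,c,a) \<or> (i,j,k) = (c,a,b) then 1 else 0)
         - (if (i,j,k) = (b,a,c) \<or> (i,j,k) = (a,c,b) \<or> (i,j,k) = (c,b,a) then 1 else 0)))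
      [(I0, I1, I2, 1), (I0, I3, I4, 1), (I0, I5, I6, 1), (I1, I3, I5, 1), (I1, I4, I6, -1), (I2, I3, I6, -1), (I2, I4, I5, -1)])"

lemma phi7_checks:
  "list_all (\<lambda>a. list_all (\<lambda>b. list_all (\<lambda>c. phi7 a b c = pt a b c) i7s) i7s) i7s"
  "list_all (\<lambda>a. list_all (\<lambda>b. list_all (\<lambda>c. ptl2 (nb2 a) b c = pt a b c) i7s) i7s) i7s"
  by code_simp+

lemma phi_phi7: "phi (t7 i) (t7 j) (t7 k) = of_int (phi7 i j k)"
proof -
  have n: "0 = t7 I0" "1 = t7 I1" "2 = t7 I2" "3 = t7 I3" "4 = t7 I4" "5 = t7 I5" "6 = t7 I6" by simp_all
  have e: "(t7 i, t7 j, t7 k) = (t7 a, t7 b, t7 c) \<longleftrightarrow> (i, j, k) = (a, b, c)" for a b c by (simp add: t7_eq)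
  have t: "phi_triples = map (\<lambda>(a, b, c, s). (t7 a, t7 b, t7 c, of_int s)) [(I0, I1, I2, 1), (I0, I3, I4, 1), (I0, I5, I6, 1), (I1, I3, I5, 1), (I1, I4, I6, -1), (I2, I3, I6, -1), (I2, I4, I5, -1)]"
    by (simp add: phi_triples_def)
  have "map f (map (\<lambda>(a, b, c, s). (t7 a, t7 b, t7 c, of_int s)) L) =
    map (\<lambda>(a, b, c, s). f (t7 a, t7 b, t7 c, of_int s)) L" for f :: "7 \<times> 7 \<times> 7 \<times> complex \<Rightarrow> complex" and L
    by (simp add: split_beta)
  note m = this
  have s: "of_int (sum_list (map h L)) = (sum_list (map (\<lambda>x. of_int (h x)) L) :: complex)" for h :: "i7 \<times> i7 \<times> i7 \<times> int \<Rightarrow> int" and L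
    by (induction L) simp_all
  show ?thesis unfolding phi_def t m phi7_def s
    by (rule arg_cong[where f = sum_list], rule map_cong[OF refl], clarify)
      (simp only: split t7_eq prod.inject of_int_mult of_int_diff if_distrib[of of_int] of_int_1 of_int_0)
qed

lemma phi_pt: "phi (t7 a) (t7 b) (t7 c) = of_int (pt a b c)"
  using phi7_checks(1) unfolding list_all_i7s phi_phi7 by simp

text \<open>Works entry by entry: \<open>nb\<close> evaluates \<open>cvec\<close> on a matrix unit,
  and \<open>nb2\<close> supplies the entries of \<open>cross_mat\<close>, with k as row and j as
  column.\<close>

fun crs3 where "crs3 z [] R = R" | "crs3 z ((j, k, s) # L) R = (k, j, gsc s z) # crs3 z L R"
fun crs2 where "crs2 z [] R = R" | "crs2 z ((i, s) # L) R = crs3 (gsc s z) (nb2 i) (crs2 z L R)"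
fun crs where "crs [] R = R" | "crs ((a, b, z) # K) R = crs2 z (nb a b) (crs K R)"

lemma smx_crs3: "smx t7 t7 (crs3 z L R) $ t7 k $ t7 j = gc z * of_int (ptl2 L j k) + smx t7 t7 R $ t7 k $ t7 j"
  by (induction z L R rule: crs3.induct) (auto simp: un_def t7_eq gc_simps kif_eq algebra_simps)

lemma smx_crs2: "smx t7 t7 (crs2 z L R) $ t7 k $ t7 j =
   gc z * (\<Sum>i\<in>UNIV. of_int (pt i j k) * of_int (ptl L i)) + smx t7 t7 R $ t7 k $ t7 j"
proof (induction z L R rule: crs2.induct)
  case (2 z i s L R)
  have "ptl2 (nb2 i) j k = pt i j k" using phi7_checks(2) unfolding list_all_i7s by blast
  moreover have "(\<Sum>x\<in>UNIV. of_int (pt x j k) * of_int (ptl ((i, s) # L) x)) =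
      (\<Sum>x\<in>UNIV. if x = i then of_int (pt i j k) * of_int s else 0) + (\<Sum>x\<in>UNIV. of_int (pt x j k) * (of_int (ptl L x) :: complex))"
    unfolding sum.distrib[symmetric] by (rule sum.cong) (auto simp: kif_eq algebra_simps)
  ultimately show ?case using 2 by (simp add: smx_crs3 gc_simps algebra_simps del: pt.simps)
qed simp

lemma cvec_add: "cvec (A + B) = cvec A + cvec B" and cross_mat_add: "cross_mat (u + v) = cross_mat u + cross_mat v"
  by (simp_all add: cvec_def cross_mat_def vec_eq_iff algebra_simps sum.distrib)

lemma cvec_un: "cvec (un a b z) $ k = phi a b k * z"
proof -
  have "(\<Sum>j\<in>UNIV. phi i j k * un a b z $ i $ j) = (if i = a then phi a b k * z else 0)" for i
  proof -
    have "(\<Sum>j\<in>UNIV. phi i j k * un a b z $ i $ j) = (\<Sum>j\<in>UNIV. if j = b then (if i = a then phi a b k * z else 0) else 0)"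
      by (rule sum.cong) (auto simp: un_def)
    then show ?thesis by simp
  qed
  then show ?thesis by (simp add: cvec_def)
qed

lemma smx_crs: "smx t7 t7 (crs K R) = cross_mat (cvec (smx t7 t7 K)) + smx t7 t7 R"
proof (induction K R rule: crs.induct)
  case (1 R)
  have "cross_mat (cvec 0) = 0" by (simp add: cvec_def cross_mat_def vec_eq_iff)
  then show ?case by simp
next
  case (2 a b z K R)
  have "smx t7 t7 (crs2 z (nb a b) (crs K R)) = cross_mat (cvec (un (t7 a) (t7 b) (gc z))) + smx t7 t7 (crs K R)"
    unfolding vec_eq_iff all_t7
    by (simp add: smx_crs2 cross_mat_def cvec_un sum_t7 phi_pt sum_distrib_left mult_ac)
  then show ?case using 2 by (simp add: cvec_add cross_mat_add add.assoc)
qed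

lemma msc_simps: "msc c (A + B) = msc c A + msc c B" "msc c (msc e A) = msc (c * e) A" "msc 1 A = A" "msc c 0 = 0"
  "msc (c + e) A = msc c A + msc e A" "msc 0 A = 0" "msc c (- A) = - msc c A" "msc c (A - B) = msc c A - msc c B"
  by (simp_all add: msc_def vec_eq_iff algebra_simps)

lemma msc_mult:
  fixes A A' :: "complex^'n^'m" and B :: "complex^'p^'n"
  shows "msc c A ** B = msc c (A ** B)" "A ** msc c B = msc c (A ** B)"
    "transpose (msc c A) = msc c (transpose A)" "transpose (A + A') = transpose A + transpose A'"
  by (simp_all add: msc_def vec_eq_iff matrix_matrix_mult_def sum_distrib_left mult_ac transpose_def)

lemma g2proj_alt: "g2proj X = X + msc (1/6) (cross_mat (cvec X))"
  by (simp add: g2proj_def msc_def)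

lemma cross_msc: "cross_mat (cvec (msc c X)) = msc c (cross_mat (cvec X))"
  by (simp add: cross_mat_def cvec_def msc_def vec_eq_iff sum_distrib_left mult_ac)

lemma g2proj_linear: "g2proj (X + Y) = g2proj X + g2proj Y" "g2proj (msc c X) = msc c (g2proj X)"
  by (simp_all add: g2proj_alt cvec_add cross_mat_add msc_simps cross_msc mult.commute)

section \<open>Elements of G(3) with Gaussian integer entries\<close>

datatype gel = GE "(i7 \<times> i7 \<times> gi) list" "(i2 \<times> i2 \<times> gi) list" "(i7 \<times> i2 \<times> gi) list"

fun gsem :: "gel \<Rightarrow> g3" where "gsem (GE A B N) = (smx t7 t7 A, smx t2 t2 B, smx t7 t2 N)"

definition j2 :: "(i2 \<times> i2 \<times> gi) list" where "j2 = [(L0, L1, G 1 0), (L1, L0, G (-1) 0)]"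

lemma smx_j2: "smx t2 t2 j2 = J2"
  by (auto simp: j2_def J2_def un_def vec_eq_iff)

fun gY where "gY N N' = smul N (smul j2 (str N') []) (smul N' (smul j2 (str N) []) [])"
fun gcr where "gcr Y = ssc 6 Y (crs Y [])"

text \<open>Computes twice the bracket. The term with \<open>g2proj\<close> is 3Y plus one half of
  the cross product part, and doubling it gives the integral expression \<open>gcr\<close>;
  \<open>glc\<close> doubles the expected result accordingly.\<close>

fun gbr2 :: "gel \<Rightarrow> gel \<Rightarrow> gel" where
  "gbr2 (GE A B N) (GE A' B' N') = GE
    (ssc 2 (smul A A' []) (ssc (-2) (smul A' A []) (gcr (gY N N'))))
    (ssc 2 (smul B B' []) (ssc (-2) (smul B' B [])
      (ssc 4 (smul (smul (str N') N (smul (str N) N' [])) j2 []) [])))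
    (ssc 2 (smul A N' (smul N' (str B) [])) (ssc (-2) (smul A' N (smul N (str B') [])) []))"

lemma inj_t: "inj t7" "inj t2"
  using bij_t7 bij_t2 by (auto simp: bij_def)

lemma g3_scale_simp: "g3_scale c (A, B, N) = (msc c A, msc c B, msc c N)"
  by (simp add: g3_scale_def)

lemma g3_add_eq [simp]: "g3_add x y = x + y"
  by (simp add: g3_add_def prod_eq_iff)

lemma msc_neg: "msc (- c) A = - msc c A"
  by (simp add: msc_def vec_eq_iff)

lemma gsem_gbr2: "gsem (gbr2 x y) = g3_scale 2 (g3_bracket (gsem x) (gsem y))"
  by (cases x; cases y)
    (simp add: g3_bracket_def g3_scale_simp g3_act_def smx_ssc smx_smul[where tb = t7, OF inj_t(1)]
      smx_smul[where tb = t2, OF inj_t(2)] smx_str smx_crs smx_j2 g2proj_alt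
      msc_simps msc_neg matrix_mul_assoc matrix_distrib)

fun gsadd where "gsadd k (GE A B N) (GE A' B' N') = GE (ssc k A A') (ssc k B B') (ssc k N N')"
fun gzero where "gzero (GE A B N) \<longleftrightarrow> sz (length A) A \<and> sz (length B) B \<and> sz (length N) N"
fun glc where "glc H [] = GE [] [] []" | "glc H ((k, m) # L) = gsadd (2 * k) (H ! m) (glc H L)"

lemma gsem_gsadd: "gsem (gsadd k x y) = g3_scale (of_int k) (gsem x) + gsem y"
  by (cases x; cases y) (simp add: g3_scale_simp smx_ssc)

lemma gzero_sound: "gzero x \<Longrightarrow> gsem x = 0"
  by (cases x) (auto simp: zero_prod_def intro: sz_sound(1))

text \<open>Entries 7, 8, 9 span a Cartan subalgebra: imaginary multiples of rotations in the
  coordinate planes (1,2), (3,4), (5,6), together with a diagonal matrix of sl(2). The others are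
  root vectors. The weight vectors in dimension seven are e0, e1 +- i e2, e3 +- i e4, e5 +- i e6,
  which is why Gaussian integers occur. The scalings are matched to \<open>SL\<close>, so that the
  same table \<open>stab\<close> serves both algebras.\<close>

definition BL :: "gel list" where
  "BL = [
    GE [(I1, I5, G 0 3), (I1, I6, G 3 0), (I2, I5, G (-3) 0), (I2, I6, G 0 3), (I5, I1, G 0 (-3)), (I5, I2, G 3
    0), (I6, I1, G (-3) 0), (I6, I2, G 0 (-3))] [] [],
    GE [(I3, I5, G 0 3), (I3, I6, G 3 0), (I4, I5, G (-3)
    0), (I4, I6, G 0 3), (I5, I3, G 0 (-3)), (I5, I4, G 3 0), (I6, I3, G (-3) 0), (I6, I4, G 0 (-3))] [] [],
    GE
    [(I0, I5, G 0 (-2)), (I0, I6, G (-2) 0), (I1, I3, G (-1) 0), (I1, I4, G 0 (-1)), (I2, I3, G 0 (-1)), (I2,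
    I4, G 1 0), (I3, I1, G 1 0), (I3, I2, G 0 1), (I4, I1, G 0 1), (I4, I2, G (-1) 0), (I5, I0, G 0 2), (I6,
    I0, G 2 0)] [] [],
    GE [(I0, I1, G 2 0), (I0, I2, G 0 2), (I1, I0, G (-2) 0), (I2, I0, G 0 (-2)), (I3, I5, G
    0 1), (I3, I6, G 1 0), (I4, I5, G 1 0), (I4, I6, G 0 (-1)), (I5, I3, G 0 (-1)), (I5, I4, G (-1) 0), (I6,
    I3, G (-1) 0), (I6, I4, G 0 1)] [] [],
    GE [(I0, I3, G 2 0), (I0, I4, G 0 2), (I1, I5, G 0 (-1)), (I1, I6, G
    (-1) 0), (I2, I5, G (-1) 0), (I2, I6, G 0 1), (I3, I0, G (-2) 0), (I4, I0, G 0 (-2)), (I5, I1, G 0 1), (I5,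
    I2, G 1 0), (I6, I1, G 1 0), (I6, I2, G 0 (-1))] [] [],
    GE [(I1, I3, G (-3) 0), (I1, I4, G 0 3), (I2, I3, G
    0 (-3)), (I2, I4, G (-3) 0), (I3, I1, G 3 0), (I3, I2, G 0 3), (I4, I1, G 0 (-3)), (I4, I2, G 3 0)] []
    [],
    GE [] [(L0, L1, G 1 0)] [],
    GE [(I1, I2, G 0 1), (I2, I1, G 0 (-1)), (I5, I6, G 0 (-1)), (I6, I5, G 0
    1)] [] [],
    GE [(I3, I4, G 0 1), (I4, I3, G 0 (-1)), (I5, I6, G 0 (-1)), (I6, I5, G 0 1)] [(L0, L0, G 1 0),
    (L1, L1, G (-1) 0)] [],
    GE [] [(L0, L0, G (-1) 0), (L1, L1, G 1 0)] [],
    GE [] [(L1, L0, G (-1) 0)] [],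
    GE
    [(I1, I3, G (-3) 0), (I1, I4, G 0 (-3)), (I2, I3, G 0 3), (I2, I4, G (-3) 0), (I3, I1, G 3 0), (I3, I2, G 0
    (-3)), (I4, I1, G 0 3), (I4, I2, G 3 0)] [] [],
    GE [(I0, I3, G (-2) 0), (I0, I4, G 0 2), (I1, I5, G 0
    (-1)), (I1, I6, G 1 0), (I2, I5, G 1 0), (I2, I6, G 0 1), (I3, I0, G 2 0), (I4, I0, G 0 (-2)), (I5, I1, G 0
    1), (I5, I2, G (-1) 0), (I6, I1, G (-1) 0), (I6, I2, G 0 (-1))] [] [],
    GE [(I0, I1, G (-2) 0), (I0, I2, G 0
    2), (I1, I0, G 2 0), (I2, I0, G 0 (-2)), (I3, I5, G 0 1), (I3, I6, G (-1) 0), (I4, I5, G (-1) 0), (I4, I6,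
    G 0 (-1)), (I5, I3, G 0 (-1)), (I5, I4, G 1 0), (I6, I3, G 1 0), (I6, I4, G 0 1)] [] [],
    GE [(I0, I5, G 0
    2), (I0, I6, G (-2) 0), (I1, I3, G (-1) 0), (I1, I4, G 0 1), (I2, I3, G 0 1), (I2, I4, G 1 0), (I3, I1, G 1
    0), (I3, I2, G 0 (-1)), (I4, I1, G 0 (-1)), (I4, I2, G (-1) 0), (I5, I0, G 0 (-2)), (I6, I0, G 2 0)] []
    [],
    GE [(I3, I5, G 0 3), (I3, I6, G (-3) 0), (I4, I5, G 3 0), (I4, I6, G 0 3), (I5, I3, G 0 (-3)), (I5, I4,
    G (-3) 0), (I6, I3, G 3 0), (I6, I4, G 0 (-3))] [] [],
    GE [(I1, I5, G 0 3), (I1, I6, G (-3) 0), (I2, I5, G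
    3 0), (I2, I6, G 0 3), (I5, I1, G 0 (-3)), (I5, I2, G (-3) 0), (I6, I1, G 3 0), (I6, I2, G 0 (-3))] []
    [],
    GE [] [] [(I5, L0, G 1 0), (I6, L0, G 0 (-1))],
    GE [] [] [(I5, L1, G (-1) 0), (I6, L1, G 0 1)],
    GE []
    [] [(I1, L0, G 0 (-1)), (I2, L0, G 1 0)],
    GE [] [] [(I1, L1, G 0 (-1)), (I2, L1, G 1 0)],
    GE [] [] [(I3,
    L0, G 0 1), (I4, L0, G (-1) 0)],
    GE [] [] [(I3, L1, G 0 (-1)), (I4, L1, G 1 0)],
    GE [] [] [(I0, L0, G 0
    1)],
    GE [] [] [(I0, L1, G 0 1)],
    GE [] [] [(I3, L0, G 0 1), (I4, L0, G 1 0)],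
    GE [] [] [(I3, L1, G 0 (-1)),
    (I4, L1, G (-1) 0)],
    GE [] [] [(I1, L0, G 0 1), (I2, L0, G 1 0)],
    GE [] [] [(I1, L1, G 0 1), (I2, L1, G 1
    0)],
    GE [] [] [(I5, L0, G 1 0), (I6, L0, G 0 1)],
    GE [] [] [(I5, L1, G (-1) 0), (I6, L1, G 0 (-1))]]"

fun growc where
  "growc H X Ys [] = True"
| "growc H X (Y # Ys) (L # Ls) \<longleftrightarrow> gzero (gsadd (-1) (gbr2 X Y) (glc H L)) \<and> growc H X Ys Ls"
| "growc H X [] (L # Ls) = False"
fun gtabc where
  "gtabc H Xs [] = True"
| "gtabc H (X # Xs) (R # Rs) \<longleftrightarrow> growc H X (X # Xs) R \<and> gtabc H Xs Rs"
| "gtabc H [] (R # Rs) = False"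

lemma gtab_check: "gtabc BL BL stab"
  by code_simp

section \<open>Structure constants of the matrix model\<close>

abbreviation Bv :: "nat \<Rightarrow> g3" where "Bv k \<equiv> gsem (BL ! k)"

lemma g3_scale_linear: "g3_scale c (x + y) = g3_scale c x + g3_scale c y" "g3_scale (a + b) x = g3_scale a x + g3_scale b x"
  "g3_scale a (g3_scale b x) = g3_scale (a * b) x" "g3_scale 1 x = x" "g3_scale 0 x = 0" "g3_scale c 0 = 0"
  by (simp_all add: g3_scale_def msc_simps prod_eq_iff)

lemma g3_scale_sum: "g3_scale c (\<Sum>a\<in>A. x a) = (\<Sum>a\<in>A. g3_scale c (x a))"
  by (induction A rule: infinite_finite_induct) (simp_all add: g3_scale_linear)

definition gl :: "(nat \<Rightarrow> complex) \<Rightarrow> g3" where "gl c = (\<Sum>k<31. g3_scale (c k) (Bv k))"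

lemma gl_linear: "gl (\<lambda>k. a * c k + e k) = g3_scale a (gl c) + gl e"
  by (simp add: gl_def g3_scale_sum g3_scale_linear sum.distrib)

lemma gsem_glc: "\<forall>(c, m)\<in>set L. m < 31 \<Longrightarrow> gsem (glc BL L) = g3_scale 2 (gl (\<lambda>m. of_int (cf m L)))"
proof (induction L)
  case Nil
  then show ?case by (simp add: gl_def cf_def g3_scale_linear flip: zero_prod_def)
next
  case (Cons x L)
  obtain c i where x: "x = (c, i)" by (cases x)
  have "gl (\<lambda>m. of_int (cf m (x # L))) = gl (\<lambda>m. of_int c * (if m = i then 1 else 0) + of_int (cf m L))"
    by (rule arg_cong[where f = gl]) (auto simp: x cf_def)
  also have "\<dots> = g3_scale (of_int c) (gl (\<lambda>m. if m = i then 1 else 0)) + gl (\<lambda>m. of_int (cf m L))"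
    by (rule gl_linear)
  also have "gl (\<lambda>m. if m = i then 1 else 0) = Bv i"
  proof -
    have "gl (\<lambda>m. if m = i then 1 else 0) = (\<Sum>k<31. if k = i then Bv i else 0)"
      unfolding gl_def by (rule sum.cong) (auto simp: g3_scale_linear)
    then show ?thesis using Cons.prems by (simp add: x)
  qed
  finally show ?case using Cons by (simp add: x gsem_gsadd g3_scale_linear)
qed

lemma growc_sound:
  assumes "growc H X Ys Ls" "l < length Ls"
  shows "gsem (glc H (Ls ! l)) = g3_scale 2 (g3_bracket (gsem X) (gsem (Ys ! l)))"
  using assms
proof (induction H X Ys Ls arbitrary: l rule: growc.induct)
  case (2 H X Y Ys L Ls)
  show ?case
  proof (cases l)
    case 0
    have "gzero (gsadd (-1) (gbr2 X Y) (glc H L))" using 2 by simp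
    from gzero_sound[OF this] have "g3_scale (-1) (g3_scale 2 (g3_bracket (gsem X) (gsem Y))) + gsem (glc H L) = 0"
      by (simp only: gsem_gsadd gsem_gbr2) simp
    moreover have "g3_scale (-1) x = - x" for x by (simp add: g3_scale_def prod_eq_iff msc_neg[of 1, simplified] msc_simps)
    ultimately show ?thesis using 0 by simp
  next
    case (Suc n)
    then show ?thesis using 2 by simp
  qed
qed simp_all

lemma gtabc_sound:
  assumes "gtabc H Xs Rs" "k < length Rs" "l < length (Rs ! k)"
  shows "gsem (glc H (Rs ! k ! l)) = g3_scale 2 (g3_bracket (gsem (Xs ! k)) (gsem (Xs ! (k + l))))"
  using assms
proof (induction H Xs Rs arbitrary: k rule: gtabc.induct)
  case (2 H X Xs R Rs)
  show ?case
  proof (cases k)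
    case 0
    then show ?thesis using 2 growc_sound[of H X "X # Xs" R l] by simp
  next
    case (Suc n)
    then show ?thesis using 2 by simp
  qed
qed simp_all

fun geo :: "bool \<Rightarrow> gel \<Rightarrow> bool" where
  "geo True (GE A B N) \<longleftrightarrow> A = [] \<and> B = []" | "geo False (GE A B N) \<longleftrightarrow> N = []"

lemma BL_parity: "length BL = 31" "list_all (\<lambda>k. geo (spar ! k) (BL ! k)) [0..<31]"
  by code_simp+

lemma geo_sound: "geo True x \<Longrightarrow> g3_odd (gsem x)" "geo False x \<Longrightarrow> g3_even (gsem x)"
  by (cases x; simp add: g3_odd_def g3_even_def)+

lemma Bv_parity: "k < 31 \<Longrightarrow> if spar ! k then g3_odd (Bv k) else g3_even (Bv k)"
  using BL_parity(2) geo_sound unfolding list_all_upt by (cases "spar ! k") auto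

lemma zero_mats: "g2proj 0 = 0" "transpose (0 :: complex^'n^'m) = 0"
  using g2proj_linear(2)[of 0 0] by (simp_all add: msc_simps vec_eq_iff transpose_def)

lemma g3_skew:
  assumes "if p then g3_odd x else g3_even x" "if q then g3_odd y else g3_even y"
  shows "g3_bracket y x = g3_scale (- sg (p \<and> q)) (g3_bracket x y)"
proof -
  obtain A B N A' B' N' where xy: "x = (A, B, N)" "y = (A', B', N')" by (metis prod.exhaust)
  show ?thesis using assms
    by (cases p; cases q) (simp_all add: xy g3_odd_def g3_even_def g3_bracket_def g3_act_def g3_scale_def
        matrix_distrib zero_mats msc_simps msc_neg add.commute)
qed

lemma g3_bracket_add: "g3_bracket (x + y) z = g3_bracket x z + g3_bracket y z"
  "g3_bracket z (x + y) = g3_bracket z x + g3_bracket z y"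
  by (cases x; cases y; cases z; simp add: g3_bracket_def g3_act_def matrix_distrib msc_mult msc_simps g2proj_linear)+

lemma g3_bracket_scale: "g3_bracket (g3_scale c x) z = g3_scale c (g3_bracket x z)"
  "g3_bracket z (g3_scale c x) = g3_scale c (g3_bracket z x)"
proof -
  have c: "msc a (msc b A) = msc b (msc a A)" for a b and A :: "complex^'n^'m"
    by (simp add: msc_simps mult.commute)
  have l: "msc c (A - B) = msc c A - msc c B" "msc c A + msc c B = msc c (A + B)" for A B :: "complex^'n^'m"
    by (simp_all add: msc_simps)
  show "g3_bracket (g3_scale c x) z = g3_scale c (g3_bracket x z)" "g3_bracket z (g3_scale c x) = g3_scale c (g3_bracket z x)"
    by (cases x; cases z; simp add: g3_bracket_def g3_act_def g3_scale_def msc_mult l c[of _ c] g2proj_linear; simp add: msc_simps)+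
qed

lemma g3_bracket_zero: "g3_bracket 0 x = 0" "g3_bracket x 0 = 0"
  using g3_bracket_scale(1)[of 0 0 x] g3_bracket_scale(2)[of x 0 0] by (simp_all add: g3_scale_linear)

lemma g3_bracket_sum: "g3_bracket (\<Sum>a\<in>A. x a) z = (\<Sum>a\<in>A. g3_bracket (x a) z)"
  "g3_bracket z (\<Sum>a\<in>A. x a) = (\<Sum>a\<in>A. g3_bracket z (x a))"
  by (induction A rule: infinite_finite_induct) (simp_all add: g3_bracket_add g3_bracket_zero)

text \<open>The constants are those of the symmetries in \<open>brk_Sv\<close>. Only the pairs with
  k at most l are computed; g3_skew supplies the rest by parity.\<close>

lemma Bv_bracket:
  assumes "k < 31" "l < 31"
  shows "g3_bracket (Bv k) (Bv l) = gl (sc k l)"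
proof -
  have *: "g3_bracket (Bv k) (Bv l) = gl (\<lambda>m. of_int (cf m (stab ! k ! (l - k))))" if h: "k < 31" "l < 31" "k \<le> l" for k l
  proof -
    have "gsem (glc BL (stab ! k ! (l - k))) = g3_scale 2 (g3_bracket (Bv k) (Bv l))"
      using gtabc_sound[OF gtab_check, of k "l - k"] h lengths(4) by (simp add: length_stab)
    then have "g3_scale 2 (gl (\<lambda>m. of_int (cf m (stab ! k ! (l - k))))) = g3_scale 2 (g3_bracket (Bv k) (Bv l))"
      using gsem_glc[OF stab_less[OF h(1,3,2)]] by simp
    from arg_cong[OF this, of "g3_scale (1/2)"] show ?thesis by (simp add: g3_scale_linear)
  qed
  show ?thesis
  proof (cases "k \<le> l")
    case True
    then show ?thesis using *[OF assms] by (simp add: gl_def sc_def)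
  next
    case False
    have "g3_bracket (Bv k) (Bv l) = g3_scale (- sg (spar ! l \<and> spar ! k)) (g3_bracket (Bv l) (Bv k))"
      using g3_skew[OF Bv_parity Bv_parity] assms by blast
    then show ?thesis using *[of l k] False assms
      by (simp add: gl_def sc_def g3_scale_sum g3_scale_linear conj_commute)
  qed
qed

subsection \<open>A basis of the carrier\<close>

text \<open>The infinitesimal change of the three-form under A, evaluated on the basis vectors with
  indices a, b, c.\<close>

definition geq :: "complex^7^7 \<Rightarrow> 7 \<Rightarrow> 7 \<Rightarrow> 7 \<Rightarrow> complex" where
  "geq A a b c = (\<Sum>i\<in>UNIV. phi i b c * A $ i $ a + phi a i c * A $ i $ b + phi a b i * A $ i $ c)"

lemma sum_axis: "(\<Sum>k\<in>UNIV. h k * axis c 1 $ k) = h c" for h :: "7 \<Rightarrow> complex"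
proof -
  have "(\<Sum>k\<in>UNIV. h k * axis c 1 $ k) = (\<Sum>k\<in>UNIV. if k = c then h c else 0)"
    by (rule sum.cong) (auto simp: axis_def)
  then show ?thesis by simp
qed

lemma phiF_axis: "phiF x (axis b 1) (axis c 1) = (\<Sum>i\<in>UNIV. phi i b c * x $ i)"
  "phiF (axis a 1) x (axis c 1) = (\<Sum>i\<in>UNIV. phi a i c * x $ i)"
  "phiF (axis a 1) (axis b 1) x = (\<Sum>i\<in>UNIV. phi a b i * x $ i)"
proof -
  show "phiF x (axis b 1) (axis c 1) = (\<Sum>i\<in>UNIV. phi i b c * x $ i)"
    unfolding phiF_def sum_axis ..
  have "(\<Sum>j\<in>UNIV. phi i j c * axis a 1 $ i * x $ j) = (\<Sum>j\<in>UNIV. phi i j c * x $ j) * axis a 1 $ i" for i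
    by (simp add: sum_distrib_left sum_distrib_right mult_ac)
  then show "phiF (axis a 1) x (axis c 1) = (\<Sum>i\<in>UNIV. phi a i c * x $ i)"
    unfolding phiF_def sum_axis by (simp only: sum_axis)
  have "(\<Sum>k\<in>UNIV. phi i j k * axis a 1 $ i * axis b 1 $ j * x $ k) =
      (\<Sum>k\<in>UNIV. phi i j k * x $ k) * axis a 1 $ i * axis b 1 $ j" for i j
    by (simp add: sum_distrib_left sum_distrib_right mult_ac)
  then have "phiF (axis a 1) (axis b 1) x = (\<Sum>i\<in>UNIV. (\<Sum>k\<in>UNIV. phi i b k * x $ k) * axis a 1 $ i)"
    unfolding phiF_def by (simp only: sum_axis)
  then show "phiF (axis a 1) (axis b 1) x = (\<Sum>i\<in>UNIV. phi a b i * x $ i)"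
    by (simp only: sum_axis)
qed

lemma mat_axis: "(A *v axis a 1) $ i = A $ i $ (a :: 7)" for A :: "complex^7^7"
  by (simp add: matrix_vector_mult_def sum_axis)

lemma phiF_mat:
  fixes u v w :: "complex^7"
  defines "T \<equiv> \<lambda>f. \<Sum>a\<in>UNIV. \<Sum>b\<in>UNIV. \<Sum>c\<in>UNIV. u $ a * v $ b * w $ c * f a b c"
  shows "phiF (A *v u) v w = T (\<lambda>a b c. \<Sum>i\<in>UNIV. phi i b c * A $ i $ a)" (is ?P)
    and "phiF u (A *v v) w = T (\<lambda>a b c. \<Sum>i\<in>UNIV. phi a i c * A $ i $ b)" (is ?Q)
    and "phiF u v (A *v w) = T (\<lambda>a b c. \<Sum>i\<in>UNIV. phi a b i * A $ i $ c)" (is ?R)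
proof -
  note s = phiF_def matrix_vector_mult_def sum_distrib_left sum_distrib_right mult_ac
  let ?t = "\<lambda>a b c x. u $ a * v $ b * w $ c * x"
  have "phiF (A *v u) v w = (\<Sum>i\<in>UNIV. \<Sum>b\<in>UNIV. \<Sum>c\<in>UNIV. \<Sum>a\<in>UNIV. ?t a b c (phi i b c * A $ i $ a))"
    by (simp add: s)
  also have "\<dots> = (\<Sum>b\<in>UNIV. \<Sum>c\<in>UNIV. \<Sum>a\<in>UNIV. \<Sum>i\<in>UNIV. ?t a b c (phi i b c * A $ i $ a))"
    by (subst sum.swap, rule sum.cong[OF refl], subst sum.swap, rule sum.cong[OF refl], rule sum.swap)
  also have "\<dots> = (\<Sum>b\<in>UNIV. \<Sum>a\<in>UNIV. \<Sum>c\<in>UNIV. \<Sum>i\<in>UNIV. ?t a b c (phi i b c * A $ i $ a))"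
    by (rule sum.cong[OF refl], rule sum.swap)
  also have "\<dots> = (\<Sum>a\<in>UNIV. \<Sum>b\<in>UNIV. \<Sum>c\<in>UNIV. \<Sum>i\<in>UNIV. ?t a b c (phi i b c * A $ i $ a))"
    by (rule sum.swap)
  finally show ?P by (simp add: T_def sum_distrib_left)
  have "phiF u (A *v v) w = (\<Sum>a\<in>UNIV. \<Sum>i\<in>UNIV. \<Sum>c\<in>UNIV. \<Sum>b\<in>UNIV. ?t a b c (phi a i c * A $ i $ b))"
    by (simp add: s)
  also have "\<dots> = (\<Sum>a\<in>UNIV. \<Sum>c\<in>UNIV. \<Sum>b\<in>UNIV. \<Sum>i\<in>UNIV. ?t a b c (phi a i c * A $ i $ b))"
    by (rule sum.cong[OF refl], subst sum.swap, rule sum.cong[OF refl], rule sum.swap)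
  also have "\<dots> = (\<Sum>a\<in>UNIV. \<Sum>b\<in>UNIV. \<Sum>c\<in>UNIV. \<Sum>i\<in>UNIV. ?t a b c (phi a i c * A $ i $ b))"
    by (rule sum.cong[OF refl], rule sum.swap)
  finally show ?Q by (simp add: T_def sum_distrib_left)
  have "phiF u v (A *v w) = (\<Sum>a\<in>UNIV. \<Sum>b\<in>UNIV. \<Sum>i\<in>UNIV. \<Sum>c\<in>UNIV. ?t a b c (phi a b i * A $ i $ c))"
    by (simp add: s)
  also have "\<dots> = (\<Sum>a\<in>UNIV. \<Sum>b\<in>UNIV. \<Sum>c\<in>UNIV. \<Sum>i\<in>UNIV. ?t a b c (phi a b i * A $ i $ c))"
    by (rule sum.cong[OF refl], rule sum.cong[OF refl], rule sum.swap)
  finally show ?R by (simp add: T_def sum_distrib_left)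
qed

text \<open>By trilinearity the invariance condition need only be tested on basis vectors, which
  makes it a finite system of linear equations in the entries of A.\<close>

lemma g2set_iff: "A \<in> g2set \<longleftrightarrow> (\<forall>a b c. geq A a b c = 0)"
proof
  assume A: "A \<in> g2set"
  have "geq A a b c = phiF (A *v axis a 1) (axis b 1) (axis c 1) + phiF (axis a 1) (A *v axis b 1) (axis c 1)
      + phiF (axis a 1) (axis b 1) (A *v axis c 1)" for a b c
    by (simp add: phiF_axis mat_axis geq_def sum.distrib)
  then show "\<forall>a b c. geq A a b c = 0" using A by (simp add: g2set_def)
next
  assume A: "\<forall>a b c. geq A a b c = 0"
  have "phiF (A *v u) v w + phiF u (A *v v) w + phiF u v (A *v w) =
     (\<Sum>a\<in>UNIV. \<Sum>b\<in>UNIV. \<Sum>c\<in>UNIV. u $ a * v $ b * w $ c * geq A a b c)" for u v w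
    by (simp add: phiF_mat geq_def sum.distrib distrib_left)
  then show "A \<in> g2set" using A by (simp add: g2set_def)
qed

lemma geq_linear: "geq (A + B) a b c = geq A a b c + geq B a b c" "geq (msc k A) a b c = k * geq A a b c" "geq 0 a b c = 0"
  by (simp_all add: geq_def msc_def algebra_simps sum.distrib sum_distrib_left)

fun e1 where "e1 True k z = gsc k z" | "e1 False k z = G 0 0"
fun e2 where "e2 True i b c z = gsc (pt i b c) z" | "e2 False i b c z = G 0 0"
fun eqv :: "(i7 \<times> i7 \<times> gi) list \<Rightarrow> i7 \<Rightarrow> i7 \<Rightarrow> i7 \<Rightarrow> gi" where
  "eqv [] a b c = G 0 0"
| "eqv ((i, u, z) # L) a b c = gadd (gadd (e2 (u = a) i b c z) (gadd (e2 (u = b) a i c z) (e2 (u = c) a b i z))) (eqv L a b c)"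

lemma gc_e2: "gc (e2 p i b c z) = (if p then phi (t7 i) (t7 b) (t7 c) * gc z else 0)"
  by (cases p) (simp_all add: gc_simps phi_pt del: pt.simps)

lemma gc_eqv: "gc (eqv L a b c) = geq (smx t7 t7 L) (t7 a) (t7 b) (t7 c)"
proof (induction L)
  case (Cons x L)
  obtain i u z where x: "x = (i, u, z)" by (cases x)
  have s: "(\<Sum>j\<in>UNIV. f j * (if j = t7 i \<and> P then w else 0)) = (if P then f (t7 i) * w else 0)" for f P and w :: complex
    by (cases P) (simp_all add: if_distrib cong: if_cong)
  have "geq (un (t7 i) (t7 u) (gc z)) (t7 a) (t7 b) (t7 c) =
      gc (e2 (u = a) i b c z) + (gc (e2 (u = b) a i c z) + gc (e2 (u = c) a b i z))"
    by (simp add: geq_def un_def sum.distrib s gc_e2 t7_eq eq_commute[of _ u])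
  then show ?case using Cons by (simp add: x geq_linear gc_simps)
qed (simp add: geq_linear)

fun gA where "gA (GE A B N) = A"
fun gtr :: "(i2 \<times> i2 \<times> gi) list \<Rightarrow> gi" where "gtr [] = G 0 0" | "gtr ((a, b, z) # L) = gadd (e1 (a = b) 1 z) (gtr L)"
fun gtrc where "gtrc (GE A B N) \<longleftrightarrow> gtr B = G 0 0"

fun eqc3 where "eqc3 [] L a b = True" | "eqc3 (c # cs) L a b \<longleftrightarrow> eqv L a b c = G 0 0 \<and> eqc3 cs L a b"
fun eqc2 where "eqc2 I [] L a = True" | "eqc2 I (b # bs) L a \<longleftrightarrow> eqc3 I L a b \<and> eqc2 I bs L a"
fun eqc1 where "eqc1 I [] L = True" | "eqc1 I (a # as) L \<longleftrightarrow> eqc2 I I L a \<and> eqc1 I as L"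
fun eqc where "eqc [] = True" | "eqc (X # Xs) \<longleftrightarrow> gtrc X \<and> eqc1 i7s i7s (gA X) \<and> eqc Xs"

lemma eqc_check: "eqc BL"
  by code_simp

lemma eqc_sound: "eqc Xs \<Longrightarrow> X \<in> set Xs \<Longrightarrow> gtrc X \<and> (\<forall>a b c. eqv (gA X) a b c = G 0 0)"
proof -
  have 3: "eqc3 I L a b \<Longrightarrow> list_all (\<lambda>c. eqv L a b c = G 0 0) I" for I L a b by (induction I) simp_all
  have 2: "eqc2 I J L a \<Longrightarrow> list_all (\<lambda>b. eqc3 I L a b) J" for I J L a by (induction J) simp_all
  have 1: "eqc1 I J L \<Longrightarrow> list_all (\<lambda>a. eqc2 I I L a) J" for I J L by (induction J) simp_all
  assume "eqc Xs" "X \<in> set Xs"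
  then have "gtrc X \<and> eqc1 i7s i7s (gA X)" by (induction Xs) auto
  then show ?thesis using 1[of i7s i7s "gA X"] 2[of i7s i7s "gA X"] 3[of i7s "gA X"] unfolding list_all_i7s by blast
qed

lemma trace_2: "trace A = A $ t2 L0 $ t2 L0 + A $ t2 L1 $ t2 L1" for A :: "complex^2^2"
  unfolding trace_def UNIV_2 by simp

lemma Bv_carrier: "k < 31 \<Longrightarrow> Bv k \<in> g3_carrier"
proof -
  assume "k < 31"
  then have "BL ! k \<in> set BL" using BL_parity(1) by simp
  from eqc_sound[OF eqc_check this] have e: "gtrc (BL ! k)" "\<And>a b c. eqv (gA (BL ! k)) a b c = G 0 0" by auto
  obtain A B N where BL: "BL ! k = GE A B N" by (cases "BL ! k")
  have "geq (smx t7 t7 A) (t7 a) (t7 b) (t7 c) = 0" for a b c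
    using e(2)[of a b c] gc_eqv[of A a b c] BL by simp
  then have "smx t7 t7 A \<in> g2set" unfolding g2set_iff all_t7 by blast
  moreover have "gc (gtr B) = trace (smx t2 t2 B)"
  proof (induction B)
    case (Cons x B)
    obtain a b z where x: "x = (a, b, z)" by (cases x)
    show ?case using Cons
      by (cases a; cases b) (simp_all add: x gc_simps trace_2 un_def)
  qed (simp add: trace_2)
  ultimately show ?thesis using e(1) by (simp add: g3_carrier_def BL)
qed

lemma trace_msc: "trace (msc c A) = c * trace A" for A :: "complex^2^2"
  by (simp add: trace_2 msc_def algebra_simps)

lemma g3_carrier_closed: "x \<in> g3_carrier \<Longrightarrow> y \<in> g3_carrier \<Longrightarrow> x + y \<in> g3_carrier"
  "x \<in> g3_carrier \<Longrightarrow> g3_scale c x \<in> g3_carrier" "0 \<in> g3_carrier"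
  by (auto simp: g3_carrier_def g2set_iff geq_linear trace_add trace_msc g3_scale_simp zero_prod_def trace_def[of 0])

lemma gl_carrier: "gl c \<in> g3_carrier"
proof -
  have "(\<Sum>k\<in>A. g3_scale (c k) (Bv k)) \<in> g3_carrier" if "A \<subseteq> {..<31}" for A
    using finite_subset[OF that] that
    by (induction A rule: finite_induct) (auto intro!: g3_carrier_closed Bv_carrier)
  then show ?thesis by (simp add: gl_def)
qed

section \<open>Dual functionals and coordinates on the carrier\<close>

fun prs :: "('a \<Rightarrow> 'r) \<Rightarrow> ('b \<Rightarrow> 'c) \<Rightarrow> ('a \<times> 'b \<times> gi) list \<Rightarrow> complex^'c^'r \<Rightarrow> complex" where
  "prs r c [] A = 0" | "prs r c ((a, b, z) # L) A = gc z * A $ r a $ c b + prs r c L A"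

text \<open>An element in sparse form is read here as a linear functional, by the bilinear pairing
  of matrix entries without conjugation.\<close>

fun lamf :: "gel \<Rightarrow> g3 \<Rightarrow> complex" where
  "lamf (GE A B N) (X, Y, Z) = prs t7 t7 A X + prs t2 t2 B Y + prs t7 t2 N Z"

fun ent where "ent a b [] = G 0 0" | "ent a b ((a', b', z) # L) = gadd (e1 (a = a' \<and> b = b') 1 z) (ent a b L)"
fun pair where "pair [] L = G 0 0" | "pair ((a, b, z) # K) L = gadd (gmul z (ent a b L)) (pair K L)"
fun gpair where "gpair (GE A B N) (GE A' B' N') = gadd (pair A A') (gadd (pair B B') (pair N N'))"

lemma gc_ent: "inj r \<Longrightarrow> inj c \<Longrightarrow> gc (ent a b L) = smx r c L $ r a $ c b"
proof (induction L)
  case (Cons x L)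
  obtain a' b' z where x: "x = (a', b', z)" by (cases x)
  have "r a = r a' \<longleftrightarrow> a = a'" "c b = c b' \<longleftrightarrow> b = b'" using Cons.prems by (auto dest: injD)
  moreover have "gc (e1 p 1 z) = (if p then gc z else 0)" for p by (cases p) (simp_all add: gc_simps)
  ultimately show ?case using Cons by (simp add: x gc_simps un_def)
qed simp

lemma gc_pair: "inj r \<Longrightarrow> inj c \<Longrightarrow> gc (pair K L) = prs r c K (smx r c L)"
  by (induction K L rule: pair.induct) (simp_all add: gc_simps gc_ent)

lemma gc_gpair: "gc (gpair X Y) = lamf X (gsem Y)"
  by (cases X; cases Y) (simp add: gc_simps gc_pair[OF inj_t(1) inj_t(1)] gc_pair[OF inj_t(2) inj_t(2)]
      gc_pair[OF inj_t(1) inj_t(2)] add.assoc)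

lemma lamf_linear: "lamf L (x + y) = lamf L x + lamf L y" "lamf L (g3_scale k x) = k * lamf L x"
proof -
  have p: "prs r c L (A + B) = prs r c L A + prs r c L B" "prs r c L (msc k A) = k * prs r c L A" for r c L A B
    by (induction r c L A rule: prs.induct) (simp_all add: algebra_simps msc_def)
  show "lamf L (x + y) = lamf L x + lamf L y" "lamf L (g3_scale k x) = k * lamf L x"
    by (cases L; cases x; cases y; simp add: p g3_scale_simp algebra_simps)+
qed

text \<open>Dual basis of BL, up to the factors in LK.\<close>

definition LL :: "gel list" where
  "LL = [
    GE [(I0, I4, G 0 (-1)), (I1, I5, G 0 (-2)), (I0, I3, G 1 0), (I1, I6, G 2 0)] [] [],
    GE [(I0, I2, G 0 1),
    (I3, I5, G 0 (-2)), (I0, I1, G (-1) 0), (I3, I6, G 2 0)] [] [],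
    GE [(I0, I6, G (-1) 0), (I0, I5, G 0 1)] []
    [],
    GE [(I0, I2, G 0 (-1)), (I0, I1, G 1 0)] [] [],
    GE [(I0, I4, G 0 (-1)), (I0, I3, G 1 0)] [] [],
    GE
    [(I0, I6, G 1 0), (I1, I3, G (-2) 0), (I0, I5, G 0 1), (I1, I4, G 0 (-2))] [] [],
    GE [] [(L0, L1, G 1 0)]
    [],
    GE [(I1, I2, G 0 (-1))] [] [],
    GE [(I3, I4, G 0 (-1))] [] [],
    GE [(I3, I4, G 0 (-1))] [(L0, L0, G (-1)
    0)] [],
    GE [] [(L1, L0, G (-1) 0)] [],
    GE [(I0, I6, G 1 0), (I1, I3, G (-2) 0), (I0, I5, G 0 (-1)), (I1,
    I4, G 0 2)] [] [],
    GE [(I0, I4, G 0 (-1)), (I0, I3, G (-1) 0)] [] [],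
    GE [(I0, I2, G 0 (-1)), (I0, I1, G
    (-1) 0)] [] [],
    GE [(I0, I6, G (-1) 0), (I0, I5, G 0 (-1))] [] [],
    GE [(I0, I2, G 0 1), (I3, I5, G 0 (-2)),
    (I0, I1, G 1 0), (I3, I6, G (-2) 0)] [] [],
    GE [(I0, I4, G 0 (-1)), (I1, I5, G 0 (-2)), (I0, I3, G (-1) 0),
    (I1, I6, G (-2) 0)] [] [],
    GE [] [] [(I5, L0, G 1 0), (I6, L0, G 0 1)],
    GE [] [] [(I5, L1, G (-1) 0), (I6,
    L1, G 0 (-1))],
    GE [] [] [(I1, L0, G 0 1), (I2, L0, G 1 0)],
    GE [] [] [(I1, L1, G 0 1), (I2, L1, G 1
    0)],
    GE [] [] [(I3, L0, G 0 (-1)), (I4, L0, G (-1) 0)],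
    GE [] [] [(I3, L1, G 0 1), (I4, L1, G 1 0)],
    GE []
    [] [(I0, L0, G 0 (-1))],
    GE [] [] [(I0, L1, G 0 (-1))],
    GE [] [] [(I3, L0, G 0 (-1)), (I4, L0, G 1 0)],
    GE
    [] [] [(I3, L1, G 0 1), (I4, L1, G (-1) 0)],
    GE [] [] [(I1, L0, G 0 (-1)), (I2, L0, G 1 0)],
    GE [] [] [(I1,
    L1, G 0 (-1)), (I2, L1, G 1 0)],
    GE [] [] [(I5, L0, G 1 0), (I6, L0, G 0 (-1))],
    GE [] [] [(I5, L1, G (-1)
    0), (I6, L1, G 0 1)]]"

definition LK :: "int list" where "LK = [12, 12, 4, 4, 4, 12, 1, 1, 1, 1, 1, 12, 4, 4, 4, 12, 12, 2, 2, 2, 2, 2, 2, 1, 1, 2, 2, 2, 2, 2, 2]"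

fun lamw where "lamw k m X [] n = True"
  | "lamw k m X (Y # Ys) n \<longleftrightarrow> gpair X Y = G (kif (k = m) n) 0 \<and> lamw k (Suc m) X Ys n"
fun lamx where "lamx Bs k (X # Xs) (n # ns) \<longleftrightarrow> lamw k 0 X Bs n \<and> n \<noteq> 0 \<and> lamx Bs (Suc k) Xs ns"
  | "lamx Bs k [] [] = True" | "lamx Bs k [] (n # ns) = False" | "lamx Bs k (X # Xs) [] = False"

lemma lam_check: "lamx BL 0 LL LK" "length LL = 31" "length LK = 31"
  by code_simp+

lemma lamw_sound: "lamw k i X Ys n \<Longrightarrow> m < length Ys \<Longrightarrow> lamf X (gsem (Ys ! m)) = (if k = i + m then of_int n else 0)"
proof (induction Ys arbitrary: i m)
  case (Cons Y Ys)
  show ?case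
  proof (cases m)
    case 0
    then show ?thesis using Cons.prems by (simp add: kif_eq flip: gc_gpair)
  next
    case (Suc m')
    then show ?thesis using Cons.IH[of "Suc i" m'] Cons.prems by simp
  qed
qed simp

lemma lamx_sound: "lamx Bs i Xs ns \<Longrightarrow> k < length Xs \<Longrightarrow> lamw (i + k) 0 (Xs ! k) Bs (ns ! k) \<and> ns ! k \<noteq> 0"
proof (induction Xs arbitrary: i k ns)
  case (Cons X Xs)
  obtain n ns' where ns: "ns = n # ns'" using Cons.prems by (cases ns) auto
  show ?case
  proof (cases k)
    case 0
    then show ?thesis using Cons.prems by (simp add: ns)
  next
    case (Suc k')
    then show ?thesis using Cons.IH[of "Suc i" ns' k'] Cons.prems by (simp add: ns)
  qed
qed simp

lemma lam_Bv: "k < 31 \<Longrightarrow> m < 31 \<Longrightarrow> lamf (LL ! k) (Bv m) = (if k = m then of_int (LK ! k) else 0)"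
  and LK_nonzero: "k < 31 \<Longrightarrow> LK ! k \<noteq> 0"
  using lamx_sound[OF lam_check(1), of k] lamw_sound[of k 0 "LL ! k" BL "LK ! k" m] BL_parity(1) lam_check(2) by auto

definition gcoord :: "nat \<Rightarrow> g3 \<Rightarrow> complex" where "gcoord k x = lamf (LL ! k) x / of_int (LK ! k)"

lemma gcoord_gl: "m < 31 \<Longrightarrow> gcoord m (gl c) = c m"
proof -
  assume m: "m < 31"
  have z: "lamf L 0 = 0" for L using lamf_linear(2)[of L 0 0] by (simp add: g3_scale_linear)
  have "lamf L (\<Sum>k\<in>A. g3_scale (c k) (Bv k)) = (\<Sum>k\<in>A. c k * lamf L (Bv k))" for L A
    by (induction A rule: infinite_finite_induct) (simp_all add: lamf_linear z)
  then have "lamf (LL ! m) (gl c) = (\<Sum>k<31. c k * lamf (LL ! m) (Bv k))"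
    by (simp add: gl_def)
  also have "\<dots> = (\<Sum>k<31. if k = m then c m * of_int (LK ! m) else 0)"
    by (rule sum.cong) (auto simp: lam_Bv m)
  finally have "lamf (LL ! m) (gl c) = (\<Sum>k<31. if k = m then c m * of_int (LK ! m) else 0)" .
  then show ?thesis using m LK_nonzero[OF m] by (simp add: gcoord_def)
qed

lemma geq_t7: "geq A (t7 a) (t7 b) (t7 c) =
   (\<Sum>i\<in>UNIV. of_int (pt i b c) * A $ t7 i $ t7 a + of_int (pt a i c) * A $ t7 i $ t7 b + of_int (pt a b i) * A $ t7 i $ t7 c)"
  unfolding geq_def sum_t7 by (simp only: phi_pt)

lemma sum_i7: "(\<Sum>i\<in>UNIV. f i) = f I0 + f I1 + f I2 + f I3 + f I4 + f I5 + (f I6 :: complex)"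
  unfolding UNIV_i7 by (simp add: add.assoc)

text \<open>The functionals directly annihilate N, the entries of B up to the trace condition, and
  fourteen entries of A. The invariance equations propagate this to the rest of A, which bounds the
  dimension of its part by fourteen.\<close>

lemma g3_eq_0:
  assumes x: "x \<in> g3_carrier" and l: "\<And>k. k < 31 \<Longrightarrow> lamf (LL ! k) x = 0"
  shows "x = 0"
proof -
  obtain A B N where xA: "x = (A, B, N)" by (metis prod.exhaust)
  have "list_all (\<lambda>L. lamf L x = 0) LL" using l lam_check(2) by (simp add: list_all_length)
  then have L: "list_all (\<lambda>L. lamf L (A, B, N) = 0) LL" by (simp add: xA)
  have z: "geq A (t7 a) (t7 b) (t7 c) = 0" for a b c using x by (simp add: xA g3_carrier_def g2set_iff)
  have tr: "B $ t2 L0 $ t2 L0 + B $ t2 L1 $ t2 L1 = 0" using x by (simp add: xA g3_carrier_def trace_2)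
  note l = L[unfolded LL_def list.pred_inject lamf.simps prs.simps gc.simps]
  have B: "B $ t2 L0 $ t2 L1 = 0" "B $ t2 L1 $ t2 L0 = 0" and B0: "B $ t2 L0 $ t2 L0 = 0"
    and N: "N $ t7 I0 $ t2 L0 = 0" "N $ t7 I0 $ t2 L1 = 0" "N $ t7 I1 $ t2 L0 = 0" "N $ t7 I1 $ t2 L1 = 0"
      "N $ t7 I2 $ t2 L0 = 0" "N $ t7 I2 $ t2 L1 = 0" "N $ t7 I3 $ t2 L0 = 0" "N $ t7 I3 $ t2 L1 = 0"
      "N $ t7 I4 $ t2 L0 = 0" "N $ t7 I4 $ t2 L1 = 0" "N $ t7 I5 $ t2 L0 = 0" "N $ t7 I5 $ t2 L1 = 0"
      "N $ t7 I6 $ t2 L0 = 0" "N $ t7 I6 $ t2 L1 = 0"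
    and piv: "A $ t7 I1 $ t7 I2 = 0" "A $ t7 I3 $ t7 I4 = 0" "A $ t7 I0 $ t7 I2 = 0" "A $ t7 I3 $ t7 I5 = 0"
      "A $ t7 I0 $ t7 I1 = 0" "A $ t7 I3 $ t7 I6 = 0" "A $ t7 I0 $ t7 I4 = 0" "A $ t7 I1 $ t7 I5 = 0"
      "A $ t7 I0 $ t7 I3 = 0" "A $ t7 I1 $ t7 I6 = 0" "A $ t7 I0 $ t7 I6 = 0" "A $ t7 I1 $ t7 I3 = 0"
      "A $ t7 I0 $ t7 I5 = 0" "A $ t7 I1 $ t7 I4 = 0"
    using l by (simp_all add: complex_eq_iff del: t7.simps t2.simps)
  have B1: "B $ t2 L1 $ t2 L1 = 0" using tr B0 by simp
  note e = geq_t7 sum_i7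
  \<comment> \<open>Off-diagonal entries fall into seven groups of six, according to the third point
    n of the Fano line through the two indices. Equations for triples that are not lines stay within
    one group; in group n the two entries from \<open>piv\<close> and four such equations determine
    all six, which is the fact \<open>c0\<close> to \<open>c6\<close> with that number.\<close>
  have c0: "A $ t7 I2 $ t7 I1 = 0" "A $ t7 I4 $ t7 I3 = 0" "A $ t7 I5 $ t7 I6 = 0" "A $ t7 I6 $ t7 I5 = 0"
    using z[of I1 I3 I6] z[of I1 I4 I5] z[of I2 I3 I5] z[of I2 I4 I6] piv
    by (simp_all add: e complex_eq_iff del: t7.simps)
  have c1: "A $ t7 I2 $ t7 I0 = 0" "A $ t7 I4 $ t7 I6 = 0" "A $ t7 I5 $ t7 I3 = 0" "A $ t7 I6 $ t7 I4 = 0"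
    using z[of I0 I3 I6] z[of I0 I4 I5] z[of I2 I3 I4] z[of I2 I5 I6] piv
    by (simp_all add: e complex_eq_iff del: t7.simps)
  have c2: "A $ t7 I1 $ t7 I0 = 0" "A $ t7 I4 $ t7 I5 = 0" "A $ t7 I5 $ t7 I4 = 0" "A $ t7 I6 $ t7 I3 = 0"
    using z[of I0 I3 I5] z[of I0 I4 I6] z[of I1 I3 I4] z[of I1 I5 I6] piv
    by (simp_all add: e complex_eq_iff del: t7.simps)
  have c3: "A $ t7 I2 $ t7 I6 = 0" "A $ t7 I4 $ t7 I0 = 0" "A $ t7 I5 $ t7 I1 = 0" "A $ t7 I6 $ t7 I2 = 0"
    using z[of I0 I1 I6] z[of I0 I2 I5] z[of I1 I2 I4] z[of I4 I5 I6] piv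
    by (simp_all add: e complex_eq_iff del: t7.simps)
  have c4: "A $ t7 I2 $ t7 I5 = 0" "A $ t7 I3 $ t7 I0 = 0" "A $ t7 I5 $ t7 I2 = 0" "A $ t7 I6 $ t7 I1 = 0"
    using z[of I0 I1 I5] z[of I0 I2 I6] z[of I1 I2 I3] z[of I3 I5 I6] piv
    by (simp_all add: e complex_eq_iff del: t7.simps)
  have c5: "A $ t7 I2 $ t7 I4 = 0" "A $ t7 I3 $ t7 I1 = 0" "A $ t7 I4 $ t7 I2 = 0" "A $ t7 I6 $ t7 I0 = 0"
    using z[of I0 I1 I4] z[of I0 I2 I3] z[of I1 I2 I6] z[of I3 I4 I6] piv
    by (simp_all add: e complex_eq_iff del: t7.simps)
  have c6: "A $ t7 I2 $ t7 I3 = 0" "A $ t7 I3 $ t7 I2 = 0" "A $ t7 I4 $ t7 I1 = 0" "A $ t7 I5 $ t7 I0 = 0"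
    using z[of I0 I1 I3] z[of I0 I2 I4] z[of I1 I2 I5] z[of I3 I4 I5] piv
    by (simp_all add: e complex_eq_iff del: t7.simps)
  \<comment> \<open>For a triple forming a Fano line the equation says that the three diagonal
    entries at its points sum to zero. The incidence matrix of the Fano plane is invertible over the
    rationals, so the seven lines force all seven entries to vanish.\<close>
  have c7: "A $ t7 I0 $ t7 I0 = 0" "A $ t7 I1 $ t7 I1 = 0" "A $ t7 I2 $ t7 I2 = 0" "A $ t7 I3 $ t7 I3 = 0" "A $ t7 I4 $ t7 I4 = 0" "A $ t7 I5 $ t7 I5 = 0" "A $ t7 I6 $ t7 I6 = 0"
    using z[of I0 I1 I2] z[of I0 I3 I4] z[of I0 I5 I6] z[of I1 I3 I5] z[of I1 I4 I6] z[of I2 I3 I6] z[of I2 I4 I5]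
    by (simp_all add: e complex_eq_iff del: t7.simps)
  have "\<forall>a b. A $ t7 a $ t7 b = 0"
    by (intro allI, rename_tac a b, case_tac a; case_tac b) (simp_all only: c0 c1 c2 c3 c4 c5 c6 c7 piv)
  then have "A = 0" unfolding vec_eq_iff all_t7 by simp
  moreover have "\<forall>a b. B $ t2 a $ t2 b = 0"
    by (intro allI, rename_tac a b, case_tac a; case_tac b) (simp_all only: B B0 B1)
  then have "B = 0" unfolding vec_eq_iff all_t2 by simp
  moreover have "\<forall>a b. N $ t7 a $ t2 b = 0"
    by (intro allI, rename_tac a b, case_tac a; case_tac b) (simp_all only: N)
  then have "N = 0" unfolding vec_eq_iff all_t7 all_t2 by simp
  ultimately show ?thesis by (simp add: xA zero_prod_def)
qed

lemma g3_expand: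
  assumes "x \<in> g3_carrier"
  shows "x = gl (\<lambda>k. gcoord k x)"
proof -
  let ?y = "gl (\<lambda>k. gcoord k x)"
  have m: "g3_scale (-1) y = - y" for y by (simp add: g3_scale_def prod_eq_iff msc_def vec_eq_iff)
  have "x + g3_scale (-1) ?y = 0"
  proof (rule g3_eq_0)
    show "x + g3_scale (- 1) ?y \<in> g3_carrier" using assms by (intro g3_carrier_closed gl_carrier)
    fix k :: nat assume "k < 31"
    then show "lamf (LL ! k) (x + g3_scale (- 1) ?y) = 0"
      using gcoord_gl[of k "\<lambda>k. gcoord k x"] LK_nonzero[of k] by (simp add: lamf_linear gcoord_def)
  qed
  then show ?thesis unfolding m by simp
qed

subsection \<open>The isomorphism\<close>

lemma coord_linear: "vf_ok X \<Longrightarrow> vf_ok Y \<Longrightarrow> coord k (vf_scale c X + Y) = c * coord k X + coord k Y"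
  by (simp add: coord_def jet_add jet_scale add_divide_distrib)

lemma vf_scale_sum: "vf_scale c (\<Sum>a\<in>A. X a) = (\<Sum>a\<in>A. vf_scale c (X a))"
  by (rule vf_eqI) (simp add: cmp_sum sscale_sum)

lemma vf_part_lincomb:
  "vf_part b (\<Sum>k\<in>A. vf_scale (x k) (Sv k)) = (\<Sum>k\<in>A. vf_scale (x k) (vf_part b (Sv k)))"
proof (induction A rule: infinite_finite_induct)
  have "vf_part b 0 = 0" by (rule vf_eqI) (simp add: cmp_vf_part sf_part_def pointwise)
  then show "vf_part b (\<Sum>k\<in>{}. vf_scale (x k) (Sv k)) = (\<Sum>k\<in>{}. vf_scale (x k) (vf_part b (Sv k)))" by simp
  then show "infinite A \<Longrightarrow> vf_part b (\<Sum>k\<in>A. vf_scale (x k) (Sv k)) = (\<Sum>k\<in>A. vf_scale (x k) (vf_part b (Sv k)))" for A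
    by simp
qed (simp add: vf_part_add vf_part_scale)

text \<open>Taking the part of opposite parity kills X but keeps the basis fields of that parity
  together with their coordinates, so independence makes those coordinates zero.\<close>

lemma coord_hom:
  assumes X: "X \<in> shc_sym" "vf_hom b X" and k: "k < 31" "spar ! k \<noteq> b"
  shows "coord k X = 0"
proof -
  have z: "vf_scale c 0 = 0" "vf_scale 0 Y = 0" for c Y by (rule vf_eqI, simp)+
  have "0 = vf_part (\<not> b) X" using vf_part_hom[OF X(2)] by simp
  also have "X = (\<Sum>k<31. vf_scale (coord k X) (Sv k))"
    using sym_expand[OF X(1)] by (simp only: vf_lincomb_sum)
  also have "vf_part (\<not> b) \<dots> = (\<Sum>k<31. vf_scale (coord k X) (vf_part (\<not> b) (Sv k)))"
    by (rule vf_part_lincomb)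
  also have "\<dots> = (\<Sum>k<31. vf_scale (if spar ! k \<noteq> b then coord k X else 0) (Sv k))"
    by (rule sum.cong) (auto simp: vf_part_hom[OF Sv_hom] z)
  finally have "vf_lincomb (\<lambda>k. if spar ! k \<noteq> b then coord k X else 0) Sv 31 = 0"
    by (simp add: vf_lincomb_sum)
  moreover have "coord k 0 = 0" using jet_scale[of 0 k 0] by (simp add: coord_def z)
  ultimately show ?thesis
    using coord_lincomb[OF k(1), of "\<lambda>k. if spar ! k \<noteq> b then coord k X else 0"] k by simp
qed

lemma spar_nth: "k < 31 \<Longrightarrow> spar ! k \<longleftrightarrow> 17 \<le> k"
  by (auto simp: spar_def nth_append)

text \<open>Bilinearity reduces the bracket to the basis fields. The expansion needs no parity
  signs, since \<open>brk\<close> is bilinear over the complex numbers for inhomogeneous fields as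
  well.\<close>

lemma sc_bracket:
  assumes X: "X \<in> shc_sym" and Y: "Y \<in> shc_sym" and m: "m < 31"
  shows "coord m (brk X Y) = (\<Sum>k<31. \<Sum>l<31. coord k X * coord l Y * sc k l m)"
proof -
  have v: "vf_ok (vf_scale c (Sv k))" for c k by simp
  have w: "vf_ok (vf_lincomb c Sv 31)" for c by (simp add: vf_lincomb_sum vf_ok_sum)
  have "brk X Y = brk (\<Sum>k<31. vf_scale (coord k X) (Sv k)) (\<Sum>l<31. vf_scale (coord l Y) (Sv l))"
    using sym_expand[OF X] sym_expand[OF Y] by (simp only: vf_lincomb_sum)
  also have "\<dots> = (\<Sum>k<31. \<Sum>l<31. vf_scale (coord k X * coord l Y) (brk (Sv k) (Sv l)))"
    by (simp add: brk_sum_left brk_sum_right brk_scale_left brk_scale_right vf_scale_sum)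
      (subst sum.swap, simp add: mult.commute)
  also have "\<dots> = (\<Sum>k<31. \<Sum>l<31. vf_scale (coord k X * coord l Y) (vf_lincomb (sc k l) Sv 31))"
    by (intro sum.cong) (auto simp: brk_Sv)
  finally have e: "jet m (brk X Y) = (\<Sum>k<31. \<Sum>l<31. coord k X * coord l Y * jet m (vf_lincomb (sc k l) Sv 31))"
    by (simp add: jet_sum vf_ok_sum w jet_scale)
  have j: "jet m Z = coord m Z * of_int (jn ! m)" for Z using jn_nonzero[OF m] by (simp add: coord_def)
  show ?thesis
    using e jn_nonzero[OF m] coord_lincomb[OF m]
    by (simp add: j flip: mult.assoc sum_distrib_right)
qed

lemma gl_sum: "gl (\<lambda>m. \<Sum>a\<in>A. c a * e a m) = (\<Sum>a\<in>A. g3_scale (c a) (gl (e a)))"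
proof (induction A rule: infinite_finite_induct)
  case (insert a A)
  then show ?case using gl_linear[of "c a" "e a" "\<lambda>m. \<Sum>a\<in>A. c a * e a m"] by simp
qed (simp_all add: gl_def g3_scale_linear)

lemma gl_cong: "(\<And>m. m < 31 \<Longrightarrow> c m = e m) \<Longrightarrow> gl c = gl e"
  by (auto simp: gl_def)

text \<open>The linear map that sends the k-th field of \<open>SL\<close> to the k-th element of
  \<open>BL\<close>.\<close>

definition g3_iso :: "vf \<Rightarrow> g3" where "g3_iso X = gl (\<lambda>k. coord k X)"

lemma g3_iso_bij: "bij_betw g3_iso shc_sym g3_carrier"
proof (rule bij_betwI[where g = "\<lambda>x. vf_lincomb (\<lambda>k. gcoord k x) Sv 31"])
  show "g3_iso \<in> shc_sym \<rightarrow> g3_carrier" by (simp add: g3_iso_def gl_carrier)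
  show "(\<lambda>x. vf_lincomb (\<lambda>k. gcoord k x) Sv 31) \<in> g3_carrier \<rightarrow> shc_sym"
    by (auto intro: lincomb_sym Sv_sym)
  fix X assume X: "X \<in> shc_sym"
  have "vf_lincomb (\<lambda>k. gcoord k (g3_iso X)) Sv 31 = vf_lincomb (\<lambda>k. coord k X) Sv 31"
    by (simp add: vf_lincomb_sum g3_iso_def gcoord_gl)
  then show "vf_lincomb (\<lambda>k. gcoord k (g3_iso X)) Sv 31 = X" using sym_expand[OF X] by simp
next
  fix x assume x: "x \<in> g3_carrier"
  have "g3_iso (vf_lincomb (\<lambda>k. gcoord k x) Sv 31) = gl (\<lambda>k. gcoord k x)"
    unfolding g3_iso_def by (rule gl_cong) (rule coord_lincomb)
  then show "g3_iso (vf_lincomb (\<lambda>k. gcoord k x) Sv 31) = x" using g3_expand[OF x] by simp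
qed

lemma g3_iso_bracket:
  assumes X: "X \<in> shc_sym" and Y: "Y \<in> shc_sym"
  shows "g3_iso (brk X Y) = g3_bracket (g3_iso X) (g3_iso Y)"
proof -
  \<comment> \<open>The factor 1 gives the outer sum the shape \<open>c a * e a m\<close> to which
    \<open>gl_sum\<close> applies.\<close>
  have "g3_iso (brk X Y) = gl (\<lambda>m. \<Sum>k<31. 1 * (\<Sum>l<31. coord k X * coord l Y * sc k l m))"
    unfolding g3_iso_def by (rule gl_cong) (simp add: sc_bracket[OF X Y])
  also have "\<dots> = (\<Sum>k<31. \<Sum>l<31. g3_scale (coord k X * coord l Y) (gl (sc k l)))"
    unfolding gl_sum by (simp add: g3_scale_linear)
  also have "\<dots> = (\<Sum>k<31. \<Sum>l<31. g3_scale (coord k X * coord l Y) (g3_bracket (Bv k) (Bv l)))"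
    by (intro sum.cong) (auto simp: Bv_bracket)
  also have "\<dots> = g3_bracket (g3_iso X) (g3_iso Y)"
    by (simp add: g3_iso_def gl_def g3_bracket_sum g3_bracket_scale g3_scale_linear g3_scale_sum)
      (subst sum.swap, simp add: mult.commute)
  finally show ?thesis .
qed

lemma g3_iso_parity:
  assumes X: "X \<in> shc_sym" "vf_hom b X"
  shows "if b then g3_odd (g3_iso X) else g3_even (g3_iso X)"
proof -
  have s: "if b then g3_odd (\<Sum>k\<in>A. g3_scale (coord k X) (Bv k)) else g3_even (\<Sum>k\<in>A. g3_scale (coord k X) (Bv k))"
    if "finite A" "A \<subseteq> {..<31}" for A
    using that
  proof (induction A rule: finite_induct)
    case (insert k A)
    have "if b then g3_odd (g3_scale (coord k X) (Bv k)) else g3_even (g3_scale (coord k X) (Bv k))"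
    proof (cases "spar ! k = b")
      case True
      then show ?thesis using Bv_parity[of k] insert.prems
        by (auto simp: g3_odd_def g3_even_def g3_scale_def msc_simps)
    next
      case False
      then show ?thesis using coord_hom[OF X, of k] insert.prems
        by (auto simp: g3_odd_def g3_even_def g3_scale_linear)
    qed
    then show ?case using insert by (auto simp: g3_odd_def g3_even_def split: if_splits)
  qed (simp add: g3_odd_def g3_even_def)
  show ?thesis using s[of "{..<31}"] by (simp add: g3_iso_def gl_def)
qed

section \<open>Dimensions of the even and odd parts\<close>

lemma lincomb_block:
  assumes "a + n \<le> 31"
  shows "vf_lincomb c (\<lambda>i. Sv (a + i)) n = vf_lincomb (\<lambda>k. if a \<le> k \<and> k < a + n then c (k - a) else 0) Sv 31"
proof -
  have z: "vf_scale 0 Y = 0" for Y by (rule vf_eqI) simp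
  have "(\<Sum>i<n. vf_scale (c i) (Sv (a + i))) = (\<Sum>k\<in>{a..<a+n}. vf_scale (c (k - a)) (Sv k))"
    by (rule sum.reindex_bij_witness[where i = "\<lambda>k. k - a" and j = "\<lambda>i. a + i"]) auto
  also have "\<dots> = (\<Sum>k\<in>{a..<a+n}. vf_scale (if a \<le> k \<and> k < a + n then c (k - a) else 0) (Sv k))"
    by (rule sum.cong) auto
  also have "\<dots> = (\<Sum>k<31. vf_scale (if a \<le> k \<and> k < a + n then c (k - a) else 0) (Sv k))"
    using assms by (intro sum.mono_neutral_left) (auto simp: z)
  finally show ?thesis by (simp only: vf_lincomb_sum)
qed

text \<open>The basis fields of one parity occupy a contiguous block of indices, starting at a, so
  the block is a basis of that part by \<open>coord_hom\<close>.\<close>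

lemma hom_cdim:
  assumes "a + n \<le> 31" and par: "\<And>k. k < 31 \<Longrightarrow> spar ! k = b \<longleftrightarrow> a \<le> k \<and> k < a + n"
  shows "vf_cdim {X\<in>shc_sym. vf_hom b X} n"
  unfolding vf_cdim_def
proof (intro exI[of _ "\<lambda>i. Sv (a + i)"] conjI allI impI ballI)
  fix i assume "i < n"
  then show "Sv (a + i) \<in> {X\<in>shc_sym. vf_hom b X}"
    using Sv_sym[of "a + i"] Sv_hom[of "a + i"] par[of "a + i"] assms(1) by auto
next
  fix c i assume c: "vf_lincomb c (\<lambda>i. Sv (a + i)) n = vf_zero" and i: "i < n"
  have "coord (a + i) 0 = 0"
    using jet_scale[of 0 "a + i" 0] by (simp add: coord_def vf_eqI[of "vf_scale 0 _" 0])
  then show "c i = 0"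
    using coord_lincomb[of "a + i" "\<lambda>k. if a \<le> k \<and> k < a + n then c (k - a) else 0"] c i assms(1)
    by (simp add: lincomb_block)
next
  fix X assume X: "X \<in> {X\<in>shc_sym. vf_hom b X}"
  have "vf_lincomb (\<lambda>i. coord (a + i) X) (\<lambda>i. Sv (a + i)) n = vf_lincomb (\<lambda>k. coord k X) Sv 31"
    unfolding lincomb_block[OF assms(1)] unfolding vf_lincomb_sum
    by (rule sum.cong) (use X coord_hom[of X b] par in auto)
  then have "X = vf_lincomb (\<lambda>i. coord (a + i) X) (\<lambda>i. Sv (a + i)) n"
    using sym_expand[of X] X by simp
  then show "\<exists>c. X = vf_lincomb c (\<lambda>i. Sv (a + i)) n"
    by (rule exI[of _ "\<lambda>i. coord (a + i) X"])
qed

theorem theorem4p13: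
  shows "(\<exists>f. bij_betw f shc_sym g3_carrier
            \<and> (\<forall>X\<in>shc_sym. \<forall>Y\<in>shc_sym. \<forall>c.
                  f (vf_add (vf_scale c X) Y) = g3_add (g3_scale c (f X)) (f Y))
            \<and> (\<forall>X\<in>shc_sym. vf_hom False X \<longrightarrow> g3_even (f X))
            \<and> (\<forall>X\<in>shc_sym. vf_hom True X \<longrightarrow> g3_odd (f X))
            \<and> (\<forall>X\<in>shc_sym. \<forall>Y\<in>shc_sym. f (brk X Y) = g3_bracket (f X) (f Y)))
         \<and> vf_cdim {X\<in>shc_sym. vf_hom False X} 17
         \<and> vf_cdim {X\<in>shc_sym. vf_hom True X} 14"
proof (intro conjI exI[of _ g3_iso] ballI allI impI)
  show "bij_betw g3_iso shc_sym g3_carrier" by (rule g3_iso_bij)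
  fix X Y c assume X: "X \<in> shc_sym" and Y: "Y \<in> shc_sym"
  show "g3_iso (vf_add (vf_scale c X) Y) = g3_add (g3_scale c (g3_iso X)) (g3_iso Y)"
    using shc_sym_ok[OF X] shc_sym_ok[OF Y] by (simp add: g3_iso_def coord_linear gl_linear)
  show "g3_iso (brk X Y) = g3_bracket (g3_iso X) (g3_iso Y)" by (rule g3_iso_bracket[OF X Y])
next
  fix X assume "X \<in> shc_sym" "vf_hom False X"
  then show "g3_even (g3_iso X)" using g3_iso_parity by fastforce
next
  fix X assume "X \<in> shc_sym" "vf_hom True X"
  then show "g3_odd (g3_iso X)" using g3_iso_parity by fastforce
next
  show "vf_cdim {X\<in>shc_sym. vf_hom False X} 17"
    by (rule hom_cdim[of 0]) (auto simp: spar_nth)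
  show "vf_cdim {X\<in>shc_sym. vf_hom True X} 14"
    by (rule hom_cdim[of 17]) (auto simp: spar_nth)
qed

end
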